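(* Let $k$ be a field and $<$ a monomial preorder on $k[X]=k[x_1,\dots,x_n]$. Let $\mathbb{P}$ be an open and faithful property of local rings, and let $I$ be an ideal in $k[X]_<$. If $\mathbb{P}$ holds at all primes of $k[X]/L_<(I)$, then it also holds at all primes of $k[X]_</I$.
   Context: For $a\in\mathbb{N}^n$ write $x^a=x_1^{\alpha_1}\cdots x_n^{\alpha_n}$. A weak order on a set is a strict partial order for which incomparability is an equivalence relation. A monomial preorder on $k[X]$ is a weak order $<$ on the monomials such that for all $a,b,c\in\mathbb{N}^n$: $x^a<x^b$ if and only if $x^ax^c<x^bx^c$. For $f=\sum c_ax^a\in k[X]$, the leading part $L_<(f)$ is the sum of those terms $c_ax^a$ ($c_a\ne0$) such that no monomial $x^b$ occurring in $f$ satisfies $x^a<x^b$. Put $S_<=\{u\in k[X]\mid L_<(u)=1\}$ (a multiplicative set) and $k[X]_<=S_<^{-1}k[X]$. For $f\in k[X]_<$ choose $u\in S_<$ with $uf\in k[X]$ and set $L_<(f)=L_<(uf)$ (independent of $u$). For a subset $G\subseteq k[X]_<$, the leading ideal $L_<(G)$ is the ideal of $k[X]$ generated by all $L_<(f)$, $f\in G$. $\mathbb{P}$ denotes a property (invariant under ring isomorphism) which a local ring may or may not have; it holds at a prime $P$ of a noetherian ring $A$ if $A_P$ has $\mathbb{P}$, and $\operatorname{Spec}_{\mathbb{P}}(A)$ is the set of such primes. $\mathbb{P}$ is open if for every finitely generated algebra $A$ over a field, $\operatorname{Spec}_{\mathbb{P}}(A)$ is Zariski-open in $\operatorname{Spec}(A)$.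 $\mathbb{P}$ is faithful if for every noetherian local ring $(A,\mathfrak{m})$: (F1) if $A[t]_{\mathfrak{m}A[t]}$ has $\mathbb{P}$, where $t$ is an indeterminate, then $A$ has $\mathbb{P}$; (F2) if $A/tA$ has $\mathbb{P}$ for some non-zerodivisor $t\in\mathfrak{m}$, then $A$ has $\mathbb{P}$. *)

theory Defs
  imports
    "HOL-Algebra.UnivPoly"
    "HOL-Algebra.QuotRing"
    "HOL-Algebra.Ring_Divisibility"
    "HOL-Algebra.Generated_Rings"
    "HOL-Library.Poly_Mapping"
    "HOL-Library.Equipollence"
begin

section \<open>Localization of commutative rings\<close>

definition frac_rel :: "('a, 'm) ring_scheme \<Rightarrow> 'a set \<Rightarrow> (('a \<times> 'a) \<times> ('a \<times> 'a)) set" where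
  "frac_rel R S = {((a, s), (b, t)). a \<in> carrier R \<and> b \<in> carrier R \<and> s \<in> S \<and> t \<in> S \<and>
     (\<exists>u\<in>S. u \<otimes>\<^bsub>R\<^esub> ((a \<otimes>\<^bsub>R\<^esub> t) \<ominus>\<^bsub>R\<^esub> (b \<otimes>\<^bsub>R\<^esub> s)) = \<zero>\<^bsub>R\<^esub>)}"

definition frac :: "('a, 'm) ring_scheme \<Rightarrow> 'a set \<Rightarrow> 'a \<Rightarrow> 'a \<Rightarrow> ('a \<times> 'a) set" where
  "frac R S a s = frac_rel R S `` {(a, s)}"

text \<open>
  The unions over representatives are taken of one and the same equivalence class, as for
  \<^const>\<open>rcoset_mult\<close> in the definition of quotient rings.
\<close>

definition localization :: "('a, 'm) ring_scheme \<Rightarrow> 'a set \<Rightarrow> ('a \<times> 'a) set ring" where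
  "localization R S =
    \<lparr>carrier = (carrier R \<times> S) // frac_rel R S,
     mult = (\<lambda>x y. \<Union>(a, s)\<in>x. \<Union>(b, t)\<in>y. frac R S (a \<otimes>\<^bsub>R\<^esub> b) (s \<otimes>\<^bsub>R\<^esub> t)),
     one = frac R S \<one>\<^bsub>R\<^esub> \<one>\<^bsub>R\<^esub>,
     zero = frac R S \<zero>\<^bsub>R\<^esub> \<one>\<^bsub>R\<^esub>,
     add = (\<lambda>x y. \<Union>(a, s)\<in>x. \<Union>(b, t)\<in>y.
              frac R S ((a \<otimes>\<^bsub>R\<^esub> t) \<oplus>\<^bsub>R\<^esub> (b \<otimes>\<^bsub>R\<^esub> s)) (s \<otimes>\<^bsub>R\<^esub> t))\<rparr>"

definition localization_at :: "('a, 'm) ring_scheme \<Rightarrow> 'a set \<Rightarrow> ('a \<times> 'a) set ring" where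
  "localization_at R P = localization R (carrier R - P)"


section \<open>Prime spectra and properties of local rings\<close>

definition spec :: "('a, 'm) ring_scheme \<Rightarrow> 'a set set" where
  "spec R = {P. primeideal P R}"

definition zariski_open :: "('a, 'm) ring_scheme \<Rightarrow> 'a set set \<Rightarrow> bool" where
  "zariski_open R U \<longleftrightarrow> (\<exists>J. ideal J R \<and> U = spec R - {P \<in> spec R. J \<subseteq> P})"

definition local_ring :: "('a, 'm) ring_scheme \<Rightarrow> bool" where
  "local_ring R \<longleftrightarrow> cring R \<and> (\<exists>!M. maximalideal M R)"

text \<open>
  A property of local rings is a predicate \<open>PP\<close> on the rings whose elements are taken from a
  type \<open>'u\<close>, which serves as a universe. It extends to rings over other types along
  isomorphisms: \<open>has_property PP R\<close> says that some isomorphic copy of \<open>R\<close> in the universe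
  has \<open>PP\<close>; as \<open>PP\<close> is isomorphism invariant, the choice of the copy does not matter. All the
  definitions below, and their use, are meant for a universe that is infinite and at least as
  large as the ground field. Then all the rings involved (finitely generated algebras over the
  field; polynomial rings, quotients and localizations of rings in the universe) do have
  isomorphic copies in the universe.
\<close>

definition local_ring_property :: "('u ring \<Rightarrow> bool) \<Rightarrow> bool" where
  "local_ring_property PP \<longleftrightarrow>
    (\<forall>R S. local_ring R \<longrightarrow> local_ring S \<longrightarrow> R \<simeq> S \<longrightarrow> (PP R \<longleftrightarrow> PP S))"

text \<open>
  In the next definition \<open>local_ring S\<close> is not redundant: since \<open>\<simeq>\<close> does not mention the zero
  field of the record, an isomorphic copy of a ring need not literally be a ring.
\<close>

definition has_property :: "('u ring \<Rightarrow> bool) \<Rightarrow> ('a, 'm) ring_scheme \<Rightarrow> bool" where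
  "has_property PP R \<longleftrightarrow> (\<exists>S. local_ring S \<and> R \<simeq> S \<and> PP S)"

definition holds_at :: "('u ring \<Rightarrow> bool) \<Rightarrow> ('a, 'm) ring_scheme \<Rightarrow> 'a set \<Rightarrow> bool" where
  "holds_at PP A P \<longleftrightarrow> has_property PP (localization_at A P)"

definition spec_property :: "('u ring \<Rightarrow> bool) \<Rightarrow> ('a, 'm) ring_scheme \<Rightarrow> 'a set set" where
  "spec_property PP A = {P \<in> spec A. holds_at PP A P}"

definition fin_gen_algebra :: "('b, 'm) ring_scheme \<Rightarrow> ('b \<Rightarrow> 'a) \<Rightarrow> ('a, 'l) ring_scheme \<Rightarrow> bool" where
  "fin_gen_algebra F \<phi> A \<longleftrightarrow> cring A \<and> \<phi> \<in> ring_hom F A \<and>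
    (\<exists>E. finite E \<and> E \<subseteq> carrier A \<and> generate_ring A (\<phi> ` carrier F \<union> E) = carrier A)"

definition open_property :: "('u ring \<Rightarrow> bool) \<Rightarrow> bool" where
  "open_property PP \<longleftrightarrow>
    (\<forall>(F :: 'u ring) \<phi> (A :: 'u ring). field F \<longrightarrow> fin_gen_algebra F \<phi> A \<longrightarrow>
       zariski_open A (spec_property PP A))"

text \<open>\<open>extended_ideal A M\<close> is the extension of the ideal \<open>M\<close> of \<open>A\<close> to \<open>A[t]\<close>.\<close>

definition extended_ideal :: "('a, 'm) ring_scheme \<Rightarrow> 'a set \<Rightarrow> (nat \<Rightarrow> 'a) set" where
  "extended_ideal A M = Idl\<^bsub>UP A\<^esub> ((\<lambda>a. monom (UP A) a 0) ` M)"

definition non_zerodivisor :: "('a, 'm) ring_scheme \<Rightarrow> 'a \<Rightarrow> bool" where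
  "non_zerodivisor A t \<longleftrightarrow> t \<in> carrier A \<and> (\<forall>a\<in>carrier A. t \<otimes>\<^bsub>A\<^esub> a = \<zero>\<^bsub>A\<^esub> \<longrightarrow> a = \<zero>\<^bsub>A\<^esub>)"

definition faithful_property :: "('u ring \<Rightarrow> bool) \<Rightarrow> bool" where
  "faithful_property PP \<longleftrightarrow>
    (\<forall>(A :: 'u ring) M. noetherian_ring A \<longrightarrow> local_ring A \<longrightarrow> maximalideal M A \<longrightarrow>
       (has_property PP (localization_at (UP A) (extended_ideal A M)) \<longrightarrow> has_property PP A) \<and>
       (\<forall>t\<in>M. non_zerodivisor A t \<longrightarrow> has_property PP (A Quot (PIdl\<^bsub>A\<^esub> t)) \<longrightarrow> has_property PP A))"


section \<open>Monomial preorders and leading ideals\<close>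

text \<open>
  A monomial in the \<open>n\<close> variables \<open>x\<^sub>0, \<dots>, x\<^sub>n\<^sub>-\<^sub>1\<close> is identified with its exponent
  vector, and orders on monomials with relations on exponent vectors.
\<close>

definition exponents :: "nat \<Rightarrow> (nat \<Rightarrow>\<^sub>0 nat) set" where
  "exponents n = {a. Poly_Mapping.keys a \<subseteq> {..<n}}"

definition polynomial_ring :: "nat \<Rightarrow> ((nat \<Rightarrow>\<^sub>0 nat) \<Rightarrow>\<^sub>0 'k::field) ring" where
  "polynomial_ring n =
    \<lparr>carrier = {p. Poly_Mapping.keys p \<subseteq> exponents n}, mult = (*), one = 1, zero = 0, add = (+)\<rparr>"

definition weak_order_on :: "'a set \<Rightarrow> ('a \<Rightarrow> 'a \<Rightarrow> bool) \<Rightarrow> bool" where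
  "weak_order_on A lt \<longleftrightarrow> irreflp_on A lt \<and> transp_on A lt \<and>
    equiv A {(x, y). x \<in> A \<and> y \<in> A \<and> \<not> lt x y \<and> \<not> lt y x}"

definition monomial_preorder :: "nat \<Rightarrow> ((nat \<Rightarrow>\<^sub>0 nat) \<Rightarrow> (nat \<Rightarrow>\<^sub>0 nat) \<Rightarrow> bool) \<Rightarrow> bool" where
  "monomial_preorder n lt \<longleftrightarrow> weak_order_on (exponents n) lt \<and>
    (\<forall>a\<in>exponents n. \<forall>b\<in>exponents n. \<forall>c\<in>exponents n. lt a b \<longleftrightarrow> lt (a + c) (b + c))"

definition leading_part ::
    "((nat \<Rightarrow>\<^sub>0 nat) \<Rightarrow> (nat \<Rightarrow>\<^sub>0 nat) \<Rightarrow> bool) \<Rightarrow> ((nat \<Rightarrow>\<^sub>0 nat) \<Rightarrow>\<^sub>0 'k::field) \<Rightarrow> ((nat \<Rightarrow>\<^sub>0 nat) \<Rightarrow>\<^sub>0 'k)" where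
  "leading_part lt f =
    (\<Sum>a\<in>{a \<in> Poly_Mapping.keys f. \<not> (\<exists>b\<in>Poly_Mapping.keys f. lt a b)}.
       Poly_Mapping.single a (Poly_Mapping.lookup f a))"

definition unit_lead ::
    "nat \<Rightarrow> ((nat \<Rightarrow>\<^sub>0 nat) \<Rightarrow> (nat \<Rightarrow>\<^sub>0 nat) \<Rightarrow> bool) \<Rightarrow> ((nat \<Rightarrow>\<^sub>0 nat) \<Rightarrow>\<^sub>0 'k::field) set" where
  "unit_lead n lt = {u \<in> carrier (polynomial_ring n). leading_part lt u = 1}"

type_synonym 'k fractions = "(((nat \<Rightarrow>\<^sub>0 nat) \<Rightarrow>\<^sub>0 'k) \<times> ((nat \<Rightarrow>\<^sub>0 nat) \<Rightarrow>\<^sub>0 'k)) set"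

definition localized_polynomial_ring ::
    "nat \<Rightarrow> ((nat \<Rightarrow>\<^sub>0 nat) \<Rightarrow> (nat \<Rightarrow>\<^sub>0 nat) \<Rightarrow> bool) \<Rightarrow> 'k::field fractions ring" where
  "localized_polynomial_ring n lt = localization (polynomial_ring n) (unit_lead n lt)"

definition poly_to_localized ::
    "nat \<Rightarrow> ((nat \<Rightarrow>\<^sub>0 nat) \<Rightarrow> (nat \<Rightarrow>\<^sub>0 nat) \<Rightarrow> bool) \<Rightarrow> ((nat \<Rightarrow>\<^sub>0 nat) \<Rightarrow>\<^sub>0 'k::field) \<Rightarrow> 'k fractions" where
  "poly_to_localized n lt p = frac (polynomial_ring n) (unit_lead n lt) p 1"

text \<open>
  For \<open>f\<close> in the localized ring, some polynomial of the form \<open>u f\<close> is chosen, where \<open>u\<close> has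
  leading part \<open>1\<close>; the leading part of \<open>u f\<close> does not depend on the choice.
\<close>

definition localized_leading_part ::
    "nat \<Rightarrow> ((nat \<Rightarrow>\<^sub>0 nat) \<Rightarrow> (nat \<Rightarrow>\<^sub>0 nat) \<Rightarrow> bool) \<Rightarrow> 'k::field fractions \<Rightarrow> ((nat \<Rightarrow>\<^sub>0 nat) \<Rightarrow>\<^sub>0 'k)" where
  "localized_leading_part n lt f =
    leading_part lt (SOME p. p \<in> carrier (polynomial_ring n) \<and>
      (\<exists>u\<in>unit_lead n lt.
         poly_to_localized n lt u \<otimes>\<^bsub>localized_polynomial_ring n lt\<^esub> f = poly_to_localized n lt p))"

definition leading_ideal ::
    "nat \<Rightarrow> ((nat \<Rightarrow>\<^sub>0 nat) \<Rightarrow> (nat \<Rightarrow>\<^sub>0 nat) \<Rightarrow> bool) \<Rightarrow> 'k::field fractions set \<Rightarrow> ((nat \<Rightarrow>\<^sub>0 nat) \<Rightarrow>\<^sub>0 'k) set" where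
  "leading_ideal n lt G = Idl\<^bsub>polynomial_ring n\<^esub> (localized_leading_part n lt ` G)"

end

theory Submission
  imports Defs "HOL-Algebra.Weak_Morphisms" "HOL-Algebra.Free_Abelian_Groups"
begin

text \<open>
  A prime of \<open>k[X]\<^sub></I\<close> comes from a prime \<open>p\<close> of \<open>k[X]\<close> that contains \<open>J = I \<inter> k[X]\<close> and no
  polynomial with leading part \<open>1\<close>, and the local rings in question are those of \<open>k[X]/J\<close>. By
  noetherianity \<open>L\<^sub><(J)\<close> and \<open>L\<^sub><(p)\<close> depend on finitely many comparisons of \<open><\<close> only, and these can
  be realized by an integral weight vector \<open>w\<close> (Fourier--Motzkin elimination).

  For the order given by \<open>w\<close>, let \<open>A\<close> be the Rees algebra of \<open>k[X]\<close> with parameter \<open>T\<close>, modulo the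
  homogenization of \<open>J\<close>. Then \<open>T\<close> is a non-zerodivisor of \<open>A\<close> with \<open>A/TA = k[X]/L\<^sub><(J)\<close>, and
  \<open>A[1/T] = (k[X]/J)[T, 1/T]\<close>. As \<open>1 \<notin> L\<^sub><(p)\<close>, some prime \<open>Q\<close> of \<open>A\<close> contains both \<open>T\<close> and the
  homogenization of \<open>p\<close>. By (F2) the property holds at \<open>Q\<close>; by openness it also holds at the
  homogenization of \<open>p\<close>, whose local ring is \<open>C[T]\<close> localized at the extended maximal ideal, where
  \<open>C\<close> is the local ring of \<open>k[X]/J\<close> at \<open>p\<close>. By (F1) the property holds for \<open>C\<close>.
\<close>

section \<open>Rings of fractions\<close>

text \<open>Openness enters as stability under generization: an open set that contains
  \<open>Q\<close> contains every prime inside \<open>Q\<close>. This carries the property from the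
  special fibre \<open>T = 0\<close>, where (F2) applies, to the homogenization of \<open>p\<close>,
  at which \<open>T\<close> is invertible. The obstacle is to make the two meet. Their intersection
  is the spectrum of \<open>k[X]/L(p)\<close>, which is nonempty because the leading ideal of
  \<open>p\<close> contains 1 only if some element of \<open>p\<close> has leading part 1. Hence one
  weight must reproduce the leading parts of \<open>J\<close> and of \<open>p\<close> together.
  Agreement with the order on finitely many monomials first gives only an inclusion of leading
  ideals; equality comes from counting dimensions in each total degree.

  The same local rings arise over \<open>k[X]\<close>, \<open>k[X][T]\<close>, the Laurent
  polynomials and the Rees algebra. They are therefore described by a map from the base ring,
  through its kernel and the preimage of the units, which determine them up to isomorphism. The
  axioms on the property speak of rings over the universe type, so copies there are taken where an
  axiom is applied.\<close>

locale localize = cring R for R (structure) +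
  fixes S
  assumes S_carrier: "S \<subseteq> carrier R" and one_S: "\<one> \<in> S"
    and mult_S: "s \<in> S \<Longrightarrow> t \<in> S \<Longrightarrow> s \<otimes> t \<in> S"
begin

lemma S_closed [simp, intro]: "s \<in> S \<Longrightarrow> s \<in> carrier R"
  using S_carrier by auto

text \<open>Membership as an equation instead of a vanishing difference: calculations with fractions
  then become mere rearrangements of products and sums.\<close>

lemma frac_rel_iff:
  assumes "a \<in> carrier R" "b \<in> carrier R" "s \<in> S" "t \<in> S"
  shows "((a, s), (b, t)) \<in> frac_rel R S \<longleftrightarrow> (\<exists>u\<in>S. u \<otimes> (a \<otimes> t) = u \<otimes> (b \<otimes> s))"
proof -
  have "u \<otimes> (a \<otimes> t \<ominus> b \<otimes> s) = \<zero> \<longleftrightarrow> u \<otimes> (a \<otimes> t) = u \<otimes> (b \<otimes> s)" if "u \<in> S" for u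
  proof -
    have "u \<otimes> (a \<otimes> t \<ominus> b \<otimes> s) = u \<otimes> (a \<otimes> t) \<ominus> u \<otimes> (b \<otimes> s)"
      using assms that by (simp add: minus_eq r_distr r_minus)
    then show ?thesis using assms that by simp
  qed
  then show ?thesis using assms unfolding frac_rel_def by auto
qed

lemma equiv_frac_rel: "equiv (carrier R \<times> S) (frac_rel R S)"
proof (rule equivI)
  show "frac_rel R S \<subseteq> (carrier R \<times> S) \<times> (carrier R \<times> S)"
    unfolding frac_rel_def by auto
  show "refl_on (carrier R \<times> S) (frac_rel R S)"
    by (rule refl_onI) (use one_S frac_rel_iff in fastforce)
  show "sym (frac_rel R S)"
  proof (rule symI)
    fix x y assume xy: "(x, y) \<in> frac_rel R S"
    obtain a s b t where e: "x = (a, s)" "y = (b, t)" by (cases x, cases y)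
    have "a \<in> carrier R" "b \<in> carrier R" "s \<in> S" "t \<in> S"
      using xy unfolding e frac_rel_def by auto
    then show "(y, x) \<in> frac_rel R S" using xy unfolding e by (auto simp: frac_rel_iff) metis
  qed
  show "trans (frac_rel R S)"
  proof (rule transI)
    fix x y z assume xy: "(x, y) \<in> frac_rel R S" and yz: "(y, z) \<in> frac_rel R S"
    obtain a s b t c w where e: "x = (a, s)" "y = (b, t)" "z = (c, w)" by (cases x, cases y, cases z)
    have m: "a \<in> carrier R" "b \<in> carrier R" "c \<in> carrier R" "s \<in> S" "t \<in> S" "w \<in> S"
      using xy yz unfolding e frac_rel_def by auto
    obtain u v where uv: "u \<in> S" "v \<in> S"
      and u: "u \<otimes> (a \<otimes> t) = u \<otimes> (b \<otimes> s)" and v: "v \<otimes> (b \<otimes> w) = v \<otimes> (c \<otimes> t)"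
      using xy yz m unfolding e by (auto simp: frac_rel_iff)
    \<comment> \<open>The middle denominator \<open>t\<close> has to enter the witness: the two
      relations can be chained after multiplying the first by \<open>v \<otimes> w\<close> and the
      second by \<open>u \<otimes> s\<close>.\<close>
    have "(u \<otimes> v \<otimes> t) \<otimes> (a \<otimes> w) = (v \<otimes> w) \<otimes> (u \<otimes> (a \<otimes> t))"
      using m uv by (simp add: m_ac)
    also have "\<dots> = (u \<otimes> s) \<otimes> (v \<otimes> (b \<otimes> w))"
      unfolding u using m uv by (simp add: m_ac)
    also have "\<dots> = (u \<otimes> v \<otimes> t) \<otimes> (c \<otimes> s)"
      unfolding v using m uv by (simp add: m_ac)
    finally show "(x, z) \<in> frac_rel R S"
      using m uv mult_S unfolding e by (auto simp: frac_rel_iff)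
  qed
qed

lemma frac_eq_iff:
  assumes "a \<in> carrier R" "b \<in> carrier R" "s \<in> S" "t \<in> S"
  shows "frac R S a s = frac R S b t \<longleftrightarrow> (\<exists>u\<in>S. u \<otimes> (a \<otimes> t) = u \<otimes> (b \<otimes> s))"
  unfolding frac_def using eq_equiv_class_iff[OF equiv_frac_rel, of "(a, s)" "(b, t)"] assms
  by (simp add: frac_rel_iff)

lemma frac_eqI:
  assumes "a \<in> carrier R" "b \<in> carrier R" "s \<in> S" "t \<in> S" "u \<in> S" "u \<otimes> (a \<otimes> t) = u \<otimes> (b \<otimes> s)"
  shows "frac R S a s = frac R S b t"
  using assms frac_eq_iff by blast

lemma frac_cancel:
  assumes "a \<in> carrier R" "s \<in> S" "t \<in> S"
  shows "frac R S (t \<otimes> a) (t \<otimes> s) = frac R S a s"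
  by (rule frac_eqI[of _ _ _ _ \<one>]) (use assms one_S mult_S in \<open>auto simp: m_ac\<close>)

lemma frac_class:
  assumes "(b, t) \<in> frac R S a s" "a \<in> carrier R" "s \<in> S"
  shows "b \<in> carrier R" "t \<in> S" "frac R S b t = frac R S a s"
proof -
  have r: "((a, s), (b, t)) \<in> frac_rel R S" using assms(1) unfolding frac_def by auto
  then show "b \<in> carrier R" "t \<in> S" unfolding frac_rel_def by auto
  show "frac R S b t = frac R S a s"
    unfolding frac_def using equiv_class_eq[OF equiv_frac_rel r] by simp
qed

lemma frac_self: "a \<in> carrier R \<Longrightarrow> s \<in> S \<Longrightarrow> (a, s) \<in> frac R S a s"
  unfolding frac_def using one_S frac_rel_iff by fastforce

lemma frac_closed [simp, intro]:
  "a \<in> carrier R \<Longrightarrow> s \<in> S \<Longrightarrow> frac R S a s \<in> carrier (localization R S)"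
  unfolding localization_def frac_def by (auto intro: quotientI)

lemma localization_cases:
  assumes "x \<in> carrier (localization R S)"
  obtains a s where "a \<in> carrier R" "s \<in> S" "x = frac R S a s"
  using assms unfolding localization_def frac_def by (auto elim!: quotientE)

text \<open>The operations of \<open>localization\<close> are unions over all representatives. If
  the value does not depend on the representatives, the union is taken of one and the same set over
  a nonempty class.\<close>

lemma UN_frac:
  assumes "a \<in> carrier R" "s \<in> S" "b \<in> carrier R" "t \<in> S"
    and "\<And>a' s' b' t'. (a', s') \<in> frac R S a s \<Longrightarrow> (b', t') \<in> frac R S b t \<Longrightarrow> f a' s' b' t' = f a s b t"
  shows "(\<Union>(a, s)\<in>frac R S a s. \<Union>(b, t)\<in>frac R S b t. f a s b t) = f a s b t"
proof -
  have "(\<Union>(b', t')\<in>frac R S b t. f a' s' b' t') = f a s b t" if "(a', s') \<in> frac R S a s" for a' s'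
    by (rule UN_constant_eq[OF frac_self[OF assms(3,4)]]) (use assms(5)[OF that] in auto)
  then show ?thesis
    by (intro UN_constant_eq[OF frac_self[OF assms(1,2)]]) auto
qed

lemma frac_mult:
  assumes "a \<in> carrier R" "s \<in> S" "b \<in> carrier R" "t \<in> S"
  shows "frac R S a s \<otimes>\<^bsub>localization R S\<^esub> frac R S b t = frac R S (a \<otimes> b) (s \<otimes> t)"
proof -
  have "frac R S (a' \<otimes> b') (s' \<otimes> t') = frac R S (a \<otimes> b) (s \<otimes> t)"
    if p: "(a', s') \<in> frac R S a s" and q: "(b', t') \<in> frac R S b t" for a' s' b' t'
  proof -
    note p' = frac_class[OF p assms(1,2)] and q' = frac_class[OF q assms(3,4)]
    obtain u v where uv: "u \<in> S" "v \<in> S" and u: "u \<otimes> (a' \<otimes> s) = u \<otimes> (a \<otimes> s')"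
      and v: "v \<otimes> (b' \<otimes> t) = v \<otimes> (b \<otimes> t')"
      using p' q' frac_eq_iff assms by metis
    have "(u \<otimes> v) \<otimes> ((a' \<otimes> b') \<otimes> (s \<otimes> t)) = (u \<otimes> (a' \<otimes> s)) \<otimes> (v \<otimes> (b' \<otimes> t))"
      using p' q' uv assms by (simp add: m_ac)
    also have "\<dots> = (u \<otimes> v) \<otimes> ((a \<otimes> b) \<otimes> (s' \<otimes> t'))"
      unfolding u v using p' q' uv assms by (simp add: m_ac)
    finally show ?thesis
      by (rule frac_eqI[rotated -1]) (use p' q' uv assms mult_S in auto)
  qed
  then show ?thesis
    unfolding localization_def using UN_frac[OF assms, where f = "\<lambda>a s b t. frac R S (a \<otimes> b) (s \<otimes> t)"]
    by simp
qed

lemma frac_add: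
  assumes "a \<in> carrier R" "s \<in> S" "b \<in> carrier R" "t \<in> S"
  shows "frac R S a s \<oplus>\<^bsub>localization R S\<^esub> frac R S b t = frac R S (a \<otimes> t \<oplus> b \<otimes> s) (s \<otimes> t)"
proof -
  have "frac R S (a' \<otimes> t' \<oplus> b' \<otimes> s') (s' \<otimes> t') = frac R S (a \<otimes> t \<oplus> b \<otimes> s) (s \<otimes> t)"
    if p: "(a', s') \<in> frac R S a s" and q: "(b', t') \<in> frac R S b t" for a' s' b' t'
  proof -
    note p' = frac_class[OF p assms(1,2)] and q' = frac_class[OF q assms(3,4)]
    obtain u v where uv: "u \<in> S" "v \<in> S" and u: "u \<otimes> (a' \<otimes> s) = u \<otimes> (a \<otimes> s')"
      and v: "v \<otimes> (b' \<otimes> t) = v \<otimes> (b \<otimes> t')"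
      using p' q' frac_eq_iff assms by metis
    have "(u \<otimes> v) \<otimes> ((a' \<otimes> t' \<oplus> b' \<otimes> s') \<otimes> (s \<otimes> t))
        = (u \<otimes> (a' \<otimes> s)) \<otimes> (v \<otimes> t \<otimes> t') \<oplus> (v \<otimes> (b' \<otimes> t)) \<otimes> (u \<otimes> s \<otimes> s')"
      using p' q' uv assms by (simp add: m_ac l_distr r_distr)
    also have "\<dots> = (u \<otimes> v) \<otimes> ((a \<otimes> t \<oplus> b \<otimes> s) \<otimes> (s' \<otimes> t'))"
      unfolding u v using p' q' uv assms by (simp add: m_ac l_distr r_distr)
    finally show ?thesis
      by (rule frac_eqI[rotated -1]) (use p' q' uv assms mult_S in auto)
  qed
  then show ?thesis
    unfolding localization_def
    using UN_frac[OF assms, where f = "\<lambda>a s b t. frac R S (a \<otimes> t \<oplus> b \<otimes> s) (s \<otimes> t)"]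
    by simp
qed

lemma localization_one: "\<one>\<^bsub>localization R S\<^esub> = frac R S \<one> \<one>"
  and localization_zero: "\<zero>\<^bsub>localization R S\<^esub> = frac R S \<zero> \<one>"
  by (simp_all add: localization_def)

lemma frac_zero: "s \<in> S \<Longrightarrow> frac R S \<zero> s = frac R S \<zero> \<one>"
  by (rule frac_eqI[of _ _ _ _ \<one>]) (use one_S in auto)

lemma cring_localization: "cring (localization R S)"
proof (rule cringI)
  let ?L = "localization R S"
  note frac_simps = frac_mult frac_add localization_one localization_zero mult_S one_S
  show "abelian_group ?L"
  proof (rule abelian_groupI)
    fix x y assume "x \<in> carrier ?L" "y \<in> carrier ?L"
    then show "x \<oplus>\<^bsub>?L\<^esub> y \<in> carrier ?L" by (elim localization_cases) (simp add: frac_simps)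
  next
    show "\<zero>\<^bsub>?L\<^esub> \<in> carrier ?L" by (simp add: frac_simps)
  next
    fix x y z assume "x \<in> carrier ?L" "y \<in> carrier ?L" "z \<in> carrier ?L"
    then show "x \<oplus>\<^bsub>?L\<^esub> y \<oplus>\<^bsub>?L\<^esub> z = x \<oplus>\<^bsub>?L\<^esub> (y \<oplus>\<^bsub>?L\<^esub> z)"
      by (elim localization_cases) (simp add: frac_simps m_ac a_ac l_distr r_distr)
  next
    fix x y assume "x \<in> carrier ?L" "y \<in> carrier ?L"
    then show "x \<oplus>\<^bsub>?L\<^esub> y = y \<oplus>\<^bsub>?L\<^esub> x"
      by (elim localization_cases) (simp add: frac_simps m_ac a_ac)
  next
    fix x assume "x \<in> carrier ?L"
    then show "\<zero>\<^bsub>?L\<^esub> \<oplus>\<^bsub>?L\<^esub> x = x"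
      by (elim localization_cases) (simp add: frac_simps)
  next
    fix x assume "x \<in> carrier ?L"
    then obtain a s where a: "a \<in> carrier R" "s \<in> S" "x = frac R S a s" by (elim localization_cases)
    have "\<ominus> a \<otimes> s \<oplus> a \<otimes> s = \<zero>"
      using a by (metis S_closed a_inv_closed l_distr l_neg l_null)
    then have "frac R S (\<ominus> a) s \<oplus>\<^bsub>?L\<^esub> x = \<zero>\<^bsub>?L\<^esub>"
      using a frac_zero[of "s \<otimes> s"] by (simp add: frac_simps)
    then show "\<exists>y\<in>carrier ?L. y \<oplus>\<^bsub>?L\<^esub> x = \<zero>\<^bsub>?L\<^esub>" using a by blast
  qed
  show "Group.comm_monoid ?L"
  proof (rule comm_monoidI)
    fix x y assume "x \<in> carrier ?L" "y \<in> carrier ?L"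
    then show "x \<otimes>\<^bsub>?L\<^esub> y \<in> carrier ?L" by (elim localization_cases) (simp add: frac_simps)
  next
    show "\<one>\<^bsub>?L\<^esub> \<in> carrier ?L" by (simp add: frac_simps)
  next
    fix x y z assume "x \<in> carrier ?L" "y \<in> carrier ?L" "z \<in> carrier ?L"
    then show "x \<otimes>\<^bsub>?L\<^esub> y \<otimes>\<^bsub>?L\<^esub> z = x \<otimes>\<^bsub>?L\<^esub> (y \<otimes>\<^bsub>?L\<^esub> z)"
      by (elim localization_cases) (simp add: frac_simps m_ac)
  next
    fix x assume "x \<in> carrier ?L"
    then show "\<one>\<^bsub>?L\<^esub> \<otimes>\<^bsub>?L\<^esub> x = x"
      by (elim localization_cases) (simp add: frac_simps)
  next
    fix x y assume "x \<in> carrier ?L" "y \<in> carrier ?L"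
    then show "x \<otimes>\<^bsub>?L\<^esub> y = y \<otimes>\<^bsub>?L\<^esub> x"
      by (elim localization_cases) (simp add: frac_simps m_ac)
  qed
  fix x y z assume "x \<in> carrier ?L" "y \<in> carrier ?L" "z \<in> carrier ?L"
  then obtain a s b t c u where *: "a \<in> carrier R" "s \<in> S" "x = frac R S a s"
    "b \<in> carrier R" "t \<in> S" "y = frac R S b t" "c \<in> carrier R" "u \<in> S" "z = frac R S c u"
    by (elim localization_cases)
  have "frac R S (a \<otimes> c \<otimes> (t \<otimes> u) \<oplus> b \<otimes> c \<otimes> (s \<otimes> u)) (s \<otimes> u \<otimes> (t \<otimes> u))
      = frac R S (u \<otimes> ((a \<otimes> t \<oplus> b \<otimes> s) \<otimes> c)) (u \<otimes> (s \<otimes> t \<otimes> u))"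
    using * by (simp add: m_ac l_distr r_distr)
  also have "\<dots> = frac R S ((a \<otimes> t \<oplus> b \<otimes> s) \<otimes> c) (s \<otimes> t \<otimes> u)"
    by (rule frac_cancel) (use * mult_S in auto)
  finally show "(x \<oplus>\<^bsub>?L\<^esub> y) \<otimes>\<^bsub>?L\<^esub> z = x \<otimes>\<^bsub>?L\<^esub> z \<oplus>\<^bsub>?L\<^esub> y \<otimes>\<^bsub>?L\<^esub> z"
    using * by (simp add: frac_simps)
qed

lemma frac_hom: "(\<lambda>a. frac R S a \<one>) \<in> ring_hom R (localization R S)"
  by (rule ring_hom_memI) (auto simp: frac_mult frac_add localization_one one_S)

lemma frac_eq_zero_iff:
  assumes "a \<in> carrier R"
  shows "frac R S a \<one> = \<zero>\<^bsub>localization R S\<^esub> \<longleftrightarrow> (\<exists>u\<in>S. u \<otimes> a = \<zero>)"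
  using assms one_S by (auto simp: localization_zero frac_eq_iff)

lemma frac_unit:
  assumes "s \<in> S" "t \<in> S"
  shows "frac R S s t \<in> Units (localization R S)"
proof -
  have "frac R S s t \<otimes>\<^bsub>localization R S\<^esub> frac R S t s = \<one>\<^bsub>localization R S\<^esub>"
    using assms frac_cancel[of \<one> \<one> "s \<otimes> t"] one_S mult_S
    by (simp add: frac_mult localization_one m_comm)
  moreover have "frac R S t s \<otimes>\<^bsub>localization R S\<^esub> frac R S s t = \<one>\<^bsub>localization R S\<^esub>"
    using assms frac_cancel[of \<one> \<one> "s \<otimes> t"] one_S mult_S
    by (simp add: frac_mult localization_one m_comm)
  ultimately show ?thesis using assms unfolding Units_def by blast
qed

end

text \<open>Every element of \<open>B\<close> is a fraction of images from \<open>A\<close>, without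
  a named set of denominators. Localizations and surjections are both of this kind, and so are
  composites; a local ring of a quotient can thus be treated as a single map.\<close>

definition is_fraction_map :: "('a, 'm) ring_scheme \<Rightarrow> ('a \<Rightarrow> 'b) \<Rightarrow> ('b, 'l) ring_scheme \<Rightarrow> bool" where
  "is_fraction_map A \<psi> B \<longleftrightarrow> cring A \<and> cring B \<and> \<psi> \<in> ring_hom A B \<and>
     (\<forall>x\<in>carrier B. \<exists>a\<in>carrier A. \<exists>s\<in>carrier A. \<psi> s \<in> Units B \<and> x \<otimes>\<^bsub>B\<^esub> \<psi> s = \<psi> a)"

lemma (in localize) is_fraction_map_localization:
  "is_fraction_map R (\<lambda>a. frac R S a \<one>) (localization R S)"
  unfolding is_fraction_map_def
proof (intro conjI ballI)
  fix x assume "x \<in> carrier (localization R S)"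
  then obtain a s where a: "a \<in> carrier R" "s \<in> S" "x = frac R S a s" by (elim localization_cases)
  have "x \<otimes>\<^bsub>localization R S\<^esub> frac R S s \<one> = frac R S a \<one>"
    using a one_S frac_cancel[of a \<one> s] by (simp add: frac_mult m_comm)
  then show "\<exists>a\<in>carrier R. \<exists>s\<in>carrier R. frac R S s \<one> \<in> Units (localization R S) \<and>
      x \<otimes>\<^bsub>localization R S\<^esub> frac R S s \<one> = frac R S a \<one>"
    using a frac_unit one_S by blast
qed (use is_cring cring_localization frac_hom in auto)

lemma is_fraction_map_surj:
  assumes "cring A" "cring B" "h \<in> ring_hom A B" "h ` carrier A = carrier B"
  shows "is_fraction_map A h B"
proof -
  interpret A: cring A by fact
  interpret B: cring B by fact
  show ?thesis
    unfolding is_fraction_map_def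
  proof (intro conjI ballI)
    fix x assume "x \<in> carrier B"
    then obtain a where "a \<in> carrier A" "x = h a" using assms(4) by auto
    then have "x \<otimes>\<^bsub>B\<^esub> h \<one>\<^bsub>A\<^esub> = h a" "h \<one>\<^bsub>A\<^esub> \<in> Units B"
      using assms(3) by (auto simp: ring_hom_one[OF assms(3)] ring_hom_closed[OF assms(3)])
    then show "\<exists>a\<in>carrier A. \<exists>s\<in>carrier A. h s \<in> Units B \<and> x \<otimes>\<^bsub>B\<^esub> h s = h a"
      using \<open>a \<in> carrier A\<close> by blast
  qed (use assms in auto)
qed

lemma ring_hom_Units:
  assumes "cring A" "cring B" "h \<in> ring_hom A B" "u \<in> Units A"
  shows "h u \<in> Units B"
proof -
  interpret A: cring A by fact
  have "u \<otimes>\<^bsub>A\<^esub> inv\<^bsub>A\<^esub> u = \<one>\<^bsub>A\<^esub>" "inv\<^bsub>A\<^esub> u \<otimes>\<^bsub>A\<^esub> u = \<one>\<^bsub>A\<^esub>" "u \<in> carrier A" "inv\<^bsub>A\<^esub> u \<in> carrier A"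
    using assms(4) by auto
  then have "h u \<otimes>\<^bsub>B\<^esub> h (inv\<^bsub>A\<^esub> u) = \<one>\<^bsub>B\<^esub>" "h (inv\<^bsub>A\<^esub> u) \<otimes>\<^bsub>B\<^esub> h u = \<one>\<^bsub>B\<^esub>" "h u \<in> carrier B" "h (inv\<^bsub>A\<^esub> u) \<in> carrier B"
    using ring_hom_memE[OF assms(3)] by metis+
  then show ?thesis unfolding Units_def by blast
qed

lemma is_fraction_map_trans:
  assumes "is_fraction_map A \<psi> B" "is_fraction_map B \<sigma> C"
  shows "is_fraction_map A (\<sigma> \<circ> \<psi>) C"
proof -
  interpret A: cring A using assms unfolding is_fraction_map_def by auto
  interpret B: cring B using assms unfolding is_fraction_map_def by auto
  interpret C: cring C using assms unfolding is_fraction_map_def by auto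
  have hp: "\<psi> \<in> ring_hom A B" and hs: "\<sigma> \<in> ring_hom B C"
    using assms unfolding is_fraction_map_def by auto
  note p = ring_hom_memE[OF hp] and s = ring_hom_memE[OF hs]
  show ?thesis
    unfolding is_fraction_map_def
  proof (intro conjI ballI)
    fix w assume w: "w \<in> carrier C"
    \<comment> \<open>\<open>w\<close> is a fraction over \<open>B\<close>, and its numerator and
      denominator are in turn fractions over \<open>A\<close>; clearing both denominators gives a
      fraction over \<open>A\<close>.\<close>
    obtain b s' where 1: "b \<in> carrier B" "s' \<in> carrier B" "\<sigma> s' \<in> Units C" "w \<otimes>\<^bsub>C\<^esub> \<sigma> s' = \<sigma> b"
      using assms w unfolding is_fraction_map_def by blast
    obtain a1 s1 where 2: "a1 \<in> carrier A" "s1 \<in> carrier A" "\<psi> s1 \<in> Units B" "s' \<otimes>\<^bsub>B\<^esub> \<psi> s1 = \<psi> a1"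
      using assms 1 unfolding is_fraction_map_def by blast
    obtain a2 s2 where 3: "a2 \<in> carrier A" "s2 \<in> carrier A" "\<psi> s2 \<in> Units B" "b \<otimes>\<^bsub>B\<^esub> \<psi> s2 = \<psi> a2"
      using assms 1 unfolding is_fraction_map_def by blast
    have u: "\<sigma> (\<psi> s1) \<in> Units C" "\<sigma> (\<psi> s2) \<in> Units C"
      using ring_hom_Units[OF B.is_cring C.is_cring hs] 2 3 by auto
    have e1: "\<sigma> (\<psi> (a1 \<otimes>\<^bsub>A\<^esub> s2)) = \<sigma> s' \<otimes>\<^bsub>C\<^esub> \<sigma> (\<psi> s1) \<otimes>\<^bsub>C\<^esub> \<sigma> (\<psi> s2)"
      using 1 2 3 p s by (metis B.m_closed)
    have e2: "\<sigma> (\<psi> (a2 \<otimes>\<^bsub>A\<^esub> s1)) = \<sigma> b \<otimes>\<^bsub>C\<^esub> \<sigma> (\<psi> s2) \<otimes>\<^bsub>C\<^esub> \<sigma> (\<psi> s1)"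
      using 1 2 3 p s by (metis B.m_closed)
    have "\<sigma> (\<psi> (a1 \<otimes>\<^bsub>A\<^esub> s2)) \<in> Units C" unfolding e1 using 1 u by auto
    moreover have "w \<otimes>\<^bsub>C\<^esub> \<sigma> (\<psi> (a1 \<otimes>\<^bsub>A\<^esub> s2)) = \<sigma> (\<psi> (a2 \<otimes>\<^bsub>A\<^esub> s1))"
    proof -
      have "w \<otimes>\<^bsub>C\<^esub> (\<sigma> s' \<otimes>\<^bsub>C\<^esub> \<sigma> (\<psi> s1) \<otimes>\<^bsub>C\<^esub> \<sigma> (\<psi> s2)) = (w \<otimes>\<^bsub>C\<^esub> \<sigma> s') \<otimes>\<^bsub>C\<^esub> \<sigma> (\<psi> s2) \<otimes>\<^bsub>C\<^esub> \<sigma> (\<psi> s1)"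
        using w s(1)[OF 1(2)] u[THEN C.Units_closed] by (simp add: C.m_ac)
      then show ?thesis unfolding e1 e2 1(4) .
    qed
    moreover have "a1 \<otimes>\<^bsub>A\<^esub> s2 \<in> carrier A" "a2 \<otimes>\<^bsub>A\<^esub> s1 \<in> carrier A" using 2 3 by auto
    ultimately show "\<exists>a\<in>carrier A. \<exists>s\<in>carrier A. (\<sigma> \<circ> \<psi>) s \<in> Units C \<and> w \<otimes>\<^bsub>C\<^esub> (\<sigma> \<circ> \<psi>) s = (\<sigma> \<circ> \<psi>) a"
      unfolding comp_def by blast
  qed (use A.is_cring C.is_cring ring_hom_trans[OF hp hs] in auto)
qed

lemma hom_eq_iff_diff:
  assumes "cring A" "cring B" "h \<in> ring_hom A B" "a \<in> carrier A" "b \<in> carrier A"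
  shows "h a = h b \<longleftrightarrow> h (a \<ominus>\<^bsub>A\<^esub> b) = \<zero>\<^bsub>B\<^esub>"
proof -
  interpret A: cring A by fact
  interpret B: cring B by fact
  interpret h: ring_hom_cring A B h
    using assms by (intro UnivPoly.ring_hom_cringI) auto
  have "h (a \<ominus>\<^bsub>A\<^esub> b) = h a \<ominus>\<^bsub>B\<^esub> h b"
    using assms by (simp add: A.minus_eq B.minus_eq)
  then show ?thesis using assms by simp
qed

text \<open>Both rings consist of fractions over \<open>A\<close>. Equal preimages of the units
  admit the same denominators, and equal kernels identify the same fractions.\<close>

lemma is_fraction_map_unique:
  assumes B: "is_fraction_map A \<psi> B" and C: "is_fraction_map A \<sigma> C"
    and ker: "\<And>a. a \<in> carrier A \<Longrightarrow> \<psi> a = \<zero>\<^bsub>B\<^esub> \<longleftrightarrow> \<sigma> a = \<zero>\<^bsub>C\<^esub>"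
    and uni: "\<And>a. a \<in> carrier A \<Longrightarrow> \<psi> a \<in> Units B \<longleftrightarrow> \<sigma> a \<in> Units C"
  shows "B \<simeq> C"
proof -
  interpret A: cring A using B unfolding is_fraction_map_def by auto
  interpret B: cring B using B unfolding is_fraction_map_def by auto
  interpret C: cring C using C unfolding is_fraction_map_def by auto
  have hp: "\<psi> \<in> ring_hom A B" and hs: "\<sigma> \<in> ring_hom A C"
    using B C unfolding is_fraction_map_def by auto
  note p = ring_hom_memE[OF hp] and s = ring_hom_memE[OF hs]
  \<comment> \<open>The graph of the isomorphism: \<open>x\<close> and \<open>y\<close> are given by
    the same fraction \<open>a/s\<close>.\<close>
  define rel where "rel x y \<longleftrightarrow> x \<in> carrier B \<and> y \<in> carrier C \<and>
     (\<exists>a\<in>carrier A. \<exists>s\<in>carrier A. \<psi> s \<in> Units B \<and> x \<otimes>\<^bsub>B\<^esub> \<psi> s = \<psi> a \<and> y \<otimes>\<^bsub>C\<^esub> \<sigma> s = \<sigma> a)" for x y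
  have eq_iff: "\<psi> a = \<psi> b \<longleftrightarrow> \<sigma> a = \<sigma> b" if "a \<in> carrier A" "b \<in> carrier A" for a b
    using that ker[of "a \<ominus>\<^bsub>A\<^esub> b"] hom_eq_iff_diff[OF A.is_cring B.is_cring hp]
      hom_eq_iff_diff[OF A.is_cring C.is_cring hs] by auto
  have ex1: "\<exists>y. rel x y" if x: "x \<in> carrier B" for x
  proof -
    obtain a s where 1: "a \<in> carrier A" "s \<in> carrier A" "\<psi> s \<in> Units B" "x \<otimes>\<^bsub>B\<^esub> \<psi> s = \<psi> a"
      using B x unfolding is_fraction_map_def by blast
    then have "\<sigma> s \<in> Units C" using uni by auto
    then have "\<sigma> a \<otimes>\<^bsub>C\<^esub> inv\<^bsub>C\<^esub> \<sigma> s \<otimes>\<^bsub>C\<^esub> \<sigma> s = \<sigma> a" "\<sigma> a \<otimes>\<^bsub>C\<^esub> inv\<^bsub>C\<^esub> \<sigma> s \<in> carrier C"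
      using 1 s(1) C.m_assoc by simp_all
    then have "rel x (\<sigma> a \<otimes>\<^bsub>C\<^esub> inv\<^bsub>C\<^esub> \<sigma> s)"
      unfolding rel_def using x 1 by blast
    then show ?thesis ..
  qed
  have ex2: "\<exists>x. rel x y" if y: "y \<in> carrier C" for y
  proof -
    obtain a s where 1: "a \<in> carrier A" "s \<in> carrier A" "\<sigma> s \<in> Units C" "y \<otimes>\<^bsub>C\<^esub> \<sigma> s = \<sigma> a"
      using C y unfolding is_fraction_map_def by blast
    then have "\<psi> s \<in> Units B" using uni by auto
    then have "\<psi> a \<otimes>\<^bsub>B\<^esub> inv\<^bsub>B\<^esub> \<psi> s \<otimes>\<^bsub>B\<^esub> \<psi> s = \<psi> a" "\<psi> a \<otimes>\<^bsub>B\<^esub> inv\<^bsub>B\<^esub> \<psi> s \<in> carrier B"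
      using 1 p(1) B.m_assoc by simp_all
    then have "rel (\<psi> a \<otimes>\<^bsub>B\<^esub> inv\<^bsub>B\<^esub> \<psi> s) y"
      unfolding rel_def using y 1 \<open>\<psi> s \<in> Units B\<close> by blast
    then show ?thesis ..
  qed
  have cross: "x \<otimes>\<^bsub>B\<^esub> \<psi> (s1 \<otimes>\<^bsub>A\<^esub> s2) = \<psi> (a1 \<otimes>\<^bsub>A\<^esub> s2)"
    if "x \<in> carrier B" "a1 \<in> carrier A" "s1 \<in> carrier A" "s2 \<in> carrier A" "x \<otimes>\<^bsub>B\<^esub> \<psi> s1 = \<psi> a1" for x a1 s1 s2
    using that p(1,2) by (simp add: B.m_assoc[symmetric])
  have cross': "x \<otimes>\<^bsub>C\<^esub> \<sigma> (s1 \<otimes>\<^bsub>A\<^esub> s2) = \<sigma> (a1 \<otimes>\<^bsub>A\<^esub> s2)"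
    if "x \<in> carrier C" "a1 \<in> carrier A" "s1 \<in> carrier A" "s2 \<in> carrier A" "x \<otimes>\<^bsub>C\<^esub> \<sigma> s1 = \<sigma> a1" for x a1 s1 s2
    using that s(1,2) by (simp add: C.m_assoc[symmetric])
  have relI: "rel x y" if "x \<in> carrier B" "y \<in> carrier C" "a \<in> carrier A" "s \<in> carrier A" "\<psi> s \<in> Units B"
    "x \<otimes>\<^bsub>B\<^esub> \<psi> s = \<psi> a" "y \<otimes>\<^bsub>C\<^esub> \<sigma> s = \<sigma> a" for x y a s
    using that unfolding rel_def by blast
  have relE: "\<exists>a s. a \<in> carrier A \<and> s \<in> carrier A \<and> \<psi> s \<in> Units B \<and> x \<otimes>\<^bsub>B\<^esub> \<psi> s = \<psi> a \<and> y \<otimes>\<^bsub>C\<^esub> \<sigma> s = \<sigma> a"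
    if "rel x y" for x y
    using that unfolding rel_def Bex_def by simp
  define den where "den x y a s \<longleftrightarrow> x \<otimes>\<^bsub>B\<^esub> \<psi> s = \<psi> a \<and> y \<otimes>\<^bsub>C\<^esub> \<sigma> s = \<sigma> a" for x y a s
  \<comment> \<open>Two pairs of the graph are written over the common denominator
    \<open>s \<otimes> s'\<close>, so that sums and comparisons reduce to numerators.\<close>
  have common: "\<exists>a\<in>carrier A. \<exists>a'\<in>carrier A. \<exists>s\<in>carrier A. \<psi> s \<in> Units B \<and> \<sigma> s \<in> Units C \<and> den x y a s \<and> den x' y' a' s"
    if r1: "rel x y" and r2: "rel x' y'" for x y x' y'
  proof -
    obtain a s where 1: "a \<in> carrier A" "s \<in> carrier A" "\<psi> s \<in> Units B" "x \<otimes>\<^bsub>B\<^esub> \<psi> s = \<psi> a" "y \<otimes>\<^bsub>C\<^esub> \<sigma> s = \<sigma> a"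
      using relE[OF r1] by metis
    obtain a' s' where 2: "a' \<in> carrier A" "s' \<in> carrier A" "\<psi> s' \<in> Units B" "x' \<otimes>\<^bsub>B\<^esub> \<psi> s' = \<psi> a'" "y' \<otimes>\<^bsub>C\<^esub> \<sigma> s' = \<sigma> a'"
      using relE[OF r2] by metis
    have xy: "x \<in> carrier B" "x' \<in> carrier B" "y \<in> carrier C" "y' \<in> carrier C"
      using r1 r2 unfolding rel_def by auto
    have 3: "\<psi> (s \<otimes>\<^bsub>A\<^esub> s') \<in> Units B" using 1 2 p by auto
    moreover have "\<sigma> (s \<otimes>\<^bsub>A\<^esub> s') \<in> Units C" using 3 uni 1 2 by auto
    moreover have "s' \<otimes>\<^bsub>A\<^esub> s = s \<otimes>\<^bsub>A\<^esub> s'" using 1 2 by (metis A.m_comm)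
    then have "x \<otimes>\<^bsub>B\<^esub> \<psi> (s \<otimes>\<^bsub>A\<^esub> s') = \<psi> (a \<otimes>\<^bsub>A\<^esub> s')" "y \<otimes>\<^bsub>C\<^esub> \<sigma> (s \<otimes>\<^bsub>A\<^esub> s') = \<sigma> (a \<otimes>\<^bsub>A\<^esub> s')"
      "x' \<otimes>\<^bsub>B\<^esub> \<psi> (s \<otimes>\<^bsub>A\<^esub> s') = \<psi> (a' \<otimes>\<^bsub>A\<^esub> s)" "y' \<otimes>\<^bsub>C\<^esub> \<sigma> (s \<otimes>\<^bsub>A\<^esub> s') = \<sigma> (a' \<otimes>\<^bsub>A\<^esub> s)"
      using cross[OF xy(1) 1(1,2) 2(2) 1(4)] cross'[OF xy(3) 1(1,2) 2(2) 1(5)]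
        cross[OF xy(2) 2(1,2) 1(2) 2(4)] cross'[OF xy(4) 2(1,2) 1(2) 2(5)] by simp_all
    moreover have "a \<otimes>\<^bsub>A\<^esub> s' \<in> carrier A" "a' \<otimes>\<^bsub>A\<^esub> s \<in> carrier A" "s \<otimes>\<^bsub>A\<^esub> s' \<in> carrier A"
      using 1 2 by simp_all
    ultimately show ?thesis unfolding den_def Bex_def by metis
  qed
  have relD: "x \<in> carrier B" "y \<in> carrier C" if "rel x y" for x y
    using that unfolding rel_def by auto
  have inj: "x = x' \<longleftrightarrow> y = y'" if r: "rel x y" "rel x' y'" for x y x' y'
  proof -
    obtain a a' s where c: "a \<in> carrier A" "a' \<in> carrier A" "s \<in> carrier A" "\<psi> s \<in> Units B" "\<sigma> s \<in> Units C"
      "x \<otimes>\<^bsub>B\<^esub> \<psi> s = \<psi> a" "y \<otimes>\<^bsub>C\<^esub> \<sigma> s = \<sigma> a" "x' \<otimes>\<^bsub>B\<^esub> \<psi> s = \<psi> a'" "y' \<otimes>\<^bsub>C\<^esub> \<sigma> s = \<sigma> a'"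
      using common[OF r] unfolding den_def Bex_def by metis
    have "x = x' \<longleftrightarrow> x \<otimes>\<^bsub>B\<^esub> \<psi> s = x' \<otimes>\<^bsub>B\<^esub> \<psi> s"
      using c relD[OF r(1)] relD[OF r(2)] by (metis B.Units_closed B.Units_l_cancel B.m_comm)
    also have "\<dots> \<longleftrightarrow> y \<otimes>\<^bsub>C\<^esub> \<sigma> s = y' \<otimes>\<^bsub>C\<^esub> \<sigma> s"
      using c eq_iff by simp
    also have "\<dots> \<longleftrightarrow> y = y'"
      using c relD[OF r(1)] relD[OF r(2)] by (metis C.Units_closed C.Units_l_cancel C.m_comm)
    finally show ?thesis .
  qed
  define h where "h x = (SOME y. rel x y)" for x
  have h: "rel x (h x)" if "x \<in> carrier B" for x
    unfolding h_def using ex1[OF that] by (rule someI_ex)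
  have hI: "h x = y" if "rel x y" for x y
    using inj[OF h that] relD[OF that] by auto
  have "h \<in> ring_iso B C"
  proof (rule ring_iso_memI)
    fix x assume x: "x \<in> carrier B"
    show "h x \<in> carrier C" using h[OF x] relD by auto
    fix y assume y: "y \<in> carrier B"
    obtain a a' s where c: "a \<in> carrier A" "a' \<in> carrier A" "s \<in> carrier A" "\<psi> s \<in> Units B" "\<sigma> s \<in> Units C"
      "x \<otimes>\<^bsub>B\<^esub> \<psi> s = \<psi> a" "h x \<otimes>\<^bsub>C\<^esub> \<sigma> s = \<sigma> a" "y \<otimes>\<^bsub>B\<^esub> \<psi> s = \<psi> a'" "h y \<otimes>\<^bsub>C\<^esub> \<sigma> s = \<sigma> a'"
      using common[OF h[OF x] h[OF y]] unfolding den_def Bex_def by metis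
    have cl: "h x \<in> carrier C" "h y \<in> carrier C" "\<psi> s \<in> carrier B" "\<sigma> s \<in> carrier C"
      using relD(2)[OF h[OF x]] relD(2)[OF h[OF y]] c by auto
    have "(x \<otimes>\<^bsub>B\<^esub> y) \<otimes>\<^bsub>B\<^esub> (\<psi> s \<otimes>\<^bsub>B\<^esub> \<psi> s) = (x \<otimes>\<^bsub>B\<^esub> \<psi> s) \<otimes>\<^bsub>B\<^esub> (y \<otimes>\<^bsub>B\<^esub> \<psi> s)"
      using x y cl by (simp add: B.m_ac)
    then have 1: "(x \<otimes>\<^bsub>B\<^esub> y) \<otimes>\<^bsub>B\<^esub> \<psi> (s \<otimes>\<^bsub>A\<^esub> s) = \<psi> (a \<otimes>\<^bsub>A\<^esub> a')" using c p by simp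
    have "(h x \<otimes>\<^bsub>C\<^esub> h y) \<otimes>\<^bsub>C\<^esub> (\<sigma> s \<otimes>\<^bsub>C\<^esub> \<sigma> s) = (h x \<otimes>\<^bsub>C\<^esub> \<sigma> s) \<otimes>\<^bsub>C\<^esub> (h y \<otimes>\<^bsub>C\<^esub> \<sigma> s)"
      using x y cl by (simp add: C.m_ac)
    then have 2: "(h x \<otimes>\<^bsub>C\<^esub> h y) \<otimes>\<^bsub>C\<^esub> \<sigma> (s \<otimes>\<^bsub>A\<^esub> s) = \<sigma> (a \<otimes>\<^bsub>A\<^esub> a')" using c s by simp
    have "\<psi> (s \<otimes>\<^bsub>A\<^esub> s) \<in> Units B" using c p by auto
    then show "h (x \<otimes>\<^bsub>B\<^esub> y) = h x \<otimes>\<^bsub>C\<^esub> h y"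
      using c x y cl by (intro hI relI[OF _ _ _ _ _ 1 2]) auto
    have 1: "(x \<oplus>\<^bsub>B\<^esub> y) \<otimes>\<^bsub>B\<^esub> \<psi> s = \<psi> (a \<oplus>\<^bsub>A\<^esub> a')"
      using x y cl c p by (simp add: B.l_distr)
    have 2: "(h x \<oplus>\<^bsub>C\<^esub> h y) \<otimes>\<^bsub>C\<^esub> \<sigma> s = \<sigma> (a \<oplus>\<^bsub>A\<^esub> a')"
      using x y cl c s by (simp add: C.l_distr)
    show "h (x \<oplus>\<^bsub>B\<^esub> y) = h x \<oplus>\<^bsub>C\<^esub> h y"
      using c x y cl by (intro hI relI[OF _ _ _ _ _ 1 2]) auto
  next
    show "h \<one>\<^bsub>B\<^esub> = \<one>\<^bsub>C\<^esub>"
      by (intro hI relI[of _ _ "\<one>\<^bsub>A\<^esub>" "\<one>\<^bsub>A\<^esub>"]) (auto simp: p(4) s(4))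
    show "bij_betw h (carrier B) (carrier C)"
      unfolding bij_betw_def
    proof
      show "inj_on h (carrier B)" using inj h by (intro inj_onI) metis
      show "h ` carrier B = carrier C"
      proof
        show "h ` carrier B \<subseteq> carrier C" by (auto intro: relD(2)[OF h])
        show "carrier C \<subseteq> h ` carrier B" using ex2 hI relD by (metis image_eqI subsetI)
      qed
    qed
  qed
  then show ?thesis unfolding is_ring_iso_def by auto
qed

section \<open>Local rings of quotients at primes\<close>

lemma cring_idealI:
  fixes R (structure)
  assumes "cring R" "I \<subseteq> carrier R" "\<zero> \<in> I"
    and add: "\<And>a b. a \<in> I \<Longrightarrow> b \<in> I \<Longrightarrow> a \<oplus> b \<in> I"
    and mult: "\<And>a x. a \<in> I \<Longrightarrow> x \<in> carrier R \<Longrightarrow> x \<otimes> a \<in> I"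
  shows "ideal I R"
proof -
  interpret cring R by fact
  have neg: "\<ominus> a \<in> I" if "a \<in> I" for a
  proof -
    have "\<ominus> \<one> \<otimes> a = \<ominus> a" using that assms(2) by (simp add: subset_iff l_minus)
    then show ?thesis using mult[OF that, of "\<ominus> \<one>"] by simp
  qed
  show ?thesis
  proof (rule idealI)
    show "subgroup I (add_monoid R)"
      by (rule subgroup.intro) (use assms neg in \<open>auto simp: a_inv_def[symmetric]\<close>)
    fix a x assume "a \<in> I" "x \<in> carrier R"
    then show "x \<otimes> a \<in> I" "a \<otimes> x \<in> I" using mult m_comm assms(2) by (metis subsetD)+
  qed (rule ring_axioms)
qed

lemma ideal_vimage_hom:
  assumes "cring A" "cring B" "h \<in> ring_hom A B" "ideal K B"
  shows "ideal {a \<in> carrier A. h a \<in> K} A"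
proof -
  interpret h: ring_hom_cring A B h using assms by (intro UnivPoly.ring_hom_cringI) auto
  interpret K: ideal K B by fact
  show ?thesis
    by (rule cring_idealI) (use assms K.I_l_closed in auto)
qed

lemma primeideal_vimage_hom:
  assumes "cring A" "h \<in> ring_hom A B" "primeideal Q B"
  shows "primeideal {a \<in> carrier A. h a \<in> Q} A"
proof -
  interpret Q: primeideal Q B by fact
  interpret h: ring_hom_cring A B h using assms Q.is_cring by (intro UnivPoly.ring_hom_cringI) auto
  show ?thesis
  proof (rule primeidealI)
    show "ideal {a \<in> carrier A. h a \<in> Q} A"
      using ideal_vimage_hom[OF assms(1) Q.is_cring assms(2)] Q.is_ideal by auto
    show "carrier A \<noteq> {a \<in> carrier A. h a \<in> Q}"
      using Q.one_imp_carrier Q.I_notcarr h.hom_one h.R.one_closed by (metis (mono_tags, lifting) mem_Collect_eq)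
    fix a b assume "a \<in> carrier A" "b \<in> carrier A" "a \<otimes>\<^bsub>A\<^esub> b \<in> {a \<in> carrier A. h a \<in> Q}"
    then show "a \<in> {a \<in> carrier A. h a \<in> Q} \<or> b \<in> {a \<in> carrier A. h a \<in> Q}"
      using Q.I_prime[of "h a" "h b"] by auto
  qed (rule assms)
qed

text \<open>Two elements with the same image differ by an element of the kernel, which lies in
  \<open>P\<close>. So \<open>P\<close> is recovered as the preimage of its image, and primality can
  be checked in \<open>A\<close>.\<close>

lemma primeideal_image_surj:
  assumes "cring A" "cring B" and h: "h \<in> ring_hom A B" "h ` carrier A = carrier B"
    and P: "primeideal P A" and ker: "\<And>a. a \<in> carrier A \<Longrightarrow> h a = \<zero>\<^bsub>B\<^esub> \<Longrightarrow> a \<in> P"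
  shows "primeideal (h ` P) B" "{a \<in> carrier A. h a \<in> h ` P} = P"
proof -
  interpret h: ring_hom_cring A B h using assms by (intro UnivPoly.ring_hom_cringI) auto
  interpret P: primeideal P A by fact
  have in_P: "a \<in> P" if a: "a \<in> carrier A" and "h a \<in> h ` P" for a
  proof -
    from that obtain b where b: "b \<in> P" "h a = h b" by auto
    have bc: "b \<in> carrier A" using b by auto
    have "h (a \<ominus>\<^bsub>A\<^esub> b) = \<zero>\<^bsub>B\<^esub>"
      using hom_eq_iff_diff[OF assms(1,2) h(1) a bc] b by simp
    then have "a \<ominus>\<^bsub>A\<^esub> b \<in> P" using ker a bc by simp
    then have "(a \<ominus>\<^bsub>A\<^esub> b) \<oplus>\<^bsub>A\<^esub> b \<in> P" using b by simp
    then show ?thesis using a bc by (simp add: h.R.minus_eq h.R.a_assoc h.R.l_neg)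
  qed
  show vim: "{a \<in> carrier A. h a \<in> h ` P} = P" using in_P by auto
  show "primeideal (h ` P) B"
  proof (rule primeidealI)
    show "ideal (h ` P) B"
    proof (rule cring_idealI)
      show "h ` P \<subseteq> carrier B" using h.hom_closed P.Icarr by auto
      show "\<zero>\<^bsub>B\<^esub> \<in> h ` P" using P.zero_closed h.hom_zero by (metis imageI)
      fix x y assume "x \<in> h ` P" "y \<in> h ` P"
      then obtain a b where "a \<in> P" "b \<in> P" "x = h a" "y = h b" by auto
      then show "x \<oplus>\<^bsub>B\<^esub> y \<in> h ` P" using P.a_closed P.Icarr by (auto intro!: image_eqI[of _ _ "a \<oplus>\<^bsub>A\<^esub> b"])
    next
      fix x y assume "x \<in> h ` P" "y \<in> carrier B"
      then obtain a b where "a \<in> P" "b \<in> carrier A" "x = h a" "y = h b" unfolding h(2)[symmetric] by auto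
      then show "y \<otimes>\<^bsub>B\<^esub> x \<in> h ` P"
        using P.I_l_closed P.Icarr by (auto intro!: image_eqI[of _ _ "b \<otimes>\<^bsub>A\<^esub> a"])
    qed (rule assms)
    show "carrier B \<noteq> h ` P"
    proof
      assume "carrier B = h ` P"
      then have "carrier A \<subseteq> P" using in_P h.hom_closed by blast
      then show False using P.I_notcarr P.Icarr by blast
    qed
    fix x y assume xy: "x \<in> carrier B" "y \<in> carrier B" "x \<otimes>\<^bsub>B\<^esub> y \<in> h ` P"
    then obtain a b where "a \<in> carrier A" "b \<in> carrier A" "x = h a" "y = h b"
      unfolding h(2)[symmetric] by auto
    then show "x \<in> h ` P \<or> y \<in> h ` P" using xy in_P[of "a \<otimes>\<^bsub>A\<^esub> b"] P.I_prime[of a b] by auto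
  qed (rule assms)
qed

lemma localize_at_prime:
  assumes "primeideal P R"
  shows "localize R (carrier R - P)"
proof -
  interpret P: primeideal P R by fact
  show ?thesis
    by unfold_locales (use P.I_prime P.one_imp_carrier P.I_notcarr in auto)
qed

text \<open>\<open>\<psi>\<close> exhibits \<open>L\<close> as the localization of \<open>A/J\<close> at \<open>P/J\<close>.\<close>

definition local_ring_at :: "('a, 'm) ring_scheme \<Rightarrow> 'a set \<Rightarrow> 'a set \<Rightarrow> ('a \<Rightarrow> 'b) \<Rightarrow> ('b, 'l) ring_scheme \<Rightarrow> bool" where
  "local_ring_at A J P \<psi> L \<longleftrightarrow> is_fraction_map A \<psi> L \<and> primeideal P A \<and>
     (\<forall>a\<in>carrier A. \<psi> a = \<zero>\<^bsub>L\<^esub> \<longleftrightarrow> (\<exists>s\<in>carrier A - P. s \<otimes>\<^bsub>A\<^esub> a \<in> J)) \<and>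
     (\<forall>a\<in>carrier A. \<psi> a \<in> Units L \<longleftrightarrow> a \<notin> P)"

lemma local_ring_at_unique:
  assumes "local_ring_at A J P \<psi> L" "local_ring_at A J P \<psi>' L'"
  shows "L \<simeq> L'"
  by (rule is_fraction_map_unique[of A \<psi> _ \<psi>']) (use assms in \<open>auto simp: local_ring_at_def\<close>)

lemma is_fraction_map_localization_at:
  assumes "primeideal P R"
  shows "is_fraction_map R (\<lambda>a. frac R (carrier R - P) a \<one>\<^bsub>R\<^esub>) (localization_at R P)"
  unfolding localization_at_def
  by (rule localize.is_fraction_map_localization[OF localize_at_prime[OF assms]])

lemma frac_unit_at_prime_iff:
  assumes "primeideal P R" "a \<in> carrier R"
  shows "frac R (carrier R - P) a \<one>\<^bsub>R\<^esub> \<in> Units (localization_at R P) \<longleftrightarrow> a \<notin> P"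
proof -
  interpret P: primeideal P R by fact
  interpret localize R "carrier R - P" by (rule localize_at_prime[OF assms(1)])
  show ?thesis
  proof
    assume "a \<notin> P"
    then show "frac R (carrier R - P) a \<one>\<^bsub>R\<^esub> \<in> Units (localization_at R P)"
      unfolding localization_at_def using assms one_S by (intro frac_unit) auto
  next
    assume u: "frac R (carrier R - P) a \<one>\<^bsub>R\<^esub> \<in> Units (localization_at R P)"
    obtain x where x: "x \<in> carrier (localization_at R P)"
      "frac R (carrier R - P) a \<one>\<^bsub>R\<^esub> \<otimes>\<^bsub>localization_at R P\<^esub> x = \<one>\<^bsub>localization_at R P\<^esub>"
      using u unfolding Units_def by auto
    then obtain b t where bt: "b \<in> carrier R" "t \<in> carrier R - P" "x = frac R (carrier R - P) b t"
      unfolding localization_at_def by (elim localization_cases)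
    have "frac R (carrier R - P) (a \<otimes>\<^bsub>R\<^esub> b) t = frac R (carrier R - P) \<one>\<^bsub>R\<^esub> \<one>\<^bsub>R\<^esub>"
      using x(2) bt assms one_S unfolding localization_at_def by (simp add: frac_mult localization_one)
    then obtain u where "u \<in> carrier R - P" "u \<otimes>\<^bsub>R\<^esub> (a \<otimes>\<^bsub>R\<^esub> b) = u \<otimes>\<^bsub>R\<^esub> t"
      using bt assms one_S frac_eq_iff[of "a \<otimes>\<^bsub>R\<^esub> b" "\<one>\<^bsub>R\<^esub>" t "\<one>\<^bsub>R\<^esub>"] by auto
    moreover have "u \<otimes>\<^bsub>R\<^esub> t \<notin> P" if "u \<in> carrier R - P" for u
      using that bt P.I_prime[of u t] by auto
    ultimately have "u \<otimes>\<^bsub>R\<^esub> (a \<otimes>\<^bsub>R\<^esub> b) \<notin> P" by auto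
    then show "a \<notin> P" using bt \<open>u \<in> carrier R - P\<close> P.I_l_closed P.I_r_closed by auto
  qed
qed

lemma local_ring_at_surj:
  assumes "cring A" "cring B" and h: "h \<in> ring_hom A B" "h ` carrier A = carrier B" and Q: "primeideal Q B"
  shows "local_ring_at A {a \<in> carrier A. h a = \<zero>\<^bsub>B\<^esub>} {a \<in> carrier A. h a \<in> Q}
    ((\<lambda>a. frac B (carrier B - Q) a \<one>\<^bsub>B\<^esub>) \<circ> h) (localization_at B Q)"
proof -
  interpret Q: primeideal Q B by fact
  interpret h: ring_hom_cring A B h using assms by (intro UnivPoly.ring_hom_cringI) auto
  interpret localize B "carrier B - Q" by (rule localize_at_prime[OF Q])
  show ?thesis
    unfolding local_ring_at_def
  proof (intro conjI ballI)
    show "is_fraction_map A ((\<lambda>a. frac B (carrier B - Q) a \<one>\<^bsub>B\<^esub>) \<circ> h) (localization_at B Q)"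
      by (rule is_fraction_map_trans[OF is_fraction_map_surj[OF assms(1,2) h] is_fraction_map_localization_at[OF Q]])
    show "primeideal {a \<in> carrier A. h a \<in> Q} A" by (rule primeideal_vimage_hom) fact+
  next
    fix a assume a: "a \<in> carrier A"
    have "(\<exists>u\<in>carrier B - Q. u \<otimes>\<^bsub>B\<^esub> h a = \<zero>\<^bsub>B\<^esub>) \<longleftrightarrow> (\<exists>s\<in>carrier A. h s \<notin> Q \<and> h s \<otimes>\<^bsub>B\<^esub> h a = \<zero>\<^bsub>B\<^esub>)"
      unfolding h(2)[symmetric] by auto
    then show "((\<lambda>a. frac B (carrier B - Q) a \<one>\<^bsub>B\<^esub>) \<circ> h) a = \<zero>\<^bsub>localization_at B Q\<^esub> \<longleftrightarrow>
         (\<exists>s\<in>carrier A - {a \<in> carrier A. h a \<in> Q}. s \<otimes>\<^bsub>A\<^esub> a \<in> {a \<in> carrier A. h a = \<zero>\<^bsub>B\<^esub>})"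
      using a unfolding localization_at_def by (auto simp: frac_eq_zero_iff)
    show "((\<lambda>a. frac B (carrier B - Q) a \<one>\<^bsub>B\<^esub>) \<circ> h) a \<in> Units (localization_at B Q) \<longleftrightarrow> a \<notin> {a \<in> carrier A. h a \<in> Q}"
      using a frac_unit_at_prime_iff[OF Q] by simp
  qed
qed

text \<open>Moves a presentation from \<open>B\<close> to a ring \<open>A\<close> that maps onto it,
  so that local rings of different quotients can be compared over one ring.\<close>

lemma local_ring_at_pullback:
  assumes "cring A" "cring B" and h: "h \<in> ring_hom A B" "h ` carrier A = carrier B"
    and L: "local_ring_at B K Q \<psi> L"
  shows "local_ring_at A {a \<in> carrier A. h a \<in> K} {a \<in> carrier A. h a \<in> Q} (\<psi> \<circ> h) L"
proof -
  have Q: "primeideal Q B" and fr: "is_fraction_map B \<psi> L" using L by (auto simp: local_ring_at_def)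
  interpret h: ring_hom_cring A B h using assms by (intro UnivPoly.ring_hom_cringI) auto
  show ?thesis
    unfolding local_ring_at_def
  proof (intro conjI ballI)
    show "is_fraction_map A (\<psi> \<circ> h) L"
      by (rule is_fraction_map_trans[OF is_fraction_map_surj[OF assms(1,2) h] fr])
    show "primeideal {a \<in> carrier A. h a \<in> Q} A" by (rule primeideal_vimage_hom) fact+
  next
    fix a assume a: "a \<in> carrier A"
    have "(\<exists>u\<in>carrier B - Q. u \<otimes>\<^bsub>B\<^esub> h a \<in> K) \<longleftrightarrow> (\<exists>s\<in>carrier A. h s \<notin> Q \<and> h s \<otimes>\<^bsub>B\<^esub> h a \<in> K)"
      unfolding h(2)[symmetric] by auto
    then show "(\<psi> \<circ> h) a = \<zero>\<^bsub>L\<^esub> \<longleftrightarrow>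
         (\<exists>s\<in>carrier A - {a \<in> carrier A. h a \<in> Q}. s \<otimes>\<^bsub>A\<^esub> a \<in> {a \<in> carrier A. h a \<in> K})"
      using a L by (auto simp: local_ring_at_def)
    show "(\<psi> \<circ> h) a \<in> Units L \<longleftrightarrow> a \<notin> {a \<in> carrier A. h a \<in> Q}"
      using a L by (auto simp: local_ring_at_def)
  qed
qed

lemma local_ring_at_iso:
  assumes L: "local_ring_at A J P \<psi> L" and "cring L'" and g: "g \<in> ring_iso L L'"
  shows "local_ring_at A J P (g \<circ> \<psi>) L'"
proof -
  have fr: "is_fraction_map A \<psi> L" using L by (auto simp: local_ring_at_def)
  then have cr: "cring L" "cring A" and hom: "\<psi> \<in> ring_hom A L" by (auto simp: is_fraction_map_def)
  have g1: "g \<in> ring_hom L L'" "g ` carrier L = carrier L'" "inj_on g (carrier L)"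
    using g unfolding ring_iso_def bij_betw_def by auto
  interpret L: cring L by fact
  interpret h: ring_hom_cring L L' g using assms cr g1 by (intro UnivPoly.ring_hom_cringI) auto
  have g2: "inv_into (carrier L) g \<in> ring_hom L' L"
    using ring_iso_set_sym[OF L.ring_axioms g] by (simp add: ring_iso_def)
  have cl: "\<psi> a \<in> carrier L" if "a \<in> carrier A" for a using hom that by (rule ring_hom_closed)
  have "is_fraction_map A (g \<circ> \<psi>) L'"
    by (rule is_fraction_map_trans[OF fr is_fraction_map_surj[OF cr(1) assms(2) g1(1,2)]])
  moreover have "g x = \<zero>\<^bsub>L'\<^esub> \<longleftrightarrow> x = \<zero>\<^bsub>L\<^esub>" if "x \<in> carrier L" for x
    using inj_on_eq_iff[OF g1(3) that L.zero_closed] by simp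
  moreover have "g x \<in> Units L' \<longleftrightarrow> x \<in> Units L" if "x \<in> carrier L" for x
    using ring_hom_Units[OF cr(1) assms(2) g1(1), of x] ring_hom_Units[OF assms(2) cr(1) g2, of "g x"]
      inv_into_f_f[OF g1(3) that] by auto
  ultimately show ?thesis using L cl unfolding local_ring_at_def by simp
qed

lemma local_ringI:
  assumes "cring L" "\<one>\<^bsub>L\<^esub> \<noteq> \<zero>\<^bsub>L\<^esub>"
    and add: "\<And>x y. x \<in> carrier L - Units L \<Longrightarrow> y \<in> carrier L - Units L \<Longrightarrow> x \<oplus>\<^bsub>L\<^esub> y \<notin> Units L"
  shows "local_ring L" "maximalideal (carrier L - Units L) L"
    "\<And>M. maximalideal M L \<Longrightarrow> M = carrier L - Units L"
proof -
  interpret L: cring L by fact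
  have no_unit: "I = carrier L" if "ideal I L" "u \<in> I" "u \<in> Units L" for I u
  proof -
    interpret I: ideal I L by fact
    have "inv\<^bsub>L\<^esub> u \<otimes>\<^bsub>L\<^esub> u \<in> I" using that by (intro I.I_l_closed) auto
    then show ?thesis using that I.one_imp_carrier L.Units_l_inv by metis
  qed
  have mult: "x \<otimes>\<^bsub>L\<^esub> y \<notin> Units L" if "y \<in> carrier L - Units L" "x \<in> carrier L" for x y
    using that L.m_comm L.unit_factor by (metis DiffD1 DiffD2)
  have zero: "\<zero>\<^bsub>L\<^esub> \<notin> Units L"
    using assms(2) unfolding Units_def by auto
  have N: "ideal (carrier L - Units L) L"
    by (rule cring_idealI) (use assms(1) add mult zero in auto)
  show max: "maximalideal (carrier L - Units L) L"
  proof (rule maximalidealI[OF N])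
    show "carrier L \<noteq> carrier L - Units L" using L.Units_one_closed by blast
    fix J assume J: "ideal J L" "carrier L - Units L \<subseteq> J" "J \<subseteq> carrier L"
    show "J = carrier L - Units L \<or> J = carrier L"
      using no_unit[OF J(1)] J by blast
  qed
  show uniq: "M = carrier L - Units L" if M: "maximalideal M L" for M
  proof -
    interpret M: maximalideal M L by fact
    have "M \<subseteq> carrier L - Units L" using no_unit[OF M.is_ideal] M.I_notcarr M.Icarr by blast
    then show ?thesis using M.I_maximal[OF N] L.Units_one_closed by blast
  qed
  show "local_ring L" unfolding local_ring_def using assms(1) max uniq by blast
qed

text \<open>The non-units are the fractions with numerator in \<open>P\<close>. Over the common
  denominator, the numerator of a sum of two such fractions is again in \<open>P\<close>.\<close>

lemma local_ring_at_local:
  assumes L: "local_ring_at A J P \<psi> L"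
  shows "cring L" "local_ring L" "maximalideal (carrier L - Units L) L"
    "\<And>M. maximalideal M L \<Longrightarrow> M = carrier L - Units L"
proof -
  have fr: "is_fraction_map A \<psi> L" and P: "primeideal P A"
    and U: "\<And>a. a \<in> carrier A \<Longrightarrow> \<psi> a \<in> Units L \<longleftrightarrow> a \<notin> P" using L by (auto simp: local_ring_at_def)
  then have cr: "cring L" "cring A" and hom: "\<psi> \<in> ring_hom A L" by (auto simp: is_fraction_map_def)
  interpret h: ring_hom_cring A L \<psi> using cr hom by (intro UnivPoly.ring_hom_cringI) auto
  interpret P: primeideal P A by fact
  show "cring L" by fact
  have one: "\<one>\<^bsub>L\<^esub> \<noteq> \<zero>\<^bsub>L\<^esub>"
    using U[of "\<zero>\<^bsub>A\<^esub>"] P.zero_closed h.hom_zero h.S.Units_one_closed by (metis h.R.zero_closed)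
  have add: "x \<oplus>\<^bsub>L\<^esub> y \<notin> Units L" if x: "x \<in> carrier L - Units L" and y: "y \<in> carrier L - Units L" for x y
  proof -
    obtain a s where a: "a \<in> carrier A" "s \<in> carrier A" "\<psi> s \<in> Units L" "x \<otimes>\<^bsub>L\<^esub> \<psi> s = \<psi> a"
      using fr x unfolding is_fraction_map_def by blast
    obtain b t where b: "b \<in> carrier A" "t \<in> carrier A" "\<psi> t \<in> Units L" "y \<otimes>\<^bsub>L\<^esub> \<psi> t = \<psi> b"
      using fr y unfolding is_fraction_map_def by blast
    have "\<psi> a \<notin> Units L"
      using h.S.unit_factor[of x "\<psi> s"] a x by auto
    moreover have "\<psi> b \<notin> Units L"
      using h.S.unit_factor[of y "\<psi> t"] b y by auto
    ultimately have "a \<in> P" "b \<in> P" using U a b by auto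
    then have "a \<otimes>\<^bsub>A\<^esub> t \<oplus>\<^bsub>A\<^esub> b \<otimes>\<^bsub>A\<^esub> s \<in> P" using a b P.I_r_closed by simp
    then have "\<psi> (a \<otimes>\<^bsub>A\<^esub> t \<oplus>\<^bsub>A\<^esub> b \<otimes>\<^bsub>A\<^esub> s) \<notin> Units L" using U P.Icarr by blast
    moreover have "\<psi> (a \<otimes>\<^bsub>A\<^esub> t \<oplus>\<^bsub>A\<^esub> b \<otimes>\<^bsub>A\<^esub> s) = (x \<oplus>\<^bsub>L\<^esub> y) \<otimes>\<^bsub>L\<^esub> (\<psi> s \<otimes>\<^bsub>L\<^esub> \<psi> t)"
      using a(1,2) b(1,2) x y a(4)[symmetric] b(4)[symmetric] by (simp add: h.S.m_ac h.S.l_distr h.S.r_distr)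
    ultimately show ?thesis using a b by auto
  qed
  show "local_ring L" "maximalideal (carrier L - Units L) L"
    "\<And>M. maximalideal M L \<Longrightarrow> M = carrier L - Units L"
    using local_ringI[OF cr(1) one add] by blast+
qed

text \<open>Up to a unit, each element of an ideal of \<open>L\<close> is the image of an element of
  the contraction to \<open>A\<close>; so generators of the contraction generate the ideal.\<close>

lemma is_fraction_map_noetherian:
  assumes fr: "is_fraction_map A \<psi> L" and A: "noetherian_ring A"
  shows "noetherian_ring L"
proof -
  have cr: "cring L" "cring A" and hom: "\<psi> \<in> ring_hom A L" using fr by (auto simp: is_fraction_map_def)
  interpret A: noetherian_ring A by fact
  interpret h: ring_hom_cring A L \<psi> using cr hom by (intro UnivPoly.ring_hom_cringI) auto
  show ?thesis
  proof (rule h.S.noetherian_ringI)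
    fix I assume I: "ideal I L"
    interpret I: ideal I L by fact
    have "ideal {a \<in> carrier A. \<psi> a \<in> I} A" by (rule ideal_vimage_hom) fact+
    then obtain E where E: "E \<subseteq> carrier A" "finite E" "{a \<in> carrier A. \<psi> a \<in> I} = Idl\<^bsub>A\<^esub> E"
      using A.finetely_gen by blast
    have Ec: "\<psi> ` E \<subseteq> carrier L" using E h.hom_closed by auto
    interpret G: ideal "Idl\<^bsub>L\<^esub> (\<psi> ` E)" L by (rule h.S.genideal_ideal[OF Ec])
    have "\<psi> ` E \<subseteq> I" using A.genideal_self[OF E(1)] E(3) by auto
    then have 1: "Idl\<^bsub>L\<^esub> (\<psi> ` E) \<subseteq> I" by (rule h.S.genideal_minimal[OF I])
    have "ideal {a \<in> carrier A. \<psi> a \<in> Idl\<^bsub>L\<^esub> (\<psi> ` E)} A"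
      by (rule ideal_vimage_hom[OF cr(2,1) hom G.is_ideal])
    moreover have "E \<subseteq> {a \<in> carrier A. \<psi> a \<in> Idl\<^bsub>L\<^esub> (\<psi> ` E)}"
      using E(1) h.S.genideal_self[OF Ec] by auto
    ultimately have 2: "Idl\<^bsub>A\<^esub> E \<subseteq> {a \<in> carrier A. \<psi> a \<in> Idl\<^bsub>L\<^esub> (\<psi> ` E)}"
      by (rule A.genideal_minimal)
    have "x \<in> Idl\<^bsub>L\<^esub> (\<psi> ` E)" if x: "x \<in> I" for x
    proof -
      obtain a s where a: "a \<in> carrier A" "s \<in> carrier A" "\<psi> s \<in> Units L" "x \<otimes>\<^bsub>L\<^esub> \<psi> s = \<psi> a"
        using fr I.Icarr[OF x] unfolding is_fraction_map_def by blast
      have "\<psi> a \<in> I" using I.I_r_closed[OF x] a by (metis h.hom_closed)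
      then have "\<psi> a \<in> Idl\<^bsub>L\<^esub> (\<psi> ` E)" using 2 E(3) a by auto
      then have "\<psi> a \<otimes>\<^bsub>L\<^esub> inv\<^bsub>L\<^esub> \<psi> s \<in> Idl\<^bsub>L\<^esub> (\<psi> ` E)" using G.I_r_closed a by simp
      moreover have "\<psi> a \<otimes>\<^bsub>L\<^esub> inv\<^bsub>L\<^esub> \<psi> s = x"
        using a I.Icarr[OF x] by (metis h.S.Units_closed h.S.Units_inv_closed h.S.Units_r_inv h.S.m_assoc h.S.r_one)
      ultimately show ?thesis by simp
    qed
    with 1 have "I = Idl\<^bsub>L\<^esub> (\<psi> ` E)" by auto
    then show "\<exists>A\<subseteq>carrier L. finite A \<and> I = Idl\<^bsub>L\<^esub> A" using Ec E(2) by blast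
  qed
qed

text \<open>The assumptions say that \<open>K\<close> is \<open>J + tA\<close>, so dividing the
  local ring by the image of \<open>t\<close> amounts to replacing \<open>J\<close> by
  \<open>K\<close>. This is the form in which (F2) is applied.\<close>

lemma local_ring_at_quotient:
  assumes L: "local_ring_at A J P \<psi> L" and t: "t \<in> P" and K: "ideal K A" "K \<subseteq> P" "J \<subseteq> K" "t \<in> K"
    and K_mod: "\<And>a. a \<in> K \<Longrightarrow> \<exists>d\<in>carrier A. a \<ominus>\<^bsub>A\<^esub> t \<otimes>\<^bsub>A\<^esub> d \<in> J"
  shows "local_ring_at A K P ((+>\<^bsub>L\<^esub>) (PIdl\<^bsub>L\<^esub> (\<psi> t)) \<circ> \<psi>) (L Quot (PIdl\<^bsub>L\<^esub> (\<psi> t)))"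
proof -
  have fr: "is_fraction_map A \<psi> L" and P: "primeideal P A"
    and ker: "\<And>a. a \<in> carrier A \<Longrightarrow> \<psi> a = \<zero>\<^bsub>L\<^esub> \<longleftrightarrow> (\<exists>s\<in>carrier A - P. s \<otimes>\<^bsub>A\<^esub> a \<in> J)"
    and U: "\<And>a. a \<in> carrier A \<Longrightarrow> \<psi> a \<in> Units L \<longleftrightarrow> a \<notin> P" using L by (auto simp: local_ring_at_def)
  then have cr: "cring L" "cring A" and hom: "\<psi> \<in> ring_hom A L" by (auto simp: is_fraction_map_def)
  interpret h: ring_hom_cring A L \<psi> using cr hom by (intro UnivPoly.ring_hom_cringI) auto
  interpret P: primeideal P A by fact
  interpret K: ideal K A by fact
  let ?I = "PIdl\<^bsub>L\<^esub> (\<psi> t)" and ?\<pi> = "(+>\<^bsub>L\<^esub>) (PIdl\<^bsub>L\<^esub> (\<psi> t))"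
  have tc: "t \<in> carrier A" "\<psi> t \<in> carrier L" using t by auto
  interpret I: ideal ?I L by (rule h.S.cgenideal_ideal[OF tc(2)])
  have memI: "x \<in> ?I \<longleftrightarrow> (\<exists>y\<in>carrier L. x = y \<otimes>\<^bsub>L\<^esub> \<psi> t)" for x unfolding cgenideal_def by auto
  have cq: "cring (L Quot ?I)" by (rule I.quotient_is_cring[OF cr(1)])
  have pi: "?\<pi> \<in> ring_hom L (L Quot ?I)" by (rule I.rcos_ring_hom)
  have pi_surj: "?\<pi> ` carrier L = carrier (L Quot ?I)" unfolding FactRing_def A_RCOSETS_def' by auto
  have pi_zero: "?\<pi> x = \<zero>\<^bsub>L Quot ?I\<^esub> \<longleftrightarrow> x \<in> ?I" if "x \<in> carrier L" for x
    using that I.a_rcos_const I.rcos_const_imp_mem by (auto simp: FactRing_def)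
  note max = local_ring_at_local(3)[OF L]
  interpret M: maximalideal "carrier L - Units L" L by (rule max)
  \<comment> \<open>As \<open>t\<close> lies in \<open>P\<close>, the principal ideal consists of
    non-units; therefore an element that is a unit modulo this ideal is already a unit of
    \<open>L\<close>.\<close>
  have I_M: "?I \<subseteq> carrier L - Units L"
    using h.S.cgenideal_minimal[OF M.is_ideal, of "\<psi> t"] tc U[of t] t by auto
  show ?thesis
    unfolding local_ring_at_def
  proof (intro conjI ballI)
    show "is_fraction_map A (?\<pi> \<circ> \<psi>) (L Quot ?I)"
      by (rule is_fraction_map_trans[OF fr is_fraction_map_surj[OF cr(1) cq pi pi_surj]])
    show "primeideal P A" by fact
  next
    fix a assume a: "a \<in> carrier A"
    have "\<psi> a \<in> ?I \<longleftrightarrow> (\<exists>s\<in>carrier A - P. s \<otimes>\<^bsub>A\<^esub> a \<in> K)"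
    proof
      assume "\<psi> a \<in> ?I"
      then obtain x where x: "x \<in> carrier L" "\<psi> a = x \<otimes>\<^bsub>L\<^esub> \<psi> t" using memI[of "\<psi> a"] by blast
      obtain b s where b: "b \<in> carrier A" "s \<in> carrier A" "\<psi> s \<in> Units L" "x \<otimes>\<^bsub>L\<^esub> \<psi> s = \<psi> b"
        using fr x unfolding is_fraction_map_def by blast
      have "\<psi> (s \<otimes>\<^bsub>A\<^esub> a) = x \<otimes>\<^bsub>L\<^esub> \<psi> s \<otimes>\<^bsub>L\<^esub> \<psi> t" using x b(1,2,3) a tc by (simp add: h.S.m_ac)
      also have "\<dots> = \<psi> (b \<otimes>\<^bsub>A\<^esub> t)" using b tc by simp
      finally have "\<psi> (s \<otimes>\<^bsub>A\<^esub> a \<ominus>\<^bsub>A\<^esub> b \<otimes>\<^bsub>A\<^esub> t) = \<zero>\<^bsub>L\<^esub>"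
        using hom_eq_iff_diff[OF cr(2,1) hom] a b tc by simp
      then obtain s' where s': "s' \<in> carrier A - P" "s' \<otimes>\<^bsub>A\<^esub> (s \<otimes>\<^bsub>A\<^esub> a \<ominus>\<^bsub>A\<^esub> b \<otimes>\<^bsub>A\<^esub> t) \<in> J"
        using ker[of "s \<otimes>\<^bsub>A\<^esub> a \<ominus>\<^bsub>A\<^esub> b \<otimes>\<^bsub>A\<^esub> t"] a b tc by auto
      have "(s' \<otimes>\<^bsub>A\<^esub> (s \<otimes>\<^bsub>A\<^esub> a \<ominus>\<^bsub>A\<^esub> b \<otimes>\<^bsub>A\<^esub> t)) \<oplus>\<^bsub>A\<^esub> (s' \<otimes>\<^bsub>A\<^esub> b) \<otimes>\<^bsub>A\<^esub> t \<in> K"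
        using s' K(3,4) b K.I_l_closed by (intro K.a_closed) auto
      moreover have "(s' \<otimes>\<^bsub>A\<^esub> (s \<otimes>\<^bsub>A\<^esub> a \<ominus>\<^bsub>A\<^esub> b \<otimes>\<^bsub>A\<^esub> t)) \<oplus>\<^bsub>A\<^esub> (s' \<otimes>\<^bsub>A\<^esub> b) \<otimes>\<^bsub>A\<^esub> t = s' \<otimes>\<^bsub>A\<^esub> s \<otimes>\<^bsub>A\<^esub> a"
        using s' a b(1,2) tc by (simp add: h.R.minus_eq h.R.r_distr h.R.r_minus h.R.m_assoc h.R.a_assoc h.R.l_neg)
      moreover have "s' \<otimes>\<^bsub>A\<^esub> s \<in> carrier A - P" using s' b U[of s] P.I_prime[of s' s] by auto
      ultimately show "\<exists>s\<in>carrier A - P. s \<otimes>\<^bsub>A\<^esub> a \<in> K" by metis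
    next
      assume "\<exists>s\<in>carrier A - P. s \<otimes>\<^bsub>A\<^esub> a \<in> K"
      then obtain s where s: "s \<in> carrier A" "s \<notin> P" "s \<otimes>\<^bsub>A\<^esub> a \<in> K" by auto
      then obtain d where d: "d \<in> carrier A" "s \<otimes>\<^bsub>A\<^esub> a \<ominus>\<^bsub>A\<^esub> t \<otimes>\<^bsub>A\<^esub> d \<in> J" using K_mod by blast
      have "\<psi> (s \<otimes>\<^bsub>A\<^esub> a \<ominus>\<^bsub>A\<^esub> t \<otimes>\<^bsub>A\<^esub> d) = \<zero>\<^bsub>L\<^esub>"
        unfolding ker[OF h.R.minus_closed[OF h.R.m_closed[OF s(1) a] h.R.m_closed[OF tc(1) d(1)]]]
        using d s a tc P.I_notcarr P.one_imp_carrier by (intro bexI[of _ "\<one>\<^bsub>A\<^esub>"]) auto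
      then have "\<psi> (s \<otimes>\<^bsub>A\<^esub> a) = \<psi> (t \<otimes>\<^bsub>A\<^esub> d)"
        using hom_eq_iff_diff[OF cr(2,1) hom] a s d tc by simp
      then have e: "\<psi> s \<otimes>\<^bsub>L\<^esub> \<psi> a = \<psi> d \<otimes>\<^bsub>L\<^esub> \<psi> t" using a s d tc by (simp add: h.S.m_comm)
      have us: "\<psi> s \<in> Units L" using U s by simp
      have "\<psi> a = inv\<^bsub>L\<^esub> \<psi> s \<otimes>\<^bsub>L\<^esub> (\<psi> s \<otimes>\<^bsub>L\<^esub> \<psi> a)"
        using us a s by (simp add: h.S.m_assoc[symmetric])
      also have "\<dots> = (inv\<^bsub>L\<^esub> \<psi> s \<otimes>\<^bsub>L\<^esub> \<psi> d) \<otimes>\<^bsub>L\<^esub> \<psi> t"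
        unfolding e using us d tc by (simp add: h.S.m_assoc)
      finally show "\<psi> a \<in> ?I"
        using memI[of "\<psi> a"] h.S.m_closed[OF h.S.Units_inv_closed[OF us] h.hom_closed[OF d(1)]] by blast
    qed
    then show "(?\<pi> \<circ> \<psi>) a = \<zero>\<^bsub>L Quot ?I\<^esub> \<longleftrightarrow> (\<exists>s\<in>carrier A - P. s \<otimes>\<^bsub>A\<^esub> a \<in> K)"
      using pi_zero a by simp
    show "(?\<pi> \<circ> \<psi>) a \<in> Units (L Quot ?I) \<longleftrightarrow> a \<notin> P"
    proof
      assume "a \<notin> P"
      then show "(?\<pi> \<circ> \<psi>) a \<in> Units (L Quot ?I)" using U[OF a] ring_hom_Units[OF cr(1) cq pi] by simp
    next
      assume "(?\<pi> \<circ> \<psi>) a \<in> Units (L Quot ?I)"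
      then obtain z where z: "z \<in> carrier (L Quot ?I)" "?\<pi> (\<psi> a) \<otimes>\<^bsub>L Quot ?I\<^esub> z = \<one>\<^bsub>L Quot ?I\<^esub>"
        unfolding Units_def by auto
      then obtain y where y: "y \<in> carrier L" "z = ?\<pi> y"
        unfolding pi_surj[symmetric] by blast
      have ac: "\<psi> a \<in> carrier L" and cl: "\<psi> a \<otimes>\<^bsub>L\<^esub> y \<in> carrier L" using a y(1) by simp_all
      have "?\<pi> (\<psi> a \<otimes>\<^bsub>L\<^esub> y) = ?\<pi> \<one>\<^bsub>L\<^esub>"
        using ring_hom_mult[OF pi ac y(1)] ring_hom_one[OF pi] z(2) unfolding y(2) by simp
      then have "?\<pi> (\<psi> a \<otimes>\<^bsub>L\<^esub> y \<ominus>\<^bsub>L\<^esub> \<one>\<^bsub>L\<^esub>) = \<zero>\<^bsub>L Quot ?I\<^esub>"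
        using hom_eq_iff_diff[OF cr(1) cq pi cl h.S.one_closed] by blast
      then have "\<psi> a \<otimes>\<^bsub>L\<^esub> y \<ominus>\<^bsub>L\<^esub> \<one>\<^bsub>L\<^esub> \<in> ?I"
        using pi_zero[OF h.S.minus_closed[OF cl h.S.one_closed]] by blast
      then have m: "\<psi> a \<otimes>\<^bsub>L\<^esub> y \<ominus>\<^bsub>L\<^esub> \<one>\<^bsub>L\<^esub> \<in> carrier L - Units L" using I_M by auto
      show "a \<notin> P"
      proof
        assume "a \<in> P"
        then have "\<psi> a \<in> carrier L - Units L" using U[OF a] a by simp
        then have n: "\<psi> a \<otimes>\<^bsub>L\<^esub> y \<in> carrier L - Units L" using M.I_r_closed y by auto
        have "\<psi> a \<otimes>\<^bsub>L\<^esub> y \<ominus>\<^bsub>L\<^esub> (\<psi> a \<otimes>\<^bsub>L\<^esub> y \<ominus>\<^bsub>L\<^esub> \<one>\<^bsub>L\<^esub>) \<in> carrier L - Units L"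
          unfolding h.S.minus_eq[of "\<psi> a \<otimes>\<^bsub>L\<^esub> y" "\<psi> a \<otimes>\<^bsub>L\<^esub> y \<ominus>\<^bsub>L\<^esub> \<one>\<^bsub>L\<^esub>"]
          by (rule M.a_closed[OF n M.a_inv_closed[OF m]])
        moreover have "\<psi> a \<otimes>\<^bsub>L\<^esub> y \<ominus>\<^bsub>L\<^esub> (\<psi> a \<otimes>\<^bsub>L\<^esub> y \<ominus>\<^bsub>L\<^esub> \<one>\<^bsub>L\<^esub>) = \<one>\<^bsub>L\<^esub>"
          using cl by (simp add: h.S.minus_eq h.S.minus_add h.S.r_neg2 del: h.hom_mult)
        ultimately show False by simp
      qed
    qed
  qed
qed

section \<open>Transport of properties, and copies of rings in the universe\<close>

lemma has_property_cong:
  assumes "ring R" "R \<simeq> R'" "has_property PP R"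
  shows "has_property PP R'"
proof -
  obtain S h where S: "local_ring S" "PP S" "h \<in> ring_iso R S"
    using assms(3) unfolding has_property_def is_ring_iso_def by auto
  obtain g where "g \<in> ring_iso R R'" using assms(2) unfolding is_ring_iso_def by auto
  then have "h \<circ> inv_into (carrier R) g \<in> ring_iso R' S"
    using ring_iso_set_trans[OF ring_iso_set_sym[OF assms(1)] S(3)] by blast
  then show ?thesis using S unfolding has_property_def is_ring_iso_def by blast
qed

lemma local_ring_at_has_property:
  assumes "local_ring_at A J P \<psi> L" "local_ring_at A J P \<psi>' L'" "has_property PP L"
  shows "has_property PP L'"
  using has_property_cong[OF _ local_ring_at_unique[OF assms(1,2)] assms(3)] local_ring_at_local(1)[OF assms(1)]
  by (simp add: cring_def)

lemma ex_iso_copy: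
  assumes "cring L" "carrier L \<lesssim> (UNIV :: 'u set)"
  shows "\<exists>(L' :: 'u ring) h. cring L' \<and> h \<in> ring_iso L L'"
proof -
  interpret L: cring L by fact
  obtain f :: "_ \<Rightarrow> 'u" where f: "inj_on f (carrier L)" using assms(2) unfolding lepoll_def by auto
  have iso: "f \<in> ring_iso L (image_ring f L)" by (rule inj_imp_image_ring_iso[OF f])
  \<comment> \<open>The updated zero is the one that \<open>image_ring\<close> already carries, so
    the copy itself is a ring.\<close>
  have "cring ((image_ring f L)\<lparr>zero := f \<zero>\<^bsub>L\<^esub>\<rparr>)" by (rule L.ring_iso_imp_img_cring[OF iso])
  then have "cring (image_ring f L)" by (simp add: image_ring_def image_group_def monoid.defs)
  then show ?thesis using iso by blast
qed

text \<open>Fractions are indexed by pairs from \<open>A\<close>, and an infinite universe is in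
  bijection with its square.\<close>

lemma is_fraction_map_lepoll:
  assumes "is_fraction_map A \<psi> L" "carrier A \<lesssim> (UNIV :: 'u set)" "infinite (UNIV :: 'u set)"
  shows "carrier L \<lesssim> (UNIV :: 'u set)"
proof -
  have cr: "cring L" using assms(1) by (auto simp: is_fraction_map_def)
  interpret L: cring L by fact
  have hom: "\<psi> \<in> ring_hom A L" using assms(1) by (auto simp: is_fraction_map_def)
  have "carrier L \<subseteq> (\<lambda>(a, s). \<psi> a \<otimes>\<^bsub>L\<^esub> inv\<^bsub>L\<^esub> \<psi> s) ` (carrier A \<times> carrier A)"
  proof
    fix x assume x: "x \<in> carrier L"
    obtain a s where a: "a \<in> carrier A" "s \<in> carrier A" "\<psi> s \<in> Units L" "x \<otimes>\<^bsub>L\<^esub> \<psi> s = \<psi> a"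
      using assms(1) x unfolding is_fraction_map_def by blast
    then have "x = \<psi> a \<otimes>\<^bsub>L\<^esub> inv\<^bsub>L\<^esub> \<psi> s"
      using x by (metis L.Units_closed L.Units_inv_closed L.Units_r_inv L.m_assoc L.r_one)
    then show "x \<in> (\<lambda>(a, s). \<psi> a \<otimes>\<^bsub>L\<^esub> inv\<^bsub>L\<^esub> \<psi> s) ` (carrier A \<times> carrier A)" using a by force
  qed
  then have "carrier L \<lesssim> carrier A \<times> carrier A" by (meson image_lepoll lepoll_trans subset_imp_lepoll)
  also have "\<dots> \<lesssim> (UNIV :: 'u set) \<times> (UNIV :: 'u set)" by (intro times_lepoll_mono assms)
  also have "\<dots> \<lesssim> (UNIV :: 'u set)"
    using card_of_Times_same_infinite[OF assms(3)]
    by (simp add: eqpoll_iff_card_of_ordIso[symmetric] eqpoll_imp_lepoll)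
  finally show ?thesis .
qed

section \<open>Extension to polynomial rings\<close>

lemma UP_cringI: "cring R \<Longrightarrow> UP_cring R"
  by (simp add: UP_cring_def)

definition map_UP :: "('a, 'm) ring_scheme \<Rightarrow> ('a \<Rightarrow> 'b) \<Rightarrow> (nat \<Rightarrow> 'a) \<Rightarrow> nat \<Rightarrow> 'b" where
  "map_UP A h f = (\<lambda>n. h (coeff (UP A) f n))"

text \<open>The extension \<open>K[t]\<close> described by coefficients.
  \<open>extended_ideal\<close> is given by generators, which do not show whether a given polynomial
  is a member.\<close>

definition poly_ideal :: "('a, 'm) ring_scheme \<Rightarrow> 'a set \<Rightarrow> (nat \<Rightarrow> 'a) set" where
  "poly_ideal A K = {f \<in> carrier (UP A). \<forall>n. coeff (UP A) f n \<in> K}"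

lemma (in UP_ring) UP_memI:
  assumes "\<And>n. f n \<in> carrier R" "\<And>n. n > N \<Longrightarrow> f n = \<zero>"
  shows "f \<in> carrier P" "coeff P f n = f n"
proof -
  have "f \<in> up R" by (rule mem_upI) (use assms in auto)
  then show "f \<in> carrier P" "coeff P f n = f n" by (simp_all add: P_def UP_def)
qed

lemma map_UP_closed:
  assumes "cring A" "cring B" "h \<in> ring_hom A B" "f \<in> carrier (UP A)"
  shows "map_UP A h f \<in> carrier (UP B)" "coeff (UP B) (map_UP A h f) n = h (coeff (UP A) f n)"
proof -
  interpret A: UP_cring A "UP A" using assms UP_cringI by auto
  interpret B: UP_cring B "UP B" using assms UP_cringI by auto
  interpret h: ring_hom_cring A B h using assms by (intro UnivPoly.ring_hom_cringI) auto
  have 1: "map_UP A h f n \<in> carrier B" for n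
    unfolding map_UP_def using assms by auto
  have 2: "map_UP A h f n = \<zero>\<^bsub>B\<^esub>" if "n > deg A f" for n
    unfolding map_UP_def using assms A.deg_aboveD[OF that] by auto
  show "map_UP A h f \<in> carrier (UP B)" "coeff (UP B) (map_UP A h f) n = h (coeff (UP A) f n)"
    using B.UP_memI[OF 1 2] by (auto simp: map_UP_def)
qed

lemma map_UP_hom:
  assumes "cring A" "cring B" "h \<in> ring_hom A B"
  shows "map_UP A h \<in> ring_hom (UP A) (UP B)"
proof -
  interpret A: UP_cring A "UP A" using assms UP_cringI by auto
  interpret B: UP_cring B "UP B" using assms UP_cringI by auto
  interpret h: ring_hom_cring A B h using assms by (intro UnivPoly.ring_hom_cringI) auto
  note cl = map_UP_closed[OF assms]
  show ?thesis
  proof (rule ring_hom_memI)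
    fix f g assume fg: "f \<in> carrier (UP A)" "g \<in> carrier (UP A)"
    show "map_UP A h (f \<otimes>\<^bsub>UP A\<^esub> g) = map_UP A h f \<otimes>\<^bsub>UP B\<^esub> map_UP A h g"
    proof (rule B.up_eqI)
      fix n
      have "h (\<Oplus>\<^bsub>A\<^esub>i\<in>{..n}. coeff (UP A) f i \<otimes>\<^bsub>A\<^esub> coeff (UP A) g (n - i))
          = (\<Oplus>\<^bsub>B\<^esub>i\<in>{..n}. h (coeff (UP A) f i \<otimes>\<^bsub>A\<^esub> coeff (UP A) g (n - i)))"
        using fg by (subst h.hom_finsum) (auto simp: comp_def)
      also have "\<dots> = (\<Oplus>\<^bsub>B\<^esub>i\<in>{..n}. h (coeff (UP A) f i) \<otimes>\<^bsub>B\<^esub> h (coeff (UP A) g (n - i)))"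
        using fg by (intro B.R.finsum_cong') auto
      finally show "coeff (UP B) (map_UP A h (f \<otimes>\<^bsub>UP A\<^esub> g)) n = coeff (UP B) (map_UP A h f \<otimes>\<^bsub>UP B\<^esub> map_UP A h g) n"
        using fg by (simp add: cl)
    qed (use fg cl in auto)
    show "map_UP A h (f \<oplus>\<^bsub>UP A\<^esub> g) = map_UP A h f \<oplus>\<^bsub>UP B\<^esub> map_UP A h g"
      by (rule B.up_eqI) (use fg cl in auto)
  next
    show "map_UP A h \<one>\<^bsub>UP A\<^esub> = \<one>\<^bsub>UP B\<^esub>"
      by (rule B.up_eqI) (use cl in auto)
  qed (use cl in auto)
qed

lemma (in ideal) finsum_closed:
  assumes "\<And>i. i \<in> F \<Longrightarrow> f i \<in> I"
  shows "finsum R f F \<in> I"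
  using assms
proof (induct F rule: infinite_finite_induct)
  case (insert x F)
  then have "f \<in> F \<rightarrow> carrier R" "f x \<in> carrier R" by auto
  then show ?case using insert by (simp add: finsum_insert)
qed auto

text \<open>It is the kernel of the map from \<open>A[t]\<close> to \<open>(A/K)[t]\<close>, a
  polynomial ring over a domain.\<close>

lemma poly_ideal_prime:
  assumes "primeideal K A"
  shows "primeideal (poly_ideal A K) (UP A)"
proof -
  interpret K: primeideal K A by fact
  interpret A: UP_cring A "UP A" using K.is_cring UP_cringI by auto
  interpret D: "domain" "A Quot K" by (rule K.quotient_is_domain)
  interpret Q: UP_domain "A Quot K" "UP (A Quot K)" by (simp add: UP_domain_def D.domain_axioms)
  note hom = K.rcos_ring_hom
  have zero: "K +>\<^bsub>A\<^esub> x = \<zero>\<^bsub>A Quot K\<^esub> \<longleftrightarrow> x \<in> K" if "x \<in> carrier A" for x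
    using that K.a_rcos_const K.rcos_const_imp_mem by (auto simp: FactRing_def)
  have "primeideal {f \<in> carrier (UP A). map_UP A ((+>\<^bsub>A\<^esub>) K) f \<in> {\<zero>\<^bsub>UP (A Quot K)\<^esub>}} (UP A)"
    by (rule primeideal_vimage_hom[OF A.UP_cring map_UP_hom[OF K.is_cring D.is_cring hom] Q.UP_domain[THEN domain.zeroprimeideal]])
  moreover have "map_UP A ((+>\<^bsub>A\<^esub>) K) f = \<zero>\<^bsub>UP (A Quot K)\<^esub> \<longleftrightarrow> (\<forall>n. coeff (UP A) f n \<in> K)"
    if f: "f \<in> carrier (UP A)" for f
  proof -
    note c = map_UP_closed[OF K.is_cring D.is_cring hom f]
    have "map_UP A ((+>\<^bsub>A\<^esub>) K) f = \<zero>\<^bsub>UP (A Quot K)\<^esub> \<longleftrightarrow>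
        (\<forall>n. coeff (UP (A Quot K)) (map_UP A ((+>\<^bsub>A\<^esub>) K) f) n = \<zero>\<^bsub>A Quot K\<^esub>)"
      using Q.up_eqI[OF _ c(1) Q.UP_zero_closed] by auto
    then show ?thesis using f by (simp add: c zero)
  qed
  ultimately show ?thesis unfolding poly_ideal_def by (simp cong: conj_cong)
qed

text \<open>A polynomial with coefficients in \<open>K\<close> is the sum of its terms, each of them
  a multiple of a constant from \<open>K\<close>.\<close>

lemma poly_ideal_extended:
  assumes "cring A" "ideal K A"
  shows "extended_ideal A K = poly_ideal A K"
proof -
  interpret A: UP_cring A "UP A" using assms UP_cringI by auto
  interpret K: ideal K A by fact
  let ?M = "(\<lambda>a. monom (UP A) a 0) ` K"
  have M: "?M \<subseteq> carrier (UP A)" by auto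
  interpret E: ideal "extended_ideal A K" "UP A"
    unfolding extended_ideal_def by (rule A.P.genideal_ideal[OF M])
  have "ideal (poly_ideal A K) (UP A)"
  proof (rule cring_idealI[OF A.UP_cring])
    fix f g assume "f \<in> poly_ideal A K" "g \<in> carrier (UP A)"
    then show "g \<otimes>\<^bsub>UP A\<^esub> f \<in> poly_ideal A K"
      unfolding poly_ideal_def by (auto intro!: K.finsum_closed K.I_l_closed)
  qed (auto simp: poly_ideal_def)
  moreover have "?M \<subseteq> poly_ideal A K" by (auto simp: poly_ideal_def)
  ultimately have 1: "extended_ideal A K \<subseteq> poly_ideal A K"
    unfolding extended_ideal_def by (rule A.P.genideal_minimal)
  have "f \<in> extended_ideal A K" if f: "f \<in> poly_ideal A K" for f
  proof -
    have fc: "f \<in> carrier (UP A)" and fK: "coeff (UP A) f n \<in> K" for n using f by (auto simp: poly_ideal_def)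
    have "monom (UP A) (coeff (UP A) f i) i \<in> extended_ideal A K" for i
    proof -
      have "monom (UP A) (coeff (UP A) f i) 0 \<in> extended_ideal A K"
        unfolding extended_ideal_def using A.P.genideal_self[OF M] fK by auto
      then have "monom (UP A) \<one>\<^bsub>A\<^esub> i \<otimes>\<^bsub>UP A\<^esub> monom (UP A) (coeff (UP A) f i) 0 \<in> extended_ideal A K"
        by (rule E.I_l_closed) simp
      moreover have "monom (UP A) \<one>\<^bsub>A\<^esub> i \<otimes>\<^bsub>UP A\<^esub> monom (UP A) (coeff (UP A) f i) 0 = monom (UP A) (coeff (UP A) f i) i"
        using A.monom_mult[of "\<one>\<^bsub>A\<^esub>" "coeff (UP A) f i" i 0] fc by simp
      ultimately show ?thesis by simp
    qed
    then have "(\<Oplus>\<^bsub>UP A\<^esub>i\<in>{..deg A f}. monom (UP A) (coeff (UP A) f i) i) \<in> extended_ideal A K"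
      by (intro E.finsum_closed)
    then show ?thesis using A.up_repr[OF fc] by simp
  qed
  with 1 show ?thesis by auto
qed

lemma is_fraction_map_common_denominator:
  assumes "is_fraction_map A \<psi> B"
  shows "(\<And>i. i \<in> {..<n::nat} \<Longrightarrow> x i \<in> carrier B) \<Longrightarrow>
    \<exists>c\<in>carrier A. \<psi> c \<in> Units B \<and> (\<forall>i\<in>{..<n}. \<exists>a\<in>carrier A. x i \<otimes>\<^bsub>B\<^esub> \<psi> c = \<psi> a)"
proof (induction n)
  case 0
  have "\<psi> \<one>\<^bsub>A\<^esub> = \<one>\<^bsub>B\<^esub>" "cring A" "cring B"
    using assms ring_hom_one unfolding is_fraction_map_def by blast+
  then show ?case
    using monoid.Units_one_closed[of B] monoid.one_closed[of A]
    by (auto simp: cring_def ring_def intro!: bexI[of _ "\<one>\<^bsub>A\<^esub>"])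
next
  case (Suc n)
  have cr: "cring A" "cring B" and hom: "\<psi> \<in> ring_hom A B"
    using assms by (auto simp: is_fraction_map_def)
  interpret h: ring_hom_cring A B \<psi> using cr hom by (intro UnivPoly.ring_hom_cringI) auto
  obtain c where c: "c \<in> carrier A" "\<psi> c \<in> Units B" "\<forall>i\<in>{..<n}. \<exists>a\<in>carrier A. x i \<otimes>\<^bsub>B\<^esub> \<psi> c = \<psi> a"
    using Suc by force
  obtain a s where a: "a \<in> carrier A" "s \<in> carrier A" "\<psi> s \<in> Units B" "x n \<otimes>\<^bsub>B\<^esub> \<psi> s = \<psi> a"
    using assms Suc.prems[of n] unfolding is_fraction_map_def by auto
  have "\<exists>a\<in>carrier A. x i \<otimes>\<^bsub>B\<^esub> \<psi> (c \<otimes>\<^bsub>A\<^esub> s) = \<psi> a" if i: "i \<in> {..<Suc n}" for i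
  proof (cases "i = n")
    case True
    have "x n \<otimes>\<^bsub>B\<^esub> \<psi> (c \<otimes>\<^bsub>A\<^esub> s) = (x n \<otimes>\<^bsub>B\<^esub> \<psi> s) \<otimes>\<^bsub>B\<^esub> \<psi> c"
      using a(1,2) c Suc.prems[of n] by (simp add: h.S.m_ac)
    also have "\<dots> = \<psi> (a \<otimes>\<^bsub>A\<^esub> c)" unfolding a(4) using a c by simp
    finally show ?thesis using True a c by blast
  next
    case False
    then have "i \<in> {..<n}" using i by auto
    then obtain b where b: "b \<in> carrier A" "x i \<otimes>\<^bsub>B\<^esub> \<psi> c = \<psi> b" using c(3) by blast
    have "x i \<otimes>\<^bsub>B\<^esub> \<psi> (c \<otimes>\<^bsub>A\<^esub> s) = (x i \<otimes>\<^bsub>B\<^esub> \<psi> c) \<otimes>\<^bsub>B\<^esub> \<psi> s"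
      using a(1,2) c Suc.prems[OF i] by (simp add: h.S.m_ac)
    also have "\<dots> = \<psi> (b \<otimes>\<^bsub>A\<^esub> s)" unfolding b(2) using a b by simp
    finally show ?thesis using a b by blast
  qed
  moreover have "\<psi> (c \<otimes>\<^bsub>A\<^esub> s) \<in> Units B" using a c by simp
  ultimately show ?case using a c h.R.m_closed by blast
qed

text \<open>The finitely many coefficients have a common denominator. The second part records that
  it is a constant polynomial \<open>c\<close> with \<open>\<psi> c\<close> a unit: later this
  denominator must be seen to avoid the extended prime.\<close>

lemma is_fraction_map_UP:
  assumes fr: "is_fraction_map A \<psi> B"
  shows "is_fraction_map (UP A) (map_UP A \<psi>) (UP B)"
    and "f \<in> carrier (UP B) \<Longrightarrow> \<exists>c\<in>carrier A. \<exists>F\<in>carrier (UP A). \<psi> c \<in> Units B \<and>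
      map_UP A \<psi> (monom (UP A) c 0) \<in> Units (UP B) \<and>
      f \<otimes>\<^bsub>UP B\<^esub> map_UP A \<psi> (monom (UP A) c 0) = map_UP A \<psi> F"
proof -
  have cr: "cring A" "cring B" and hom: "\<psi> \<in> ring_hom A B"
    using assms by (auto simp: is_fraction_map_def)
  interpret A: UP_cring A "UP A" using cr UP_cringI by auto
  interpret B: UP_cring B "UP B" using cr UP_cringI by auto
  interpret h: ring_hom_cring A B \<psi> using cr hom by (intro UnivPoly.ring_hom_cringI) auto
  note m = map_UP_closed[OF cr hom]
  have mono: "map_UP A \<psi> (monom (UP A) c 0) = monom (UP B) (\<psi> c) 0" if "c \<in> carrier A" for c
    by (rule B.up_eqI) (use that m in auto)
  have main: "\<exists>c\<in>carrier A. \<exists>F\<in>carrier (UP A). \<psi> c \<in> Units B \<and>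
      map_UP A \<psi> (monom (UP A) c 0) \<in> Units (UP B) \<and>
      f \<otimes>\<^bsub>UP B\<^esub> map_UP A \<psi> (monom (UP A) c 0) = map_UP A \<psi> F" if f: "f \<in> carrier (UP B)" for f
  proof -
    obtain c where c: "c \<in> carrier A" "\<psi> c \<in> Units B"
      "\<forall>i\<in>{..<Suc (deg B f)}. \<exists>a\<in>carrier A. coeff (UP B) f i \<otimes>\<^bsub>B\<^esub> \<psi> c = \<psi> a"
      using is_fraction_map_common_denominator[OF fr, of "Suc (deg B f)" "coeff (UP B) f"] f by auto
    then obtain a where a: "\<And>i. i < Suc (deg B f) \<Longrightarrow> a i \<in> carrier A \<and> coeff (UP B) f i \<otimes>\<^bsub>B\<^esub> \<psi> c = \<psi> (a i)"
      unfolding Ball_def Bex_def lessThan_iff by metis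
    define F where "F i = (if i < Suc (deg B f) then a i else \<zero>\<^bsub>A\<^esub>)" for i
    have F: "F \<in> carrier (UP A)" "coeff (UP A) F n = F n" for n
      by (rule A.UP_memI[of F "deg B f"]; use a in \<open>auto simp: F_def\<close>)+
    have u: "map_UP A \<psi> (monom (UP A) c 0) \<in> Units (UP B)"
      unfolding mono[OF c(1)]
      by (rule ring_hom_Units[OF cr(2) B.UP_cring B.const_ring_hom c(2)])
    have "f \<otimes>\<^bsub>UP B\<^esub> monom (UP B) (\<psi> c) 0 = \<psi> c \<odot>\<^bsub>UP B\<^esub> f"
      using B.monom_mult_is_smult[of "\<psi> c" f] c f B.UP_m_comm by simp
    also have "\<dots> = map_UP A \<psi> F"
    proof (rule B.up_eqI)
      fix n
      show "coeff (UP B) (\<psi> c \<odot>\<^bsub>UP B\<^esub> f) n = coeff (UP B) (map_UP A \<psi> F) n"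
        using f c a[of n] B.deg_aboveD[of f n] by (auto simp: m F F_def B.R.m_comm)
    qed (use f c m F in auto)
    finally show ?thesis using c F u mono by metis
  qed
  then show "f \<in> carrier (UP B) \<Longrightarrow> \<exists>c\<in>carrier A. \<exists>F\<in>carrier (UP A). \<psi> c \<in> Units B \<and>
      map_UP A \<psi> (monom (UP A) c 0) \<in> Units (UP B) \<and>
      f \<otimes>\<^bsub>UP B\<^esub> map_UP A \<psi> (monom (UP A) c 0) = map_UP A \<psi> F" .
  show "is_fraction_map (UP A) (map_UP A \<psi>) (UP B)"
    unfolding is_fraction_map_def
    using A.UP_cring B.UP_cring map_UP_hom[OF cr hom] main A.monom_closed by blast
qed

text \<open>Identifies the ring in (F1): \<open>C[t]\<close> localized at the extended maximal ideal
  is the local ring of \<open>(A/J)[t]\<close> at \<open>P[t]\<close>. Elements of \<open>A\<close>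
  outside \<open>P\<close> are constants outside \<open>P[t]\<close>, so localizing first in
  \<open>A\<close> and then in \<open>C[t]\<close> is the same as localizing once in
  \<open>A[t]\<close>.\<close>

lemma local_ring_at_UP:
  assumes L: "local_ring_at A J P \<psi> C" and J: "ideal J A" and M: "M = carrier C - Units C"
  shows "local_ring_at (UP A) (poly_ideal A J) (poly_ideal A P)
    ((\<lambda>f. frac (UP C) (carrier (UP C) - extended_ideal C M) f \<one>\<^bsub>UP C\<^esub>) \<circ> map_UP A \<psi>)
    (localization_at (UP C) (extended_ideal C M))"
proof -
  have fr: "is_fraction_map A \<psi> C" and P: "primeideal P A"
    and ker: "\<And>a. a \<in> carrier A \<Longrightarrow> \<psi> a = \<zero>\<^bsub>C\<^esub> \<longleftrightarrow> (\<exists>s\<in>carrier A - P. s \<otimes>\<^bsub>A\<^esub> a \<in> J)"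
    and U: "\<And>a. a \<in> carrier A \<Longrightarrow> \<psi> a \<in> Units C \<longleftrightarrow> a \<notin> P" using L by (auto simp: local_ring_at_def)
  then have cr: "cring C" "cring A" and hom: "\<psi> \<in> ring_hom A C" by (auto simp: is_fraction_map_def)
  interpret A: UP_cring A "UP A" using cr UP_cringI by auto
  interpret C: UP_cring C "UP C" using cr UP_cringI by auto
  interpret h: ring_hom_cring A C \<psi> using cr hom by (intro UnivPoly.ring_hom_cringI) auto
  interpret P: primeideal P A by fact
  interpret J: ideal J A by fact
  have maxM: "maximalideal M C" unfolding M by (rule local_ring_at_local(3)[OF L])
  have primeM: "primeideal M C" by (rule cring.maximalideal_prime[OF cr(1) maxM])
  have ext: "extended_ideal C M = poly_ideal C M"
    by (rule poly_ideal_extended[OF cr(1) maximalideal.axioms(1)[OF maxM]])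
  let ?N = "poly_ideal C M" and ?m = "map_UP A \<psi>"
  have primeN: "primeideal ?N (UP C)" by (rule poly_ideal_prime[OF primeM])
  interpret N: primeideal ?N "UP C" by fact
  interpret l: localize "UP C" "carrier (UP C) - ?N" by (rule localize_at_prime[OF primeN])
  note m = map_UP_closed[OF cr(2,1) hom] and mh = map_UP_hom[OF cr(2,1) hom] and fm = is_fraction_map_UP[OF fr]
  have inN: "?m f \<in> ?N \<longleftrightarrow> f \<in> poly_ideal A P" if f: "f \<in> carrier (UP A)" for f
    using f U m(1)[OF f] unfolding poly_ideal_def M by (auto simp: m(2)[OF f])
  have mzero: "?m f = \<zero>\<^bsub>UP C\<^esub> \<longleftrightarrow> (\<forall>n. \<psi> (coeff (UP A) f n) = \<zero>\<^bsub>C\<^esub>)" if f: "f \<in> carrier (UP A)" for f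
    using C.up_eqI[OF _ m(1)[OF f] C.UP_zero_closed] m(2)[OF f] by (metis C.coeff_zero)
  have const: "?m (monom (UP A) c 0) \<notin> ?N" if "c \<in> carrier A" "c \<notin> P" for c
  proof -
    have "coeff (UP A) (monom (UP A) c 0) 0 \<notin> P" using that by simp
    then have "monom (UP A) c 0 \<notin> poly_ideal A P" unfolding poly_ideal_def by blast
    then show ?thesis using inN[OF A.monom_closed[OF that(1)]] by blast
  qed
  have one: "\<one>\<^bsub>A\<^esub> \<in> carrier A - P" using P.one_imp_carrier P.I_notcarr by auto
  have Jzero: "\<psi> a = \<zero>\<^bsub>C\<^esub>" if "a \<in> J" for a
  proof -
    have "\<one>\<^bsub>A\<^esub> \<otimes>\<^bsub>A\<^esub> a \<in> J" using that by simp
    then show ?thesis using ker[OF J.Icarr[OF that]] one by blast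
  qed
  show ?thesis
    unfolding local_ring_at_def ext
  proof (intro conjI ballI)
    show "is_fraction_map (UP A) ((\<lambda>f. frac (UP C) (carrier (UP C) - ?N) f \<one>\<^bsub>UP C\<^esub>) \<circ> ?m) (localization_at (UP C) ?N)"
      by (rule is_fraction_map_trans[OF fm(1) is_fraction_map_localization_at[OF primeN]])
    show "primeideal (poly_ideal A P) (UP A)" by (rule poly_ideal_prime[OF P])
  next
    fix f assume f: "f \<in> carrier (UP A)"
    show "((\<lambda>f. frac (UP C) (carrier (UP C) - ?N) f \<one>\<^bsub>UP C\<^esub>) \<circ> ?m) f \<in> Units (localization_at (UP C) ?N) \<longleftrightarrow>
        f \<notin> poly_ideal A P"
      using frac_unit_at_prime_iff[OF primeN m(1)[OF f]] inN[OF f] by simp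
    have "(\<exists>u\<in>carrier (UP C) - ?N. u \<otimes>\<^bsub>UP C\<^esub> ?m f = \<zero>\<^bsub>UP C\<^esub>) \<longleftrightarrow>
      (\<exists>s\<in>carrier (UP A) - poly_ideal A P. s \<otimes>\<^bsub>UP A\<^esub> f \<in> poly_ideal A J)"
    proof
      assume "\<exists>s\<in>carrier (UP A) - poly_ideal A P. s \<otimes>\<^bsub>UP A\<^esub> f \<in> poly_ideal A J"
      then obtain s where s: "s \<in> carrier (UP A)" "s \<notin> poly_ideal A P" "s \<otimes>\<^bsub>UP A\<^esub> f \<in> poly_ideal A J" by auto
      have "?m (s \<otimes>\<^bsub>UP A\<^esub> f) = \<zero>\<^bsub>UP C\<^esub>"
        using mzero[OF A.P.m_closed[OF s(1) f]] s(3) Jzero unfolding poly_ideal_def by blast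
      then have "?m s \<otimes>\<^bsub>UP C\<^esub> ?m f = \<zero>\<^bsub>UP C\<^esub>" using ring_hom_mult[OF mh s(1) f] by simp
      then show "\<exists>u\<in>carrier (UP C) - ?N. u \<otimes>\<^bsub>UP C\<^esub> ?m f = \<zero>\<^bsub>UP C\<^esub>" using s inN m(1) by blast
    next
      assume "\<exists>u\<in>carrier (UP C) - ?N. u \<otimes>\<^bsub>UP C\<^esub> ?m f = \<zero>\<^bsub>UP C\<^esub>"
      then obtain g where g: "g \<in> carrier (UP C)" "g \<notin> ?N" "g \<otimes>\<^bsub>UP C\<^esub> ?m f = \<zero>\<^bsub>UP C\<^esub>" by auto
      \<comment> \<open>Clearing denominators turns the annihilator \<open>g\<close> over
        \<open>C\<close> into a polynomial \<open>G\<close> over \<open>A\<close>, whose image is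
        still outside the extended prime.\<close>
      obtain c G where c: "c \<in> carrier A" "\<psi> c \<in> Units C" "G \<in> carrier (UP A)"
        "g \<otimes>\<^bsub>UP C\<^esub> ?m (monom (UP A) c 0) = ?m G" using fm(2)[OF g(1)] by blast
      have mc: "?m (monom (UP A) c 0) \<in> carrier (UP C)" "?m (monom (UP A) c 0) \<notin> ?N"
        using m(1) const U c by auto
      have GN: "?m G \<notin> ?N"
        using N.I_prime[OF g(1) mc(1)] g mc unfolding c(4) by blast
      have "?m (G \<otimes>\<^bsub>UP A\<^esub> f) = (g \<otimes>\<^bsub>UP C\<^esub> ?m f) \<otimes>\<^bsub>UP C\<^esub> ?m (monom (UP A) c 0)"
        unfolding ring_hom_mult[OF mh c(3) f] c(4)[symmetric] using g(1) mc(1) m(1)[OF f] by (simp add: C.P.m_ac)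
      then have "?m (G \<otimes>\<^bsub>UP A\<^esub> f) = \<zero>\<^bsub>UP C\<^esub>" using g mc by simp
      then have z: "\<psi> (coeff (UP A) (G \<otimes>\<^bsub>UP A\<^esub> f) n) = \<zero>\<^bsub>C\<^esub>" for n
        using mzero[OF A.P.m_closed[OF c(3) f]] by blast
      \<comment> \<open>Each coefficient of the product of \<open>G\<close> and \<open>f\<close>
        vanishes in \<open>C\<close>, so some element outside \<open>P\<close> moves it into
        \<open>J\<close>; as there are finitely many coefficients, one product of such elements
        serves them all.\<close>
      have "\<exists>d\<in>carrier A - P. \<forall>n<k. d \<otimes>\<^bsub>A\<^esub> coeff (UP A) (G \<otimes>\<^bsub>UP A\<^esub> f) n \<in> J" for k
      proof (induction k)
        case 0
        then show ?case using P.one_imp_carrier P.I_notcarr A.R.one_closed by blast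
      next
        case (Suc k)
        then obtain d where d: "d \<in> carrier A - P" "\<forall>n<k. d \<otimes>\<^bsub>A\<^esub> coeff (UP A) (G \<otimes>\<^bsub>UP A\<^esub> f) n \<in> J" by auto
        obtain e where e: "e \<in> carrier A - P" "e \<otimes>\<^bsub>A\<^esub> coeff (UP A) (G \<otimes>\<^bsub>UP A\<^esub> f) k \<in> J"
          using ker z A.coeff_closed[OF A.P.m_closed[OF c(3) f]] by blast
        have de: "d \<otimes>\<^bsub>A\<^esub> e \<in> carrier A - P" using d e P.I_prime[of d e] by auto
        have "d \<otimes>\<^bsub>A\<^esub> e \<otimes>\<^bsub>A\<^esub> coeff (UP A) (G \<otimes>\<^bsub>UP A\<^esub> f) n \<in> J" if "n < Suc k" for n
        proof -
          let ?x = "coeff (UP A) (G \<otimes>\<^bsub>UP A\<^esub> f) n"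
          have x: "?x \<in> carrier A" by (rule A.coeff_closed[OF A.P.m_closed[OF c(3) f]])
          have e1: "d \<otimes>\<^bsub>A\<^esub> e \<otimes>\<^bsub>A\<^esub> ?x = d \<otimes>\<^bsub>A\<^esub> (e \<otimes>\<^bsub>A\<^esub> ?x)" "d \<otimes>\<^bsub>A\<^esub> e \<otimes>\<^bsub>A\<^esub> ?x = e \<otimes>\<^bsub>A\<^esub> (d \<otimes>\<^bsub>A\<^esub> ?x)"
            using d(1) e(1) x A.R.m_assoc A.R.m_lcomm by auto
          show ?thesis
          proof (cases "n = k")
            case True
            then show ?thesis unfolding e1(1) using e d J.I_l_closed by blast
          next
            case False
            then have "d \<otimes>\<^bsub>A\<^esub> ?x \<in> J" using d that by auto
            then show ?thesis unfolding e1(2) using e J.I_l_closed by blast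
          qed
        qed
        then show ?case using de by blast
      qed
      then obtain d where d: "d \<in> carrier A - P"
        "\<forall>n<Suc (deg A (G \<otimes>\<^bsub>UP A\<^esub> f)). d \<otimes>\<^bsub>A\<^esub> coeff (UP A) (G \<otimes>\<^bsub>UP A\<^esub> f) n \<in> J" by blast
      let ?s = "monom (UP A) d 0 \<otimes>\<^bsub>UP A\<^esub> G"
      have dc: "d \<in> carrier A" "monom (UP A) d 0 \<in> carrier (UP A)" using d by auto
      have sc: "?s \<in> carrier (UP A)" by (rule A.P.m_closed[OF dc(2) c(3)])
      have "?m ?s \<notin> ?N"
        using N.I_prime[OF m(1)[OF dc(2)] m(1)[OF c(3)]] const[of d] d GN
        unfolding ring_hom_mult[OF mh dc(2) c(3)] by blast
      then have "?s \<notin> poly_ideal A P" using inN[OF sc] by blast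
      moreover have "?s \<otimes>\<^bsub>UP A\<^esub> f \<in> poly_ideal A J"
      proof -
        have eq: "?s \<otimes>\<^bsub>UP A\<^esub> f = d \<odot>\<^bsub>UP A\<^esub> (G \<otimes>\<^bsub>UP A\<^esub> f)"
          unfolding A.P.m_assoc[OF dc(2) c(3) f] by (rule A.monom_mult_is_smult[OF dc(1) A.P.m_closed[OF c(3) f]])
        have "d \<otimes>\<^bsub>A\<^esub> coeff (UP A) (G \<otimes>\<^bsub>UP A\<^esub> f) n \<in> J" for n
        proof (cases "n < Suc (deg A (G \<otimes>\<^bsub>UP A\<^esub> f))")
          case False
          then have "coeff (UP A) (G \<otimes>\<^bsub>UP A\<^esub> f) n = \<zero>\<^bsub>A\<^esub>"
            using A.deg_aboveD[OF _ A.P.m_closed[OF c(3) f]] by simp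
          then show ?thesis using dc(1) by simp
        qed (use d in blast)
        then show ?thesis
          unfolding eq poly_ideal_def using A.coeff_smult[OF dc(1) A.P.m_closed[OF c(3) f]]
            A.UP_smult_closed[OF dc(1) A.P.m_closed[OF c(3) f]] by simp
      qed
      ultimately show "\<exists>s\<in>carrier (UP A) - poly_ideal A P. s \<otimes>\<^bsub>UP A\<^esub> f \<in> poly_ideal A J" using sc by blast
    qed
    then show "((\<lambda>f. frac (UP C) (carrier (UP C) - ?N) f \<one>\<^bsub>UP C\<^esub>) \<circ> ?m) f = \<zero>\<^bsub>localization_at (UP C) ?N\<^esub> \<longleftrightarrow>
       (\<exists>s\<in>carrier (UP A) - poly_ideal A P. s \<otimes>\<^bsub>UP A\<^esub> f \<in> poly_ideal A J)"
      using l.frac_eq_zero_iff[OF m(1)[OF f]] unfolding localization_at_def by simp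
  qed
qed

text \<open>In place of surjectivity: each element of \<open>A\<close> enters the image of
  \<open>B\<close> after multiplication by some \<open>h e\<close> outside \<open>P\<close>, that
  is, by a unit of the local ring. This applies to \<open>k[X]\<close> in its localization, and to
  polynomials and the Rees algebra in the Laurent ring.\<close>

lemma local_ring_at_restrict:
  assumes L: "local_ring_at A J P \<psi> L" and J: "ideal J A" and "cring B" and h: "h \<in> ring_hom B A"
    and mult: "\<And>a. a \<in> carrier A \<Longrightarrow> \<exists>e\<in>carrier B. \<exists>b\<in>carrier B. h e \<notin> P \<and> h e \<otimes>\<^bsub>A\<^esub> a = h b"
  shows "local_ring_at B {b \<in> carrier B. h b \<in> J} {b \<in> carrier B. h b \<in> P} (\<psi> \<circ> h) L"
proof -
  have fr: "is_fraction_map A \<psi> L" and P: "primeideal P A"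
    and ker: "\<And>a. a \<in> carrier A \<Longrightarrow> \<psi> a = \<zero>\<^bsub>L\<^esub> \<longleftrightarrow> (\<exists>s\<in>carrier A - P. s \<otimes>\<^bsub>A\<^esub> a \<in> J)"
    and U: "\<And>a. a \<in> carrier A \<Longrightarrow> \<psi> a \<in> Units L \<longleftrightarrow> a \<notin> P" using L by (auto simp: local_ring_at_def)
  then have cr: "cring L" "cring A" and hom: "\<psi> \<in> ring_hom A L" by (auto simp: is_fraction_map_def)
  interpret h: ring_hom_cring B A h using cr assms by (intro UnivPoly.ring_hom_cringI) auto
  interpret psi: ring_hom_cring A L \<psi> using cr hom by (intro UnivPoly.ring_hom_cringI) auto
  interpret P: primeideal P A by fact
  interpret J: ideal J A by fact
  show ?thesis
    unfolding local_ring_at_def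
  proof (intro conjI ballI)
    show "primeideal {b \<in> carrier B. h b \<in> P} B" by (rule primeideal_vimage_hom) fact+
    show "is_fraction_map B (\<psi> \<circ> h) L"
      unfolding is_fraction_map_def
    proof (intro conjI ballI)
      fix x assume x: "x \<in> carrier L"
      obtain a s where a: "a \<in> carrier A" "s \<in> carrier A" "\<psi> s \<in> Units L" "x \<otimes>\<^bsub>L\<^esub> \<psi> s = \<psi> a"
        using fr x unfolding is_fraction_map_def by blast
      obtain e1 b1 where 1: "e1 \<in> carrier B" "b1 \<in> carrier B" "h e1 \<notin> P" "h e1 \<otimes>\<^bsub>A\<^esub> s = h b1" using mult[OF a(2)] by blast
      obtain e2 b2 where 2: "e2 \<in> carrier B" "b2 \<in> carrier B" "h e2 \<notin> P" "h e2 \<otimes>\<^bsub>A\<^esub> a = h b2" using mult[OF a(1)] by blast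
      \<comment> \<open>\<open>s\<close> and \<open>a\<close> enter the image with different factors
        \<open>h e1\<close> and \<open>h e2\<close>; multiplying crosswise gives them the same
        factor.\<close>
      have e: "h (b1 \<otimes>\<^bsub>B\<^esub> e2) = h e1 \<otimes>\<^bsub>A\<^esub> h e2 \<otimes>\<^bsub>A\<^esub> s" "h (e1 \<otimes>\<^bsub>B\<^esub> b2) = h e1 \<otimes>\<^bsub>A\<^esub> h e2 \<otimes>\<^bsub>A\<^esub> a"
        using 1(1,2) 2(1,2) a(1,2) by (simp_all add: 1(4)[symmetric] 2(4)[symmetric] h.S.m_ac)
      have u: "\<psi> (h e1) \<in> Units L" "\<psi> (h e2) \<in> Units L" using U 1 2 by auto
      have uc: "\<psi> (h e1) \<in> carrier L" "\<psi> (h e2) \<in> carrier L" "\<psi> s \<in> carrier L" using 1 2 a by auto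
      have "\<psi> (h (b1 \<otimes>\<^bsub>B\<^esub> e2)) = \<psi> (h e1) \<otimes>\<^bsub>L\<^esub> \<psi> (h e2) \<otimes>\<^bsub>L\<^esub> \<psi> s"
        unfolding e using 1(1) 2(1) a(2) by simp
      moreover have "\<psi> (h (e1 \<otimes>\<^bsub>B\<^esub> b2)) = \<psi> (h e1) \<otimes>\<^bsub>L\<^esub> \<psi> (h e2) \<otimes>\<^bsub>L\<^esub> (x \<otimes>\<^bsub>L\<^esub> \<psi> s)"
        unfolding e a(4) using 1(1) 2(1) a(1) by simp
      ultimately have "\<psi> (h (b1 \<otimes>\<^bsub>B\<^esub> e2)) \<in> Units L" "x \<otimes>\<^bsub>L\<^esub> \<psi> (h (b1 \<otimes>\<^bsub>B\<^esub> e2)) = \<psi> (h (e1 \<otimes>\<^bsub>B\<^esub> b2))"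
        using u a(3) uc x by (simp_all add: psi.S.m_ac)
      moreover have "b1 \<otimes>\<^bsub>B\<^esub> e2 \<in> carrier B" "e1 \<otimes>\<^bsub>B\<^esub> b2 \<in> carrier B" using 1 2 by auto
      ultimately show "\<exists>a\<in>carrier B. \<exists>s\<in>carrier B. (\<psi> \<circ> h) s \<in> Units L \<and> x \<otimes>\<^bsub>L\<^esub> (\<psi> \<circ> h) s = (\<psi> \<circ> h) a"
        unfolding comp_def by blast
    qed (use cr assms ring_hom_trans[OF h hom] in auto)
  next
    fix b assume b: "b \<in> carrier B"
    show "(\<psi> \<circ> h) b \<in> Units L \<longleftrightarrow> b \<notin> {b \<in> carrier B. h b \<in> P}" using U b by auto
    have "(\<exists>s\<in>carrier A - P. s \<otimes>\<^bsub>A\<^esub> h b \<in> J) \<longleftrightarrow> (\<exists>s\<in>carrier B. h s \<notin> P \<and> h s \<otimes>\<^bsub>A\<^esub> h b \<in> J)"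
    proof
      assume "\<exists>s\<in>carrier A - P. s \<otimes>\<^bsub>A\<^esub> h b \<in> J"
      then obtain s where s: "s \<in> carrier A" "s \<notin> P" "s \<otimes>\<^bsub>A\<^esub> h b \<in> J" by auto
      obtain e c where e: "e \<in> carrier B" "c \<in> carrier B" "h e \<notin> P" "h e \<otimes>\<^bsub>A\<^esub> s = h c" using mult[OF s(1)] by blast
      have "h c \<notin> P" using P.I_prime[of "h e" s] e(1,3) s e(4) by auto
      moreover have "h e \<otimes>\<^bsub>A\<^esub> (s \<otimes>\<^bsub>A\<^esub> h b) \<in> J" using J.I_l_closed[OF s(3)] e by simp
      then have "h c \<otimes>\<^bsub>A\<^esub> h b \<in> J" unfolding e(4)[symmetric] using e(1) s b by (simp add: h.S.m_assoc)
      ultimately show "\<exists>s\<in>carrier B. h s \<notin> P \<and> h s \<otimes>\<^bsub>A\<^esub> h b \<in> J" using e by blast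
    qed auto
    then show "(\<psi> \<circ> h) b = \<zero>\<^bsub>L\<^esub> \<longleftrightarrow> (\<exists>s\<in>carrier B - {b \<in> carrier B. h b \<in> P}. s \<otimes>\<^bsub>B\<^esub> b \<in> {b \<in> carrier B. h b \<in> J})"
      using ker b by auto
  qed
qed

section \<open>Noetherian subrings of type class rings\<close>

text \<open>Subrings of type class rings as records: computations run with the type class
  operations, while ideals, quotients and localizations are those of the record.\<close>

definition ring_on :: "'a::comm_ring_1 set \<Rightarrow> 'a ring" where
  "ring_on C = \<lparr>carrier = C, mult = (*), one = 1, ring.zero = 0, add = (+)\<rparr>"

lemma ring_on_simps [simp]:
  "carrier (ring_on C) = C" "x \<otimes>\<^bsub>ring_on C\<^esub> y = x * y" "\<one>\<^bsub>ring_on C\<^esub> = 1"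
  "\<zero>\<^bsub>ring_on C\<^esub> = 0" "x \<oplus>\<^bsub>ring_on C\<^esub> y = x + y"
  by (simp_all add: ring_on_def)

definition subring_on :: "'a::comm_ring_1 set \<Rightarrow> bool" where
  "subring_on C \<longleftrightarrow> 0 \<in> C \<and> 1 \<in> C \<and> (\<forall>x\<in>C. - x \<in> C) \<and> (\<forall>x\<in>C. \<forall>y\<in>C. x + y \<in> C \<and> x * y \<in> C)"

definition ideal_on :: "'a::comm_ring_1 set \<Rightarrow> 'a set \<Rightarrow> bool" where
  "ideal_on C I \<longleftrightarrow> I \<subseteq> C \<and> 0 \<in> I \<and> (\<forall>x\<in>I. \<forall>y\<in>I. x + y \<in> I) \<and> (\<forall>r\<in>C. \<forall>x\<in>I. r * x \<in> I)"

lemma subring_onD: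
  assumes "subring_on C"
  shows "0 \<in> C" "1 \<in> C" "x \<in> C \<Longrightarrow> - x \<in> C" "x \<in> C \<Longrightarrow> y \<in> C \<Longrightarrow> x + y \<in> C"
    "x \<in> C \<Longrightarrow> y \<in> C \<Longrightarrow> x * y \<in> C" "x \<in> C \<Longrightarrow> y \<in> C \<Longrightarrow> x - y \<in> C" "x \<in> C \<Longrightarrow> x ^ m \<in> C"
    "(\<And>i. i \<in> A \<Longrightarrow> f i \<in> C) \<Longrightarrow> sum f A \<in> C" "(\<And>i. i \<in> A \<Longrightarrow> f i \<in> C) \<Longrightarrow> prod f A \<in> C"
proof -
  show *: "0 \<in> C" "1 \<in> C" "\<And>x. x \<in> C \<Longrightarrow> - x \<in> C" "\<And>x y. x \<in> C \<Longrightarrow> y \<in> C \<Longrightarrow> x + y \<in> C"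
    "\<And>x y. x \<in> C \<Longrightarrow> y \<in> C \<Longrightarrow> x * y \<in> C"
    using assms by (auto simp: subring_on_def)
  show "x \<in> C \<Longrightarrow> y \<in> C \<Longrightarrow> x - y \<in> C" using *(3,4)[of y] *(4)[of x "- y"] by simp
  show "x \<in> C \<Longrightarrow> x ^ m \<in> C" by (induction m) (auto intro: *)
  show "(\<And>i. i \<in> A \<Longrightarrow> f i \<in> C) \<Longrightarrow> sum f A \<in> C"
    by (induction A rule: infinite_finite_induct) (auto intro: *)
  show "(\<And>i. i \<in> A \<Longrightarrow> f i \<in> C) \<Longrightarrow> prod f A \<in> C"
    by (induction A rule: infinite_finite_induct) (auto intro: *)
qed

lemma ideal_onD:
  assumes "ideal_on C I"
  shows "I \<subseteq> C" "0 \<in> I" "x \<in> I \<Longrightarrow> y \<in> I \<Longrightarrow> x + y \<in> I" "r \<in> C \<Longrightarrow> x \<in> I \<Longrightarrow> r * x \<in> I"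
    "(\<And>i. i \<in> A \<Longrightarrow> f i \<in> I) \<Longrightarrow> sum f A \<in> I"
proof -
  show *: "I \<subseteq> C" "0 \<in> I" "\<And>x y. x \<in> I \<Longrightarrow> y \<in> I \<Longrightarrow> x + y \<in> I" "\<And>r x. r \<in> C \<Longrightarrow> x \<in> I \<Longrightarrow> r * x \<in> I"
    using assms by (auto simp: ideal_on_def)
  show "(\<And>i. i \<in> A \<Longrightarrow> f i \<in> I) \<Longrightarrow> sum f A \<in> I"
    by (induction A rule: infinite_finite_induct) (auto intro: *)
qed

lemma ideal_on_diff:
  assumes "subring_on C" "ideal_on C I" "x \<in> I" "y \<in> I"
  shows "x - y \<in> I"
proof -
  have "(- 1) * y \<in> I" using assms by (intro ideal_onD(4) subring_onD(3)) (auto intro: subring_onD)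
  then show ?thesis using ideal_onD(3)[OF assms(2,3), of "- y"] by simp
qed

lemma cring_ring_on: "subring_on C \<Longrightarrow> cring (ring_on C)"
proof (rule cringI)
  assume C: "subring_on C"
  show "abelian_group (ring_on C)"
  proof (rule abelian_groupI)
    fix x assume "x \<in> carrier (ring_on C)"
    then show "\<exists>y\<in>carrier (ring_on C). y \<oplus>\<^bsub>ring_on C\<^esub> x = \<zero>\<^bsub>ring_on C\<^esub>"
      using subring_onD[OF C] by (intro bexI[of _ "- x"]) auto
  qed (use subring_onD[OF C] in \<open>auto simp: algebra_simps\<close>)
  show "comm_monoid (ring_on C)"
    by (rule comm_monoidI) (use subring_onD[OF C] in \<open>auto simp: algebra_simps\<close>)
qed (auto simp: algebra_simps)

lemma ring_on_minus [simp]: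
  assumes "subring_on C" "x \<in> C" "y \<in> C"
  shows "x \<ominus>\<^bsub>ring_on C\<^esub> y = x - y"
proof -
  interpret cring "ring_on C" by (rule cring_ring_on[OF assms(1)])
  have "\<ominus>\<^bsub>ring_on C\<^esub> y = - y"
    by (rule minus_equality) (use assms subring_onD in auto)
  then show ?thesis by (simp add: minus_eq)
qed

lemma ideal_ring_on_iff:
  assumes "subring_on C"
  shows "ideal I (ring_on C) \<longleftrightarrow> ideal_on C I"
proof
  assume "ideal I (ring_on C)"
  then interpret I: ideal I "ring_on C" .
  show "ideal_on C I"
    unfolding ideal_on_def using additive_subgroup.zero_closed[OF I.is_additive_subgroup]
      additive_subgroup.a_closed[OF I.is_additive_subgroup] I.I_l_closed I.a_subset by auto
next
  assume "ideal_on C I"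
  then show "ideal I (ring_on C)"
    by (intro cring_idealI cring_ring_on[OF assms]) (auto simp: ideal_on_def)
qed

lemma primeideal_ring_on_iff:
  assumes "subring_on C"
  shows "primeideal P (ring_on C) \<longleftrightarrow>
    ideal_on C P \<and> 1 \<notin> P \<and> (\<forall>x\<in>C. \<forall>y\<in>C. x * y \<in> P \<longrightarrow> x \<in> P \<or> y \<in> P)"
proof
  assume "primeideal P (ring_on C)"
  then interpret P: primeideal P "ring_on C" .
  show "ideal_on C P \<and> 1 \<notin> P \<and> (\<forall>x\<in>C. \<forall>y\<in>C. x * y \<in> P \<longrightarrow> x \<in> P \<or> y \<in> P)"
    using ideal_ring_on_iff[OF assms] P.is_ideal P.one_imp_carrier P.I_notcarr P.I_prime by auto
next
  assume "ideal_on C P \<and> 1 \<notin> P \<and> (\<forall>x\<in>C. \<forall>y\<in>C. x * y \<in> P \<longrightarrow> x \<in> P \<or> y \<in> P)"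
  then show "primeideal P (ring_on C)"
    using ideal_ring_on_iff[OF assms] cring_ring_on[OF assms] subring_onD(2)[OF assms]
    by (intro primeidealI) auto
qed

text \<open>The coefficients are indexed by \<open>E\<close> itself, which is finite where
  generators are meant; for an infinite \<open>E\<close> the sum has the default value 0.\<close>

definition lincomb :: "'a::comm_ring_1 set \<Rightarrow> 'a set \<Rightarrow> 'a set" where
  "lincomb C E = {\<Sum>e\<in>E. r e * e | r. \<forall>e\<in>E. r e \<in> C}"

lemma lincomb_ideal:
  assumes "subring_on C" "E \<subseteq> C"
  shows "ideal_on C (lincomb C E)"
  unfolding ideal_on_def
proof (intro conjI ballI)
  show "lincomb C E \<subseteq> C"
    unfolding lincomb_def using assms by (auto intro!: subring_onD(8) subring_onD(5))
  show "0 \<in> lincomb C E"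
    unfolding lincomb_def using subring_onD(1)[OF assms(1)] by (intro CollectI exI[of _ "\<lambda>_. 0"]) auto
  fix x y assume "x \<in> lincomb C E" "y \<in> lincomb C E"
  then obtain r s where r: "\<forall>e\<in>E. r e \<in> C" "x = (\<Sum>e\<in>E. r e * e)" "\<forall>e\<in>E. s e \<in> C" "y = (\<Sum>e\<in>E. s e * e)"
    unfolding lincomb_def by auto
  then show "x + y \<in> lincomb C E"
    unfolding lincomb_def using subring_onD(4)[OF assms(1)]
    by (intro CollectI exI[of _ "\<lambda>e. r e + s e"]) (auto simp: algebra_simps sum.distrib)
next
  fix c x assume "c \<in> C" "x \<in> lincomb C E"
  then obtain r where "\<forall>e\<in>E. r e \<in> C" "x = (\<Sum>e\<in>E. r e * e)" unfolding lincomb_def by auto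
  then show "c * x \<in> lincomb C E"
    unfolding lincomb_def using subring_onD(5)[OF assms(1)] \<open>c \<in> C\<close>
    by (intro CollectI exI[of _ "\<lambda>e. c * r e"]) (auto simp: algebra_simps sum_distrib_left)
qed

lemma lincomb_base:
  assumes "subring_on C" "finite E"
  shows "E \<subseteq> lincomb C E"
proof
  fix x assume "x \<in> E"
  then have "(\<Sum>e\<in>E. (if e = x then 1 else 0) * e) = x"
    using assms(2) by (simp add: if_distrib[of "\<lambda>u. u * _"] cong: if_cong)
  then show "x \<in> lincomb C E"
    unfolding lincomb_def using subring_onD(1,2)[OF assms(1)]
    by (intro CollectI exI[of _ "\<lambda>e. if e = x then 1 else 0"]) auto
qed

lemma lincomb_least:
  assumes "ideal_on C I" "E \<subseteq> I"
  shows "lincomb C E \<subseteq> I"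
  unfolding lincomb_def using assms by (auto intro!: ideal_onD(5)[OF assms(1)] ideal_onD(4)[OF assms(1)])

section \<open>Finite generation of ideals and Hilbert's basis theorem\<close>

definition noetherian_on :: "'a::comm_ring_1 set \<Rightarrow> bool" where
  "noetherian_on C \<longleftrightarrow> subring_on C \<and> (\<forall>I. ideal_on C I \<longrightarrow> (\<exists>E. finite E \<and> E \<subseteq> I \<and> I \<subseteq> lincomb C E))"

lemma noetherian_ring_on:
  assumes "noetherian_on C"
  shows "noetherian_ring (ring_on C)"
proof -
  have C: "subring_on C" using assms by (simp add: noetherian_on_def)
  interpret cring "ring_on C" by (rule cring_ring_on[OF C])
  show ?thesis
  proof (rule noetherian_ringI)
    fix I assume I: "ideal I (ring_on C)"
    then have I': "ideal_on C I" using ideal_ring_on_iff[OF C] by simp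
    then obtain E where E: "finite E" "E \<subseteq> I" "I \<subseteq> lincomb C E"
      using assms unfolding noetherian_on_def by blast
    have EC: "E \<subseteq> carrier (ring_on C)" using E(2) ideal_onD(1)[OF I'] by auto
    have G: "ideal_on C (Idl\<^bsub>ring_on C\<^esub> E)"
      using genideal_ideal[OF EC] ideal_ring_on_iff[OF C] by simp
    have "I \<subseteq> Idl\<^bsub>ring_on C\<^esub> E"
      using E(3) lincomb_least[OF G genideal_self[OF EC]] by auto
    moreover have "Idl\<^bsub>ring_on C\<^esub> E \<subseteq> I" by (rule genideal_minimal[OF I E(2)])
    ultimately show "\<exists>A\<subseteq>carrier (ring_on C). finite A \<and> I = Idl\<^bsub>ring_on C\<^esub> A"
      using E(1) EC by blast
  qed
qed

text \<open>Values at \<open>x\<close> of polynomials over \<open>C\<close> of degree below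
  \<open>d\<close>. As \<open>x\<close> may be algebraic over \<open>C\<close>, such an expression
  is not unique; a bound on the degree makes sense where a degree does not.\<close>

primrec poly_below :: "'a::comm_ring_1 set \<Rightarrow> 'a \<Rightarrow> nat \<Rightarrow> 'a set" where
  "poly_below C x 0 = {0}"
| "poly_below C x (Suc d) = {a * x ^ d + l | a l. a \<in> C \<and> l \<in> poly_below C x d}"

definition adjoin :: "'a::comm_ring_1 set \<Rightarrow> 'a \<Rightarrow> 'a set" where
  "adjoin C x = (\<Union>d. poly_below C x d)"

lemma poly_below_SucI: "a \<in> C \<Longrightarrow> l \<in> poly_below C x d \<Longrightarrow> a * x ^ d + l \<in> poly_below C x (Suc d)"
  by auto

lemma poly_below_SucE:
  assumes "p \<in> poly_below C x (Suc d)"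
  obtains a l where "a \<in> C" "l \<in> poly_below C x d" "p = a * x ^ d + l"
  using assms by auto

declare poly_below.simps(2) [simp del]

context
  fixes C :: "'a::comm_ring_1 set" and x :: 'a
  assumes C: "subring_on C"
begin

lemma poly_below_zero: "0 \<in> poly_below C x d"
proof (induction d)
  case (Suc d)
  then show ?case using poly_below_SucI[OF subring_onD(1)[OF C]] by fastforce
qed simp

lemma poly_below_add: "p \<in> poly_below C x d \<Longrightarrow> q \<in> poly_below C x d \<Longrightarrow> p + q \<in> poly_below C x d"
proof (induction d arbitrary: p q)
  case (Suc d)
  obtain a l where p: "a \<in> C" "l \<in> poly_below C x d" "p = a * x ^ d + l"
    using Suc.prems(1) by (elim poly_below_SucE)
  obtain b m where q: "b \<in> C" "m \<in> poly_below C x d" "q = b * x ^ d + m"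
    using Suc.prems(2) by (elim poly_below_SucE)
  have "p + q = (a + b) * x ^ d + (l + m)" using p q by (simp add: algebra_simps)
  then show ?case
    using poly_below_SucI[OF subring_onD(4)[OF C p(1) q(1)] Suc.IH[OF p(2) q(2)]] by simp
qed auto

lemma poly_below_scale: "c \<in> C \<Longrightarrow> p \<in> poly_below C x d \<Longrightarrow> c * p \<in> poly_below C x d"
proof (induction d arbitrary: p)
  case (Suc d)
  then obtain a l where "a \<in> C" "l \<in> poly_below C x d" "p = a * x ^ d + l" by (auto elim!: poly_below_SucE)
  moreover from this have "c * p = (c * a) * x ^ d + c * l" by (simp add: algebra_simps)
  ultimately show ?case using poly_below_SucI[OF subring_onD(5)[OF C] Suc.IH] Suc.prems by simp
qed auto

lemma poly_below_Suc: "p \<in> poly_below C x d \<Longrightarrow> p \<in> poly_below C x (Suc d)"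
  using poly_below_SucI[OF subring_onD(1)[OF C]] by fastforce

lemma poly_below_mono: "d \<le> e \<Longrightarrow> p \<in> poly_below C x d \<Longrightarrow> p \<in> poly_below C x e"
  by (induction e rule: dec_induct) (use poly_below_Suc in auto)

lemma poly_below_shift: "p \<in> poly_below C x d \<Longrightarrow> x * p \<in> poly_below C x (Suc d)"
proof (induction d arbitrary: p)
  case 0
  then show ?case using poly_below_zero[of "Suc 0"] by simp
next
  case (Suc d)
  then obtain a l where a: "a \<in> C" "l \<in> poly_below C x d" "p = a * x ^ d + l" by (auto elim!: poly_below_SucE)
  then have "x * p = a * x ^ Suc d + x * l" by (simp add: algebra_simps)
  then show ?case using poly_below_SucI[OF a(1) Suc.IH[OF a(2)]] by simp
qed

lemma poly_below_shift_power: "p \<in> poly_below C x d \<Longrightarrow> x ^ k * p \<in> poly_below C x (d + k)"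
proof (induction k)
  case (Suc k)
  then show ?case using poly_below_shift[of "x ^ k * p" "d + k"] by (simp add: mult.assoc)
qed simp

lemma poly_below_mult: "p \<in> poly_below C x d \<Longrightarrow> q \<in> poly_below C x e \<Longrightarrow> p * q \<in> poly_below C x (d + e)"
proof (induction d arbitrary: p)
  case 0
  then show ?case using poly_below_zero by simp
next
  case (Suc d)
  then obtain a l where a: "a \<in> C" "l \<in> poly_below C x d" "p = a * x ^ d + l" by (auto elim!: poly_below_SucE)
  have "l * q \<in> poly_below C x (Suc d + e)"
    using poly_below_Suc[OF Suc.IH[OF a(2) Suc.prems(2)]] by simp
  moreover have "a * (x ^ d * q) \<in> poly_below C x (Suc d + e)"
    using poly_below_mono[OF _ poly_below_scale[OF a(1) poly_below_shift_power[OF Suc.prems(2), of d]], of "Suc d + e"]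
    by simp
  ultimately have "a * (x ^ d * q) + l * q \<in> poly_below C x (Suc d + e)" using poly_below_add by blast
  then show ?case using a(3) by (simp add: algebra_simps)
qed

lemma poly_below_diff: "p \<in> poly_below C x d \<Longrightarrow> q \<in> poly_below C x d \<Longrightarrow> p - q \<in> poly_below C x d"
  using poly_below_add[of p d "- 1 * q"] poly_below_scale[of "- 1" q d] subring_onD(2,3)[OF C] by simp

lemma poly_below_sum: "(\<And>i. i \<in> A \<Longrightarrow> f i \<in> poly_below C x d) \<Longrightarrow> sum f A \<in> poly_below C x d"
  by (induction A rule: infinite_finite_induct) (auto intro: poly_below_zero poly_below_add)

lemma adjoin_base: "C \<subseteq> adjoin C x"
proof
  fix a assume "a \<in> C"
  then have "a \<in> poly_below C x (Suc 0)" using poly_below_SucI[of a C 0 x 0] by simp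
  then show "a \<in> adjoin C x" unfolding adjoin_def by blast
qed

lemma adjoin_self: "x \<in> adjoin C x"
proof -
  have "1 \<in> poly_below C x (Suc 0)" using poly_below_SucI[OF subring_onD(2)[OF C], of 0 x 0] by simp
  from poly_below_shift[OF this] show ?thesis unfolding adjoin_def by auto
qed

lemma subring_adjoin: "subring_on (adjoin C x)"
  unfolding subring_on_def
proof (intro conjI ballI)
  show "0 \<in> adjoin C x" "1 \<in> adjoin C x" using adjoin_base subring_onD(1,2)[OF C] by auto
  fix p assume p: "p \<in> adjoin C x"
  then obtain d where d: "p \<in> poly_below C x d" unfolding adjoin_def by auto
  show "- p \<in> adjoin C x" using poly_below_diff[OF poly_below_zero d] unfolding adjoin_def by auto
  fix q assume "q \<in> adjoin C x"
  then obtain e where e: "q \<in> poly_below C x e" unfolding adjoin_def by auto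
  show "p + q \<in> adjoin C x"
    using poly_below_add[OF poly_below_mono[OF _ d, of "d + e"] poly_below_mono[OF _ e, of "d + e"]]
    unfolding adjoin_def by auto
  show "p * q \<in> adjoin C x" using poly_below_mult[OF d e] unfolding adjoin_def by auto
qed

end

lemma adjoin_least:
  assumes "C \<subseteq> B" "x \<in> B" "subring_on B"
  shows "adjoin C x \<subseteq> B"
proof -
  have "poly_below C x d \<subseteq> B" for d
  proof (induction d)
    case 0
    then show ?case using subring_onD(1)[OF assms(3)] by simp
  next
    case (Suc d)
    show ?case
    proof
      fix p assume "p \<in> poly_below C x (Suc d)"
      then obtain a l where "a \<in> C" "l \<in> poly_below C x d" "p = a * x ^ d + l" by (elim poly_below_SucE)
      moreover from this have "a \<in> B" "l \<in> B" using Suc assms by auto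
      ultimately show "p \<in> B"
        using subring_onD(4)[OF assms(3) subring_onD(5)[OF assms(3) _ subring_onD(7)[OF assms(3,2)]]] by simp
    qed
  qed
  then show ?thesis unfolding adjoin_def by auto
qed

text \<open>Hilbert's basis theorem with degree bounds in the role of degrees: an element of
  \<open>I\<close> is reduced by generators that realize its coefficient at \<open>x ^ d\<close>,
  and the induction runs on the bound.\<close>

theorem noetherian_adjoin:
  assumes "noetherian_on C"
  shows "noetherian_on (adjoin C x)"
proof -
  have C: "subring_on C" using assms by (simp add: noetherian_on_def)
  note A = subring_adjoin[OF C, of x]
  have "\<exists>E. finite E \<and> E \<subseteq> I \<and> I \<subseteq> lincomb (adjoin C x) E" if I: "ideal_on (adjoin C x) I" for I
  proof -
    note I_add = ideal_onD(3)[OF I] and I_mult = ideal_onD(4)[OF I]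
    have C_I: "c * p \<in> I" if "c \<in> C" "p \<in> I" for c p
      using I_mult that adjoin_base[OF C] by blast
    have x_I: "x ^ k * p \<in> I" if "p \<in> I" for p k
      using I_mult that subring_onD(7)[OF A adjoin_self[OF C]] by blast
    \<comment> \<open>The possible coefficients of \<open>x ^ d\<close> in elements of
      \<open>I\<close> written with degree at most \<open>d\<close>. They form an ideal of
      \<open>C\<close>, which grows with \<open>d\<close> because \<open>I\<close> is closed under
      multiplication by \<open>x\<close>.\<close>
    define L where "L d = {a \<in> C. \<exists>l\<in>poly_below C x d. a * x ^ d + l \<in> I}" for d
    have L_ideal: "ideal_on C (L d)" for d
      unfolding ideal_on_def
    proof (intro conjI ballI)
      show "0 \<in> L d" unfolding L_def using subring_onD(1)[OF C] poly_below_zero[OF C, of x d] ideal_onD(2)[OF I] by force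
      fix a b assume "a \<in> L d" "b \<in> L d"
      then obtain l m where "a \<in> C" "l \<in> poly_below C x d" "a * x ^ d + l \<in> I"
        "b \<in> C" "m \<in> poly_below C x d" "b * x ^ d + m \<in> I" unfolding L_def by auto
      then have "a + b \<in> C" "l + m \<in> poly_below C x d" "(a * x ^ d + l) + (b * x ^ d + m) \<in> I"
        using subring_onD(4)[OF C] poly_below_add[OF C] I_add by blast+
      moreover have "(a * x ^ d + l) + (b * x ^ d + m) = (a + b) * x ^ d + (l + m)" by (simp add: algebra_simps)
      ultimately show "a + b \<in> L d" unfolding L_def by auto
    next
      fix c a assume c: "c \<in> C" "a \<in> L d"
      then obtain l where "a \<in> C" "l \<in> poly_below C x d" "a * x ^ d + l \<in> I" unfolding L_def by auto
      then have "c * a \<in> C" "c * l \<in> poly_below C x d" "c * (a * x ^ d + l) \<in> I"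
        using subring_onD(5)[OF C] poly_below_scale[OF C] C_I c by blast+
      moreover have "c * (a * x ^ d + l) = c * a * x ^ d + c * l" by (simp add: algebra_simps)
      ultimately show "c * a \<in> L d" unfolding L_def by auto
    qed (auto simp: L_def)
    have L_Suc: "L d \<subseteq> L (Suc d)" for d
    proof
      fix a assume "a \<in> L d"
      then obtain l where l: "a \<in> C" "l \<in> poly_below C x d" "a * x ^ d + l \<in> I" unfolding L_def by auto
      have "x * l \<in> poly_below C x (Suc d)" by (rule poly_below_shift[OF C l(2)])
      moreover have "a * x ^ Suc d + x * l \<in> I" using x_I[OF l(3), of 1] by (simp add: algebra_simps)
      ultimately show "a \<in> L (Suc d)" unfolding L_def using l(1) by blast
    qed
    have L_mono: "L d \<subseteq> L e" if "d \<le> e" for d e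
      using that L_Suc by (rule lift_Suc_mono_le[rotated])
    have "ideal_on C (\<Union>d. L d)"
      unfolding ideal_on_def
    proof (intro conjI ballI)
      fix a b assume "a \<in> (\<Union>d. L d)" "b \<in> (\<Union>d. L d)"
      then obtain d e where "a \<in> L d" "b \<in> L e" by auto
      then have "a \<in> L (d + e)" "b \<in> L (d + e)" using L_mono[of d "d + e"] L_mono[of e "d + e"] by auto
      then show "a + b \<in> (\<Union>d. L d)" using ideal_onD(3)[OF L_ideal] by blast
    next
      fix r a assume "r \<in> C" "a \<in> (\<Union>d. L d)"
      then show "r * a \<in> (\<Union>d. L d)" using ideal_onD(4)[OF L_ideal] by blast
    next
      show "0 \<in> (\<Union>d. L d)" using ideal_onD(2)[OF L_ideal] by blast
    qed (auto simp: L_def)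
    then obtain E where E: "finite E" "E \<subseteq> (\<Union>d. L d)" "(\<Union>d. L d) \<subseteq> lincomb C E"
      using assms unfolding noetherian_on_def by blast
    \<comment> \<open>The chain is stationary from the level at which the finitely many generators
      of its union have appeared.\<close>
    have "\<exists>N. E \<subseteq> L N"
      using E(1,2)
    proof (induction E rule: finite_induct)
      case (insert e E)
      then obtain N M where "E \<subseteq> L N" "e \<in> L M" by auto
      then have "insert e E \<subseteq> L (N + M)" using L_mono[of N "N + M"] L_mono[of M "N + M"] by auto
      then show ?case ..
    qed auto
    then obtain N where N: "E \<subseteq> L N" ..
    have L_N: "L d \<subseteq> L N" for d using E(3) lincomb_least[OF L_ideal N] by blast
    have "\<exists>G. finite G \<and> G \<subseteq> L d \<and> L d \<subseteq> lincomb C G" for d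
      using assms L_ideal unfolding noetherian_on_def by blast
    then obtain G where G: "\<And>d. finite (G d)" "\<And>d. G d \<subseteq> L d" "\<And>d. L d \<subseteq> lincomb C (G d)" by metis
    have "\<exists>l. \<forall>e\<in>G d. l e \<in> poly_below C x d \<and> e * x ^ d + l e \<in> I" for d
      using G(2)[of d] unfolding L_def by (intro bchoice) auto
    then obtain l where l: "\<And>d e. e \<in> G d \<Longrightarrow> l d e \<in> poly_below C x d" "\<And>d e. e \<in> G d \<Longrightarrow> e * x ^ d + l d e \<in> I"
      by metis
    define H where "H = (\<Union>d\<in>{..N}. (\<lambda>e. e * x ^ d + l d e) ` G d)"
    have H: "finite H" "H \<subseteq> I" unfolding H_def using G(1) l(2) by auto
    note K = lincomb_ideal[OF A order.trans[OF H(2) ideal_onD(1)[OF I]]]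
    have "p \<in> poly_below C x d \<Longrightarrow> p \<in> I \<Longrightarrow> p \<in> lincomb (adjoin C x) H" for p d
    proof (induction d arbitrary: p)
      case 0
      then show ?case using ideal_onD(2)[OF K] by simp
    next
      case (Suc d)
      then obtain a m where am: "a \<in> C" "m \<in> poly_below C x d" "p = a * x ^ d + m" by (auto elim!: poly_below_SucE)
      have "a \<in> L d" unfolding L_def using am Suc.prems by auto
      \<comment> \<open>Beyond \<open>N\<close> no new coefficients occur, so generators of level
        \<open>N\<close>, shifted by a power of \<open>x\<close>, serve there.\<close>
      define d' where "d' = min d N"
      have d': "d' \<le> N" "d' \<le> d" unfolding d'_def by auto
      have "a \<in> L d'" using \<open>a \<in> L d\<close> L_N[of d] unfolding d'_def by (auto simp: min_def)
      then obtain r where r: "\<forall>e\<in>G d'. r e \<in> C" "a = (\<Sum>e\<in>G d'. r e * e)"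
        using G(3)[of d'] unfolding lincomb_def by auto
      \<comment> \<open>A combination of the generators with the same coefficient \<open>a\<close>
        at \<open>x ^ d\<close> as \<open>p\<close>, so that the difference satisfies the bound
        \<open>d\<close>.\<close>
      define q where "q = (\<Sum>e\<in>G d'. r e * (x ^ (d - d') * (e * x ^ d' + l d' e)))"
      have qK: "q \<in> lincomb (adjoin C x) H"
        unfolding q_def
      proof (rule ideal_onD(5)[OF K])
        fix e assume e: "e \<in> G d'"
        then have "e * x ^ d' + l d' e \<in> lincomb (adjoin C x) H"
          using lincomb_base[OF A H(1)] d' unfolding H_def by blast
        then show "r e * (x ^ (d - d') * (e * x ^ d' + l d' e)) \<in> lincomb (adjoin C x) H"
          using r e adjoin_base[OF C] subring_onD(7)[OF A adjoin_self[OF C]] by (intro ideal_onD(4)[OF K]) auto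
      qed
      then have qI: "q \<in> I" using lincomb_least[OF I H(2)] by auto
      have "q = (\<Sum>e\<in>G d'. r e * e * x ^ d + r e * (x ^ (d - d') * l d' e))"
        unfolding q_def
      proof (rule sum.cong)
        fix e assume "e \<in> G d'"
        have "x ^ (d - d') * x ^ d' = x ^ d" using d' by (simp add: power_add[symmetric])
        then have "r e * (x ^ (d - d') * (e * x ^ d')) = r e * e * x ^ d"
          by (metis mult.assoc mult.left_commute)
        then show "r e * (x ^ (d - d') * (e * x ^ d' + l d' e)) = r e * e * x ^ d + r e * (x ^ (d - d') * l d' e)"
          by (simp add: distrib_left)
      qed simp
      also have "\<dots> = a * x ^ d + (\<Sum>e\<in>G d'. r e * (x ^ (d - d') * l d' e))"
        by (simp add: sum.distrib r(2) sum_distrib_right)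
      finally have "p - q = m - (\<Sum>e\<in>G d'. r e * (x ^ (d - d') * l d' e))" using am(3) by simp
      moreover have "(\<Sum>e\<in>G d'. r e * (x ^ (d - d') * l d' e)) \<in> poly_below C x d"
      proof (rule poly_below_sum[OF C])
        fix e assume e: "e \<in> G d'"
        have "x ^ (d - d') * l d' e \<in> poly_below C x (d' + (d - d'))"
          by (rule poly_below_shift_power[OF C l(1)[OF e]])
        then show "r e * (x ^ (d - d') * l d' e) \<in> poly_below C x d"
          using d' e r(1) by (intro poly_below_scale[OF C, of "r e"]) auto
      qed
      ultimately have "p - q \<in> poly_below C x d" using poly_below_diff[OF C am(2)] by simp
      moreover have "p - q \<in> I" by (rule ideal_on_diff[OF A I Suc.prems(2) qI])
      ultimately have "p - q + q \<in> lincomb (adjoin C x) H" using Suc.IH qK ideal_onD(3)[OF K] by blast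
      then show ?case by simp
    qed
    then have "I \<subseteq> lincomb (adjoin C x) H" using ideal_onD(1)[OF I] unfolding adjoin_def by blast
    then show ?thesis using H by blast
  qed
  then show ?thesis using A unfolding noetherian_on_def by blast
qed

lemma field_noetherian_on:
  assumes "subring_on C" "\<And>c. c \<in> C \<Longrightarrow> c \<noteq> 0 \<Longrightarrow> \<exists>d\<in>C. d * c = 1"
  shows "noetherian_on C"
  unfolding noetherian_on_def
proof (intro conjI allI impI)
  fix I assume I: "ideal_on C I"
  show "\<exists>E. finite E \<and> E \<subseteq> I \<and> I \<subseteq> lincomb C E"
  proof (cases "I = {0}")
    case True
    then show ?thesis by (intro exI[of _ "{0}"]) (auto simp: lincomb_def intro: exI[of _ "\<lambda>_. 0"] subring_onD(1)[OF assms(1)])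
  next
    case False
    then obtain c where c: "c \<in> I" "c \<noteq> 0" using ideal_onD(2)[OF I] by auto
    then obtain d where "d \<in> C" "d * c = 1" using assms(2) ideal_onD(1)[OF I] by blast
    then have "1 \<in> I" using ideal_onD(4)[OF I] c by metis
    moreover have "I \<subseteq> lincomb C {1}" using ideal_onD(1)[OF I] unfolding lincomb_def by auto
    ultimately show ?thesis by (intro exI[of _ "{1}"]) auto
  qed
qed (rule assms)

primrec adjoin_list :: "'a::comm_ring_1 set \<Rightarrow> 'a list \<Rightarrow> 'a set" where
  "adjoin_list C [] = C"
| "adjoin_list C (x # xs) = adjoin (adjoin_list C xs) x"

lemma noetherian_adjoin_list: "noetherian_on C \<Longrightarrow> noetherian_on (adjoin_list C xs)"
  by (induction xs) (auto intro: noetherian_adjoin)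

lemma adjoin_list_props:
  assumes "subring_on C"
  shows "subring_on (adjoin_list C xs)" "C \<subseteq> adjoin_list C xs" "set xs \<subseteq> adjoin_list C xs"
proof (induction xs)
  case (Cons x xs)
  case 1 show ?case using Cons(1) subring_adjoin by auto
  case 2 show ?case using Cons adjoin_base by fastforce
  case 3 show ?case using Cons adjoin_base adjoin_self by fastforce
qed (use assms in auto)

lemma adjoin_list_least:
  assumes "C \<subseteq> B" "set xs \<subseteq> B" "subring_on B"
  shows "adjoin_list C xs \<subseteq> B"
  using assms(2)
proof (induction xs)
  case (Cons x xs)
  then have "adjoin_list C xs \<subseteq> B" "x \<in> B" by auto
  then show ?case using adjoin_least[OF _ _ assms(3)] by simp
qed (use assms in simp)

text \<open>An ideal of \<open>B\<close> is generated by the images of generators of its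
  preimage.\<close>

lemma noetherian_on_image:
  assumes C: "noetherian_on C" and B: "subring_on B" and h: "h ` C = B"
    and hom: "h 0 = 0" "\<And>x y. x \<in> C \<Longrightarrow> y \<in> C \<Longrightarrow> h (x + y) = h x + h y"
      "\<And>x y. x \<in> C \<Longrightarrow> y \<in> C \<Longrightarrow> h (x * y) = h x * h y"
  shows "noetherian_on B"
  unfolding noetherian_on_def
proof (intro conjI allI impI)
  have Cs: "subring_on C" using C by (simp add: noetherian_on_def)
  fix I assume I: "ideal_on B I"
  define J where "J = {x \<in> C. h x \<in> I}"
  have hB: "h x \<in> B" if "x \<in> C" for x using h that by auto
  have "ideal_on C J"
    unfolding ideal_on_def J_def using hom ideal_onD[OF I] subring_onD[OF Cs] hB by auto
  then obtain E where E: "finite E" "E \<subseteq> J" "J \<subseteq> lincomb C E" using C unfolding noetherian_on_def by blast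
  have hE: "finite (h ` E)" "h ` E \<subseteq> I" "h ` E \<subseteq> B" using E ideal_onD(1)[OF I] unfolding J_def by auto
  note K = lincomb_ideal[OF B hE(3)]
  define J' where "J' = {x \<in> C. h x \<in> lincomb B (h ` E)}"
  have J': "ideal_on C J'"
    unfolding ideal_on_def J'_def using hom ideal_onD[OF K] subring_onD[OF Cs] hB by auto
  have "E \<subseteq> J'" using E lincomb_base[OF B hE(1)] unfolding J_def J'_def by auto
  then have "J \<subseteq> J'" using lincomb_least[OF J'] E(3) by blast
  then have "I \<subseteq> lincomb B (h ` E)" using ideal_onD(1)[OF I] h unfolding J_def J'_def by blast
  then show "\<exists>E. finite E \<and> E \<subseteq> I \<and> I \<subseteq> lincomb B E" using hE by blast
qed (rule B)

section \<open>Rees algebras for weight vectors\<close>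

abbreviation lookup where "lookup \<equiv> Poly_Mapping.lookup"
abbreviation keys where "keys \<equiv> Poly_Mapping.keys"
abbreviation single where "single \<equiv> Poly_Mapping.single"

lemma lookup_sum_single:
  fixes f :: "'a \<Rightarrow> 'b::comm_monoid_add"
  assumes "finite A"
  shows "lookup (\<Sum>a\<in>A. single a (f a)) x = (if x \<in> A then f x else 0)"
  using assms by (simp add: lookup_sum lookup_single when_def)

lemma sum_single_lookup:
  fixes f :: "'a \<Rightarrow>\<^sub>0 'b::comm_monoid_add"
  shows "(\<Sum>a\<in>keys f. single a (lookup f a)) = f"
  by (rule poly_mapping_eqI) (simp add: lookup_sum_single in_keys_iff)

lemma poly_mapping_induct_single [consumes 1, case_names zero single add]:
  fixes f :: "'a \<Rightarrow>\<^sub>0 'b::comm_monoid_add"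
  assumes "keys f \<subseteq> A" "P 0" "\<And>a c. a \<in> A \<Longrightarrow> P (single a c)" "\<And>f g. P f \<Longrightarrow> P g \<Longrightarrow> P (f + g)"
  shows "P f"
proof -
  have "P (\<Sum>a\<in>B. single a (lookup f a))" if "finite B" "B \<subseteq> A" for B
    using that by (induction B rule: finite_induct) (use assms in auto)
  from this[of "keys f"] show ?thesis using assms(1) by (simp add: sum_single_lookup)
qed

text \<open>For exponents in a group the partner of \<open>e\<close> in degree \<open>d\<close> is
  \<open>d - e\<close>, which makes products in the grading by \<open>T\<close> explicit.\<close>

lemma lookup_mult_group:
  fixes F G :: "'g::ab_group_add \<Rightarrow>\<^sub>0 'r::comm_ring_1"
  shows "lookup (F * G) d = (\<Sum>e\<in>keys F. lookup F e * lookup G (d - e))"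
proof -
  have "(\<Sum>q. lookup G q when d = l + q) = lookup G (d - l)" for l
  proof -
    have "(\<Sum>q. lookup G q when d = l + q) = (\<Sum>q. lookup G q when q = d - l)"
      by (rule Sum_any.cong) (auto intro!: when_cong simp: algebra_simps)
    then show ?thesis by simp
  qed
  then have "lookup (F * G) d = (\<Sum>l. lookup F l * lookup G (d - l))"
    by (simp add: lookup_mult)
  also have "\<dots> = (\<Sum>e\<in>keys F. lookup F e * lookup G (d - e))"
    by (rule Sum_any.expand_superset) (auto simp: in_keys_iff)
  finally show ?thesis .
qed

lemma lookup_single_mult_group:
  fixes F :: "'g::ab_group_add \<Rightarrow>\<^sub>0 'r::comm_ring_1"
  shows "lookup (single e c * F) d = c * lookup F (d - e)"
  by (cases "c = 0") (simp_all add: lookup_mult_group)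

text \<open>Exponent vectors form only a cancellative monoid, in which subtraction truncates; so the
  coefficient is read off at a sum.\<close>

lemma lookup_single_mult_add:
  fixes f :: "(nat \<Rightarrow>\<^sub>0 nat) \<Rightarrow>\<^sub>0 'k::field"
  shows "lookup (single a c * f) (a + b) = c * lookup f b"
proof -
  have "lookup (single a c * f) (a + b) = (\<Sum>l. lookup (single a c) l * (\<Sum>q. lookup f q when a + b = l + q))"
    by (simp add: lookup_mult)
  also have "\<dots> = (\<Sum>l\<in>{a}. lookup (single a c) l * (\<Sum>q. lookup f q when a + b = l + q))"
    by (rule Sum_any.expand_superset) (auto simp: lookup_single when_def split: if_splits)
  also have "\<dots> = c * lookup f b" by simp
  finally show ?thesis .
qed

lemma keys_single_mult:
  fixes f :: "(nat \<Rightarrow>\<^sub>0 nat) \<Rightarrow>\<^sub>0 'k::field"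
  assumes "c \<noteq> 0"
  shows "keys (single a c * f) = (+) a ` keys f"
proof
  show "keys (single a c * f) \<subseteq> (+) a ` keys f"
    using keys_mult[of "single a c" f] by (auto split: if_splits)
  show "(+) a ` keys f \<subseteq> keys (single a c * f)"
    using assms by (auto simp: in_keys_iff lookup_single_mult_add)
qed

definition restr :: "'a set \<Rightarrow> ('a \<Rightarrow>\<^sub>0 'k::comm_monoid_add) \<Rightarrow> 'a \<Rightarrow>\<^sub>0 'k" where
  "restr A f = (\<Sum>a\<in>keys f \<inter> A. single a (lookup f a))"

lemma lookup_restr: "lookup (restr A f) a = (if a \<in> A then lookup f a else 0)"
  unfolding restr_def by (simp add: lookup_sum_single in_keys_iff)

lemma keys_restr: "keys (restr A f) = keys f \<inter> A"
  by (auto simp: in_keys_iff lookup_restr split: if_splits)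

lemma exponents_zero: "0 \<in> exponents n"
  by (simp add: exponents_def)

lemma exponents_add: "a \<in> exponents n \<Longrightarrow> b \<in> exponents n \<Longrightarrow> a + b \<in> exponents n"
  unfolding exponents_def using keys_add[of a b] by auto

definition polys :: "nat \<Rightarrow> ((nat \<Rightarrow>\<^sub>0 nat) \<Rightarrow>\<^sub>0 'k::field) set" where
  "polys n = {p. keys p \<subseteq> exponents n}"

lemma polynomial_ring_eq: "polynomial_ring n = ring_on (polys n)"
  by (simp add: polynomial_ring_def ring_on_def polys_def)

lemma subring_polys: "subring_on (polys n :: ((nat \<Rightarrow>\<^sub>0 nat) \<Rightarrow>\<^sub>0 'k::field) set)"
  unfolding subring_on_def polys_def
proof (intro conjI ballI CollectI)
  fix x y :: "(nat \<Rightarrow>\<^sub>0 nat) \<Rightarrow>\<^sub>0 'k" assume "x \<in> {p. keys p \<subseteq> exponents n}" "y \<in> {p. keys p \<subseteq> exponents n}"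
  then show "keys (x + y) \<subseteq> exponents n" "keys (x * y) \<subseteq> exponents n"
    using keys_add[of x y] keys_mult[of x y] exponents_add by blast+
qed (auto simp: exponents_zero)

lemma single_polys: "a \<in> exponents n \<Longrightarrow> single a c \<in> polys n"
  by (simp add: polys_def)

definition wdeg :: "nat \<Rightarrow> (nat \<Rightarrow> int) \<Rightarrow> (nat \<Rightarrow>\<^sub>0 nat) \<Rightarrow> int" where
  "wdeg n w a = (\<Sum>i<n. w i * int (lookup a i))"

lemma wdeg_add: "wdeg n w (a + b) = wdeg n w a + wdeg n w b"
  by (simp add: wdeg_def lookup_add algebra_simps sum.distrib)

lemma wdeg_zero [simp]: "wdeg n w 0 = 0"
  by (simp add: wdeg_def)

type_synonym 'k graded = "int \<Rightarrow>\<^sub>0 ((nat \<Rightarrow>\<^sub>0 nat) \<Rightarrow>\<^sub>0 'k)"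

text \<open>The coefficient of \<open>T\<^sup>d\<close> has weighted degree at most \<open>d\<close>, so that \<open>rees n w\<close> is the polynomial
  ring in \<open>T\<close> and the \<open>x\<^sub>i T\<^sup>w\<^sup>i\<close>: this is how the homogenization of a polynomial is encoded.\<close>

definition rees :: "nat \<Rightarrow> (nat \<Rightarrow> int) \<Rightarrow> 'k::field graded set" where
  "rees n w = {F. \<forall>d. \<forall>a\<in>keys (lookup F d). a \<in> exponents n \<and> wdeg n w a \<le> d}"

text \<open>This is \<open>k[X][T, 1/T]\<close>, which contains the Rees algebras of all weights and
  in which \<open>T\<close> is a unit.\<close>

definition laurent :: "nat \<Rightarrow> 'k::field graded set" where
  "laurent n = {F. \<forall>d. lookup F d \<in> polys n}"

lemma reesD: "F \<in> rees n w \<Longrightarrow> a \<in> keys (lookup F d) \<Longrightarrow> a \<in> exponents n \<and> wdeg n w a \<le> d"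
  by (auto simp: rees_def)

lemma rees_laurent: "rees n w \<subseteq> laurent n"
  by (auto simp: rees_def laurent_def polys_def)

lemma single_rees_iff:
  "single d f \<in> rees n w \<longleftrightarrow> (\<forall>a\<in>keys f. a \<in> exponents n \<and> wdeg n w a \<le> d)"
  by (auto simp: rees_def lookup_single when_def)

lemma subring_rees: "subring_on (rees n w :: 'k::field graded set)"
  unfolding subring_on_def
proof (intro conjI ballI)
  show "0 \<in> (rees n w :: 'k graded set)" by (simp add: rees_def)
  have "single 0 1 \<in> (rees n w :: 'k graded set)" unfolding single_rees_iff by (auto simp: exponents_zero)
  then show "1 \<in> (rees n w :: 'k graded set)" by simp
  fix F :: "'k graded" assume F: "F \<in> rees n w"
  show "- F \<in> rees n w" using F by (auto simp: rees_def)
  fix G :: "'k graded" assume G: "G \<in> rees n w"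
  have "a \<in> exponents n \<and> wdeg n w a \<le> d" if "a \<in> keys (lookup (F + G) d)" for d a
    using that keys_add[of "lookup F d" "lookup G d"] reesD[OF F] reesD[OF G] by (auto simp: lookup_add)
  then show "F + G \<in> rees n w" by (simp add: rees_def)
  have "a \<in> exponents n \<and> wdeg n w a \<le> d" if a: "a \<in> keys (lookup (F * G) d)" for d a
  proof -
    have "a \<in> (\<Union>e\<in>keys F. keys (lookup F e * lookup G (d - e)))"
      using a keys_sum[of "\<lambda>e. lookup F e * lookup G (d - e)" "keys F"] unfolding lookup_mult_group by blast
    then obtain e b c where "b \<in> keys (lookup F e)" "c \<in> keys (lookup G (d - e))" "a = b + c"
      using keys_mult by blast
    then show ?thesis using reesD[OF F, of b e] reesD[OF G, of c "d - e"] exponents_add by (auto simp: wdeg_add)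
  qed
  then show "F * G \<in> rees n w" by (simp add: rees_def)
qed

lemma subring_laurent: "subring_on (laurent n :: 'k::field graded set)"
  unfolding subring_on_def
proof (intro conjI ballI)
  note R = subring_onD[OF subring_polys[of n]]
  show "0 \<in> (laurent n :: 'k graded set)" "1 \<in> (laurent n :: 'k graded set)"
    using R(1,2) by (auto simp: laurent_def lookup_one when_def)
  fix F :: "'k graded" assume F: "F \<in> laurent n"
  show "- F \<in> laurent n" using F R(3) by (auto simp: laurent_def)
  fix G :: "'k graded" assume G: "G \<in> laurent n"
  show "F + G \<in> laurent n" using F G R(4) by (auto simp: laurent_def lookup_add)
  show "F * G \<in> laurent n" using F G R(5) by (auto simp: laurent_def lookup_mult_group intro!: R(8))
qed

lemma rees_induct [consumes 1, case_names zero monomial add]: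
  assumes "F \<in> rees n w" "P 0"
    "\<And>d a c. a \<in> exponents n \<Longrightarrow> wdeg n w a \<le> d \<Longrightarrow> P (single d (single a c))"
    "\<And>F G. P F \<Longrightarrow> P G \<Longrightarrow> P (F + G)"
  shows "P F"
proof -
  have single: "P (single d (lookup F d))" for d
  proof -
    have "keys (lookup F d) \<subseteq> {a \<in> exponents n. wdeg n w a \<le> d}" using reesD[OF assms(1)] by auto
    then show ?thesis
      by (rule poly_mapping_induct_single[where P = "\<lambda>f. P (single d f)"])
        (use assms in \<open>auto simp: single_add\<close>)
  qed
  have "P (\<Sum>d\<in>A. single d (lookup F d))" if "finite A" for A
    using that by (induction A rule: finite_induct) (use assms single in auto)
  then show ?thesis using sum_single_lookup[of F] by (metis finite_keys)
qed

section \<open>Generators and noetherianity of the Rees algebra\<close>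

definition rees_consts :: "'k::field graded set" where
  "rees_consts = range (\<lambda>c. single 0 (single 0 c))"

definition rees_gens :: "nat \<Rightarrow> (nat \<Rightarrow> int) \<Rightarrow> 'k::field graded list" where
  "rees_gens n w = single 1 1 # map (\<lambda>i. single (w i) (single (single i 1) 1)) [0..<n]"

lemma subring_rees_consts: "subring_on (rees_consts :: 'k::field graded set)"
  unfolding subring_on_def
proof (intro conjI ballI)
  have I: "single 0 (single 0 c) \<in> (rees_consts :: 'k graded set)" for c by (auto simp: rees_consts_def)
  show "0 \<in> (rees_consts :: 'k graded set)" "1 \<in> (rees_consts :: 'k graded set)" using I[of 0] I[of 1] by simp_all
  fix x y assume "x \<in> (rees_consts :: 'k graded set)" "y \<in> (rees_consts :: 'k graded set)"
  then obtain c d where xy: "x = single 0 (single 0 c)" "y = single 0 (single 0 d)" by (auto simp: rees_consts_def)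
  show "- x \<in> rees_consts" using I[of "- c"] unfolding xy by (simp add: single_uminus)
  show "x + y \<in> rees_consts" using I[of "c + d"] unfolding xy by (simp add: single_add)
  show "x * y \<in> rees_consts" using I[of "c * d"] unfolding xy by (simp add: mult_single)
qed

lemma single_power:
  fixes a :: "'a::comm_monoid_add" and c :: "'b::comm_semiring_1"
  shows "single a c ^ m = single (\<Sum>i<m. a) (c ^ m)"
  by (induction m) (simp_all add: mult_single add.commute)

lemma sum_const_int: "(\<Sum>i<m. (d::int)) = int m * d"
  by (simp add: of_nat_def)

lemma prod_single:
  "finite A \<Longrightarrow> (\<Prod>i\<in>A. single (d i) (single (a i) 1)) =
    (single (\<Sum>i\<in>A. d i) (single (\<Sum>i\<in>A. a i) 1) :: int \<Rightarrow>\<^sub>0 ((nat \<Rightarrow>\<^sub>0 nat) \<Rightarrow>\<^sub>0 'k::field))"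
  by (induction A rule: finite_induct) (simp_all add: mult_single)

lemma exponents_expand: "a \<in> exponents n \<Longrightarrow> (\<Sum>i<n. single i (lookup a i)) = a"
  by (rule poly_mapping_eqI) (auto simp: lookup_sum_single exponents_def in_keys_iff)

lemma sum_single_nat: "(\<Sum>j<m. single i (Suc 0)) = single i m"
  by (induction m) (simp_all add: single_add[symmetric])

lemma rees_generated: "rees n w = adjoin_list rees_consts (rees_gens n w)" (is "_ = ?A")
proof
  have c: "rees_consts \<subseteq> rees n w"
    by (auto simp: rees_consts_def single_rees_iff exponents_zero split: if_splits)
  have w: "wdeg n w (single i (Suc 0)) = w i" if "i < n" for i
    using that by (simp add: wdeg_def lookup_single when_def if_distrib[of "\<lambda>x. w _ * int x"] cong: if_cong)
  have g: "set (rees_gens n w) \<subseteq> rees n w"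
    by (auto simp: rees_gens_def single_rees_iff exponents_zero w) (auto simp: exponents_def)
  show "?A \<subseteq> rees n w" by (rule adjoin_list_least[OF c g subring_rees])
  note A = adjoin_list_props[OF subring_rees_consts, of "rees_gens n w"]
  note As = subring_onD[OF A(1)]
  show "rees n w \<subseteq> ?A"
  proof
    fix F :: "'a graded" assume "F \<in> rees n w"
    then show "F \<in> ?A"
    proof (induction F rule: rees_induct)
      case (monomial d a c)
      \<comment> \<open>The term with monomial \<open>a\<close> in degree \<open>d\<close> is the
        product of the powers of the generators for the variables, which has
        \<open>T\<close>-exponent \<open>wdeg n w a\<close>, and of the missing power of
        \<open>T\<close>. Membership in the Rees algebra says that this power is
        nonnegative.\<close>
      define m where "m = nat (d - wdeg n w a)"
      have y: "single (w i) (single (single i 1) 1) ^ k = (single (int k * w i) (single (single i k) 1) :: 'a graded)" for i k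
        by (simp add: single_power sum_const_int sum_single_nat del: sum_constant)
      have "(\<Prod>i<n. single (w i) (single (single i 1) 1) ^ lookup a i) = (single (wdeg n w a) (single a 1) :: 'a graded)"
        unfolding y using exponents_expand[OF monomial(1)]
        by (simp add: prod_single wdeg_def mult.commute)
      moreover have "single 1 1 ^ m = (single (int m) 1 :: 'a graded)"
        by (simp add: single_power sum_const_int)
      moreover have "int m + wdeg n w a = d" unfolding m_def using monomial by simp
      ultimately have "single 0 (single 0 c) * (single 1 1 ^ m * (\<Prod>i<n. single (w i) (single (single i 1) 1) ^ lookup a i))
          = (single d (single a c) :: 'a graded)"
        by (simp add: mult_single)
      moreover have "single 0 (single 0 c) * (single 1 1 ^ m * (\<Prod>i<n. single (w i) (single (single i 1) 1) ^ lookup a i)) \<in> ?A"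
        by (intro As(5) As(7) As(9)) (use A(2,3) in \<open>auto simp: rees_consts_def rees_gens_def\<close>)
      ultimately show ?case by simp
    qed (use As in auto)
  qed
qed

lemma noetherian_rees: "noetherian_on (rees n w :: 'k::field graded set)"
proof -
  have "noetherian_on (rees_consts :: 'k graded set)"
  proof (rule field_noetherian_on[OF subring_rees_consts])
    fix x :: "'k graded" assume "x \<in> rees_consts" "x \<noteq> 0"
    then obtain c where c: "x = single 0 (single 0 c)" by (auto simp: rees_consts_def)
    moreover have "c \<noteq> 0" using \<open>x \<noteq> 0\<close> c by auto
    ultimately have "single 0 (single 0 (inverse c)) * x = 1" by (simp add: mult_single)
    then show "\<exists>d\<in>rees_consts. d * x = 1" by (auto simp: rees_consts_def)
  qed
  then show ?thesis unfolding rees_generated by (rule noetherian_adjoin_list)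
qed

text \<open>Reduction modulo \<open>T\<close>, that is, restriction to the special fibre. In the
  coefficient of \<open>T ^ d\<close> a term of weighted degree below \<open>d\<close> is a multiple
  of \<open>T\<close> within the Rees algebra, and only the terms of degree exactly \<open>d\<close>
  survive. Distinct \<open>d\<close> contribute distinct monomials, so nothing cancels in the
  sum.\<close>

definition rho :: "nat \<Rightarrow> (nat \<Rightarrow> int) \<Rightarrow> 'k::field graded \<Rightarrow> (nat \<Rightarrow>\<^sub>0 nat) \<Rightarrow>\<^sub>0 'k" where
  "rho n w F = (\<Sum>d\<in>keys F. restr {a. wdeg n w a = d} (lookup F d))"

lemma lookup_rho: "lookup (rho n w F) a = lookup (lookup F (wdeg n w a)) a"
proof -
  have "lookup (rho n w F) a = (\<Sum>d\<in>keys F. if d = wdeg n w a then lookup (lookup F d) a else 0)"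
    unfolding rho_def lookup_sum by (rule sum.cong) (auto simp: lookup_restr)
  then show ?thesis by (simp add: in_keys_iff)
qed

lemma rho_zero [simp]: "rho n w 0 = 0" and rho_add: "rho n w (F + G) = rho n w F + rho n w G"
  by (rule poly_mapping_eqI, simp add: lookup_rho lookup_add)+

lemma rho_single: "rho n w (single d f) = restr {a. wdeg n w a = d} f"
  by (rule poly_mapping_eqI) (auto simp: lookup_rho lookup_restr lookup_single when_def)

lemma restr_single: "restr A (single a c) = (if a \<in> A then single a c else 0)"
  by (rule poly_mapping_eqI) (auto simp: lookup_restr lookup_single when_def)

lemma rho_one [simp]: "rho n w 1 = 1"
  by (rule poly_mapping_eqI) (auto simp: lookup_rho lookup_one when_def)

text \<open>Multiplicativity holds on the Rees algebra, not on all Laurent elements: given the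
  bounds \<open>wdeg \<le> d\<close>, the degrees of two terms add up to the exponent of their
  product only if both bounds are attained.\<close>

lemma rho_mult:
  assumes "F \<in> rees n w" "G \<in> rees n w"
  shows "rho n w (F * G) = rho n w F * rho n w G"
  using assms(1)
proof (induction F rule: rees_induct)
  case (monomial d a c)
  from assms(2) show ?case
  proof (induction G rule: rees_induct)
    case (monomial e b f)
    then show ?case using \<open>wdeg n w a \<le> d\<close> by (auto simp: mult_single rho_single restr_single wdeg_add)
  qed (simp_all add: rho_add distrib_left)
qed (simp_all add: rho_add distrib_right)

lemma rho_polys: "F \<in> rees n w \<Longrightarrow> rho n w F \<in> polys n"
  by (induction F rule: rees_induct)
    (auto simp: rho_add rho_single restr_single single_polys intro: subring_onD[OF subring_polys])

lemma rho_surj: "rho n w ` rees n w = (polys n :: ((nat \<Rightarrow>\<^sub>0 nat) \<Rightarrow>\<^sub>0 'k::field) set)" (is "?L = ?R")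
proof
  show "?R \<subseteq> ?L"
  proof
    fix f :: "(nat \<Rightarrow>\<^sub>0 nat) \<Rightarrow>\<^sub>0 'k" assume "f \<in> polys n"
    then have "keys f \<subseteq> exponents n" by (simp add: polys_def)
    then show "f \<in> rho n w ` rees n w"
    proof (rule poly_mapping_induct_single)
      show "0 \<in> rho n w ` rees n w" using subring_onD(1)[OF subring_rees] by (metis imageI rho_zero)
    next
      fix a and c :: 'k assume "a \<in> exponents n"
      then have "rho n w (single (wdeg n w a) (single a c)) = single a c"
        "single (wdeg n w a) (single a c) \<in> rees n w"
        by (simp_all add: rho_single restr_single single_rees_iff)
      then show "single a c \<in> rho n w ` rees n w" by (metis imageI)
    next
      fix g h :: "(nat \<Rightarrow>\<^sub>0 nat) \<Rightarrow>\<^sub>0 'k" assume "g \<in> rho n w ` rees n w" "h \<in> rho n w ` rees n w"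
      then obtain F G where FG: "F \<in> rees n w" "G \<in> rees n w" "g = rho n w F" "h = rho n w G" by auto
      then have "g + h = rho n w (F + G)" by (simp add: rho_add)
      then show "g + h \<in> rho n w ` rees n w" using subring_onD(4)[OF subring_rees FG(1,2)] by blast
    qed
  qed
qed (auto intro: rho_polys)

text \<open>\<open>k[X]\<close> is the special fibre of a Rees algebra, here for the zero weight,
  and inherits noetherianity from it.\<close>

lemma noetherian_polys: "noetherian_on (polys n :: ((nat \<Rightarrow>\<^sub>0 nat) \<Rightarrow>\<^sub>0 'k::field) set)"
  by (rule noetherian_on_image[OF noetherian_rees[of n "\<lambda>_. 0"] subring_polys rho_surj])
    (auto simp: rho_add rho_mult)

text \<open>If no term in the coefficient of \<open>T ^ d\<close> attains the degree
  \<open>d\<close>, then all have degree at most \<open>d - 1\<close>, so that division by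
  \<open>T\<close> does not leave the Rees algebra.\<close>

lemma rho_kernel:
  assumes "F \<in> rees n w" "rho n w F = 0"
  shows "\<exists>G\<in>rees n w. F = single 1 1 * G"
proof
  have "F = single 1 1 * (single (- 1) 1 * F)"
    by (simp add: mult.assoc[symmetric] mult_single)
  then show "F = single 1 1 * (single (- 1) 1 * F)" .
  have "a \<in> exponents n \<and> wdeg n w a \<le> d" if a: "a \<in> keys (lookup (single (- 1) 1 * F) d)" for a d
  proof -
    have k: "a \<in> keys (lookup F (d + 1))" using a by (simp add: lookup_single_mult_group)
    moreover have "wdeg n w a \<noteq> d + 1"
      using k lookup_rho[of n w F a] assms(2) by (auto simp: in_keys_iff)
    ultimately show ?thesis using reesD[OF assms(1) k] by auto
  qed
  then show "single (- 1) 1 * F \<in> rees n w" by (simp add: rees_def)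
qed

lemma T_rees: "single 1 1 \<in> rees n w" and rho_T: "rho n w (single 1 1) = 0"
proof -
  show "single 1 1 \<in> rees n w" unfolding single_rees_iff by (auto simp: exponents_zero)
  show "rho n w (single 1 1) = 0"
    by (rule poly_mapping_eqI) (auto simp: lookup_rho lookup_single lookup_one when_def)
qed

text \<open>Over \<open>laurent\<close> this is the extension of \<open>J\<close>, over
  \<open>rees\<close> the homogenization of \<open>J\<close>. The latter is the contraction of the
  former, hence \<open>T\<close> is a non-zerodivisor modulo it.\<close>

definition coeffs_in :: "'k::field graded set \<Rightarrow> ((nat \<Rightarrow>\<^sub>0 nat) \<Rightarrow>\<^sub>0 'k) set \<Rightarrow> 'k graded set" where
  "coeffs_in A J = {F \<in> A. \<forall>d. lookup F d \<in> J}"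

lemma ideal_coeffs_in_laurent:
  assumes "ideal_on (polys n) J"
  shows "ideal_on (laurent n) (coeffs_in (laurent n) J)"
  unfolding ideal_on_def coeffs_in_def
proof (intro conjI ballI)
  fix F G :: "'a graded" assume F: "F \<in> laurent n" and G: "G \<in> {F \<in> laurent n. \<forall>d. lookup F d \<in> J}"
  then show "F * G \<in> {F \<in> laurent n. \<forall>d. lookup F d \<in> J}"
    using subring_onD(5)[OF subring_laurent F]
    by (auto simp: lookup_mult_group laurent_def intro!: ideal_onD(5)[OF assms] ideal_onD(4)[OF assms])
qed (use subring_onD[OF subring_laurent] ideal_onD[OF assms] in \<open>auto simp: lookup_add\<close>)

text \<open>As in Gauss's lemma: take the highest coefficients of \<open>F\<close> and
  \<open>G\<close> that lie outside \<open>P\<close>. Their product is the only term outside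
  \<open>P\<close> in the corresponding coefficient of \<open>F * G\<close>.\<close>

lemma prime_coeffs_in_laurent:
  fixes P :: "((nat \<Rightarrow>\<^sub>0 nat) \<Rightarrow>\<^sub>0 'k::field) set"
  assumes P: "primeideal P (ring_on (polys n))"
  shows "primeideal (coeffs_in (laurent n) P) (ring_on (laurent n))"
proof -
  have I: "ideal_on (polys n) P" and one: "1 \<notin> P"
    and prime: "\<And>x y. x \<in> polys n \<Longrightarrow> y \<in> polys n \<Longrightarrow> x * y \<in> P \<Longrightarrow> x \<in> P \<or> y \<in> P"
    using P primeideal_ring_on_iff[OF subring_polys] by blast+
  have "F \<in> coeffs_in (laurent n) P \<or> G \<in> coeffs_in (laurent n) P"
    if F: "F \<in> laurent n" and G: "G \<in> laurent n" and FG: "F * G \<in> coeffs_in (laurent n) P" for F G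
  proof (rule ccontr)
    assume neg: "\<not> (F \<in> coeffs_in (laurent n) P \<or> G \<in> coeffs_in (laurent n) P)"
    define SF where "SF = {d \<in> keys F. lookup F d \<notin> P}"
    define SG where "SG = {d \<in> keys G. lookup G d \<notin> P}"
    obtain d e where "lookup F d \<notin> P" "lookup G e \<notin> P" using neg F G unfolding coeffs_in_def by auto
    moreover from this have "d \<in> keys F" "e \<in> keys G" using ideal_onD(2)[OF I] by (metis in_keys_iff)+
    ultimately have "SF \<noteq> {}" "SG \<noteq> {}" unfolding SF_def SG_def by auto
    moreover have "finite SF" "finite SG" unfolding SF_def SG_def by auto
    ultimately have e: "Max SF \<in> SF" "Max SG \<in> SG" "\<And>d. d \<in> SF \<Longrightarrow> d \<le> Max SF" "\<And>d. d \<in> SG \<Longrightarrow> d \<le> Max SG"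
      by auto
    define s t where "s = Max SF" and "t = Max SG"
    have big: "lookup F d \<in> P" if "d > s" for d
    proof (rule ccontr)
      assume "lookup F d \<notin> P"
      then have "d \<in> SF" using ideal_onD(2)[OF I] unfolding SF_def by (metis (mono_tags, lifting) in_keys_iff mem_Collect_eq)
      then show False using e(3)[of d] that unfolding s_def by simp
    qed
    have big': "lookup G d \<in> P" if "d > t" for d
    proof (rule ccontr)
      assume "lookup G d \<notin> P"
      then have "d \<in> SG" using ideal_onD(2)[OF I] unfolding SG_def by (metis (mono_tags, lifting) in_keys_iff mem_Collect_eq)
      then show False using e(4)[of d] that unfolding t_def by simp
    qed
    have st: "s \<in> keys F" "lookup F s \<notin> P" "lookup G t \<notin> P" using e unfolding s_def t_def SF_def SG_def by auto
    have FL: "lookup F d \<in> polys n" and GL: "lookup G d \<in> polys n" for d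
      using F G by (auto simp: laurent_def)
    have expand: "lookup (F * G) (s + t) = lookup F s * lookup G t + (\<Sum>d\<in>keys F - {s}. lookup F d * lookup G (s + t - d))"
      unfolding lookup_mult_group by (subst sum.remove[of _ s]) (use st in auto)
    have rest: "(\<Sum>d\<in>keys F - {s}. lookup F d * lookup G (s + t - d)) \<in> P"
    proof (rule ideal_onD(5)[OF I])
      fix d assume d: "d \<in> keys F - {s}"
      show "lookup F d * lookup G (s + t - d) \<in> P"
      proof (cases "d > s")
        case True
        then show ?thesis using ideal_onD(4)[OF I GL big] by (simp add: mult.commute)
      next
        case False
        then show ?thesis using ideal_onD(4)[OF I FL big'] d by simp
      qed
    qed
    have "lookup (F * G) (s + t) \<in> P" using FG by (simp add: coeffs_in_def)
    from ideal_on_diff[OF subring_polys I this rest] have "lookup F s * lookup G t \<in> P"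
      unfolding expand by simp
    then show False using prime[OF FL GL] st by blast
  qed
  moreover have "1 \<notin> coeffs_in (laurent n) P"
  proof
    assume "1 \<in> coeffs_in (laurent n) P"
    then have "lookup (1 :: 'k graded) 0 \<in> P" unfolding coeffs_in_def by blast
    then show False using one by simp
  qed
  ultimately show ?thesis
    unfolding primeideal_ring_on_iff[OF subring_laurent] using ideal_coeffs_in_laurent[OF I] by blast
qed

text \<open>A high power of \<open>T\<close> lifts the exponents above the weighted degrees. This is
  why the Rees algebra and the Laurent ring have the same local rings where \<open>T\<close> is
  invertible.\<close>

lemma laurent_shift_rees:
  assumes F: "F \<in> laurent n"
  shows "\<exists>m::nat. single (int m) 1 * F \<in> rees n w"
proof -
  define X where "X = (\<Union>d\<in>keys F. (\<lambda>a. wdeg n w a - d) ` keys (lookup F d))"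
  have X: "finite X" unfolding X_def by auto
  define m where "m = nat (Max (insert 0 X))"
  have m: "x \<le> int m" if "x \<in> X" for x using that X Max_ge[of "insert 0 X" x] unfolding m_def by auto
  have "a \<in> exponents n \<and> wdeg n w a \<le> d" if "a \<in> keys (lookup (single (int m) 1 * F) d)" for a d
  proof -
    have a: "a \<in> keys (lookup F (d - int m))" using that by (simp add: lookup_single_mult_group)
    then have "d - int m \<in> keys F" by (auto simp: in_keys_iff)
    then have "wdeg n w a - (d - int m) \<in> X" using a unfolding X_def by blast
    then show ?thesis using m a F by (fastforce simp: laurent_def polys_def)
  qed
  then show ?thesis unfolding rees_def by blast
qed

lemma laurent_shift_nonneg:
  shows "\<exists>m::nat. \<forall>d\<in>keys (single (int m) 1 * (F :: 'k::field graded)). d \<ge> 0"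
proof -
  define m where "m = nat (Max (insert 0 (uminus ` keys F)))"
  have m: "- d \<le> int m" if "d \<in> keys F" for d
    using that Max_ge[of "insert 0 (uminus ` keys F)" "- d"] unfolding m_def by auto
  have "d \<ge> 0" if "d \<in> keys (single (int m) 1 * F)" for d
    using that m[of "d - int m"] by (auto simp: in_keys_iff lookup_single_mult_group)
  then show ?thesis by blast
qed

section \<open>Monomial preorders and weights\<close>

text \<open>Fourier--Motzkin elimination of the last variable. The sets \<open>Ps\<close> and \<open>Pw\<close> of vectors that are
  to be made positive resp. nonnegative form a cone, so every consequence of the system is again of
  the same kind, and the contradiction \<open>0 > 0\<close> cannot arise.\<close>

lemma fourier_motzkin:
  fixes Ps Pw :: "(nat \<Rightarrow> int) \<Rightarrow> bool"
  assumes ss: "\<And>u v. Ps u \<Longrightarrow> Ps v \<Longrightarrow> Ps (\<lambda>i. u i + v i)"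
    and sw: "\<And>u v. Ps u \<Longrightarrow> Pw v \<Longrightarrow> Ps (\<lambda>i. u i + v i)"
    and ww: "\<And>u v. Pw u \<Longrightarrow> Pw v \<Longrightarrow> Pw (\<lambda>i. u i + v i)"
    and zero: "\<not> Ps (\<lambda>_. 0)"
  shows "finite S \<Longrightarrow> finite W \<Longrightarrow> (\<And>v. v \<in> S \<Longrightarrow> Ps v) \<Longrightarrow> (\<And>v. v \<in> W \<Longrightarrow> Pw v) \<Longrightarrow>
    (\<And>v i. v \<in> S \<union> W \<Longrightarrow> i \<ge> m \<Longrightarrow> v i = 0) \<Longrightarrow>
    \<exists>w :: nat \<Rightarrow> rat. (\<forall>v\<in>S. (\<Sum>i<m. w i * of_int (v i)) > 0) \<and> (\<forall>v\<in>W. (\<Sum>i<m. w i * of_int (v i)) \<ge> 0)"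
proof (induction m arbitrary: S W)
  case 0
  \<comment> \<open>Without variables a strict vector would be zero, which \<open>zero\<close>
    excludes; so there are no strict conditions.\<close>
  have "v = (\<lambda>_. 0)" if "v \<in> S" for v using 0(5)[of v] that by auto
  then have "S = {}" using 0(3) zero by blast
  then show ?case by simp
next
  case (Suc m)
  \<comment> \<open>The cones are closed under addition only; a multiple by a positive integer is a
    repeated sum.\<close>
  have scale_s: "Ps (\<lambda>i. int (Suc k) * v i)" if "Ps v" for k v
  proof (induction k)
    case (Suc k)
    then show ?case using ss[OF Suc that] by (simp add: algebra_simps)
  qed (use that in simp)
  have scale_w: "Pw (\<lambda>i. int (Suc k) * v i)" if "Pw v" for k v
  proof (induction k)
    case (Suc k)
    then show ?case using ww[OF Suc that] by (simp add: algebra_simps)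
  qed (use that in simp)
  have scale: "(Ps v \<longrightarrow> Ps (\<lambda>i. c * v i)) \<and> (Pw v \<longrightarrow> Pw (\<lambda>i. c * v i))" if "c > 0" for c v
    using scale_s[of v "nat c - 1"] scale_w[of v "nat c - 1"] that by simp
  \<comment> \<open>For \<open>u m > 0\<close> and \<open>v m < 0\<close> a sum of positive
    multiples of \<open>u\<close> and \<open>v\<close> that vanishes at the coordinate
    \<open>m\<close>.\<close>
  define comb where "comb u v = (\<lambda>i. - v m * u i + u m * v i)" for u v :: "nat \<Rightarrow> int"
  have comb: "(Ps u \<longrightarrow> Ps v \<longrightarrow> Ps (comb u v)) \<and> (Ps u \<longrightarrow> Pw v \<longrightarrow> Ps (comb u v)) \<and>
      (Pw u \<longrightarrow> Ps v \<longrightarrow> Ps (comb u v)) \<and> (Pw u \<longrightarrow> Pw v \<longrightarrow> Pw (comb u v))"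
    if "u m > 0" "v m < 0" for u v
    using scale[of "- v m" u] scale[of "u m" v] that
      ss[of "\<lambda>i. - v m * u i" "\<lambda>i. u m * v i"] sw[of "\<lambda>i. - v m * u i" "\<lambda>i. u m * v i"]
      sw[of "\<lambda>i. u m * v i" "\<lambda>i. - v m * u i"] ww[of "\<lambda>i. - v m * u i" "\<lambda>i. u m * v i"]
    unfolding comb_def by (auto simp: algebra_simps)
  define pos neg nul where "pos = (\<lambda>A. {u \<in> A. (u m :: int) > 0})" and "neg = (\<lambda>A. {u \<in> A. (u m :: int) < 0})"
    and "nul = (\<lambda>A. {u \<in> A. (u m :: int) = 0})"
  \<comment> \<open>Each pair of opposite signs leaves one condition without the variable
    \<open>m\<close>, strict as soon as one of the two is.\<close>
  define S' where "S' = nul S \<union> case_prod comb ` (pos S \<times> neg S \<union> pos S \<times> neg W \<union> pos W \<times> neg S)"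
  define W' where "W' = nul W \<union> case_prod comb ` (pos W \<times> neg W)"
  have "\<exists>w :: nat \<Rightarrow> rat. (\<forall>v\<in>S'. (\<Sum>i<m. w i * of_int (v i)) > 0) \<and> (\<forall>v\<in>W'. (\<Sum>i<m. w i * of_int (v i)) \<ge> 0)"
  proof (rule Suc.IH)
    show "finite S'" "finite W'" unfolding S'_def W'_def pos_def neg_def nul_def using Suc.prems(1,2) by auto
    show "Ps v" if "v \<in> S'" for v
      using that Suc.prems(3,4) comb unfolding S'_def pos_def neg_def nul_def by auto
    show "Pw v" if "v \<in> W'" for v
      using that Suc.prems(3,4) comb unfolding W'_def pos_def neg_def nul_def by auto
    show "v i = 0" if v: "v \<in> S' \<union> W'" and i: "i \<ge> m" for v i
    proof (cases "i = m")
      case True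
      then show ?thesis using v unfolding S'_def W'_def pos_def neg_def nul_def comb_def by auto
    next
      case False
      then have z: "u i = 0" if "u \<in> S \<union> W" for u using Suc.prems(5)[OF that] i by simp
      have "v \<in> S \<union> W \<or> (\<exists>a b. a \<in> S \<union> W \<and> b \<in> S \<union> W \<and> v = comb a b)"
        using v unfolding S'_def W'_def pos_def neg_def nul_def by auto
      then show ?thesis
      proof (elim disjE exE conjE)
        fix a b assume "a \<in> S \<union> W" "b \<in> S \<union> W" "v = comb a b"
        then show ?thesis using z[of a] z[of b] by (simp add: comb_def)
      qed (rule z)
    qed
  qed
  then obtain w :: "nat \<Rightarrow> rat" where w: "\<And>v. v \<in> S' \<Longrightarrow> (\<Sum>i<m. w i * of_int (v i)) > 0"
    "\<And>v. v \<in> W' \<Longrightarrow> (\<Sum>i<m. w i * of_int (v i)) \<ge> 0" by blast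
  define f where "f v = (\<Sum>i<m. w i * of_int (v i))" for v
  \<comment> \<open>What \<open>v\<close> demands of the last coordinate of the weight:
    \<open>bd v\<close> is a lower bound if \<open>v m > 0\<close> and an upper bound if
    \<open>v m < 0\<close>.\<close>
  define bd where "bd v = - f v / of_int (v m)" for v
  have f_comb: "f (comb u v) = - of_int (v m) * f u + of_int (u m) * f v" for u v
    unfolding f_def comb_def by (simp add: algebra_simps sum.distrib sum_distrib_left sum_negf sum_subtractf)
  have less: "bd u < bd v" if "u m > 0" "v m < 0" "f (comb u v) > 0" for u v
  proof -
    have "0 < - (of_int (v m) :: rat)" "(0 :: rat) < of_int (u m)" using that by auto
    then show ?thesis using that(3) unfolding f_comb bd_def by (simp add: field_simps)
  qed
  have less_eq: "bd u \<le> bd v" if "u m > 0" "v m < 0" "f (comb u v) \<ge> 0" for u v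
  proof -
    have "0 < - (of_int (v m) :: rat)" "(0 :: rat) < of_int (u m)" using that by auto
    then show ?thesis using that(3) unfolding f_comb bd_def by (simp add: field_simps)
  qed
  define A where "A = pos (S \<union> W)"
  define B where "B = neg (S \<union> W)"
  have fin: "finite A" "finite B" unfolding A_def B_def pos_def neg_def using Suc.prems by auto
  have AB: "bd u \<le> bd v \<and> (u \<in> S \<or> v \<in> S \<longrightarrow> bd u < bd v)" if "u \<in> A" "v \<in> B" for u v
  proof -
    have m: "u m > 0" "v m < 0" using that unfolding A_def B_def pos_def neg_def by auto
    have "comb u v \<in> S'" if "u \<in> S \<or> v \<in> S"
      using \<open>u \<in> A\<close> \<open>v \<in> B\<close> that unfolding S'_def A_def B_def pos_def neg_def by force
    moreover have "comb u v \<in> S' \<or> comb u v \<in> W'"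
      using \<open>u \<in> A\<close> \<open>v \<in> B\<close> unfolding S'_def W'_def A_def B_def pos_def neg_def by force
    ultimately show ?thesis using less[of u v] less_eq[of u v] m w unfolding f_def by fastforce
  qed
  \<comment> \<open>A value between all lower and all upper bounds. If one side is empty, the value
    lies one step beyond the extreme bound of the other; the inserted 0 guarantees that an extreme
    exists.\<close>
  have "\<exists>t :: rat. (\<forall>u\<in>A. bd u \<le> t \<and> (u \<in> S \<longrightarrow> bd u < t)) \<and> (\<forall>v\<in>B. t \<le> bd v \<and> (v \<in> S \<longrightarrow> t < bd v))"
  proof (cases "A = {} \<or> B = {}")
    case True
    then show ?thesis
    proof
      assume "A = {}"
      have "\<forall>v\<in>B. Min (insert 0 (bd ` B)) - 1 < bd v"
    proof
      fix v assume "v \<in> B"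
      then have "Min (insert 0 (bd ` B)) \<le> bd v" using fin(2) by (intro Min_le) auto
      then show "Min (insert 0 (bd ` B)) - 1 < bd v" by simp
    qed
      then show ?thesis using \<open>A = {}\<close> by (auto intro: less_imp_le)
    next
      assume "B = {}"
      have "\<forall>v\<in>A. bd v < Max (insert 0 (bd ` A)) + 1"
    proof
      fix v assume "v \<in> A"
      then have "bd v \<le> Max (insert 0 (bd ` A))" using fin(1) by (intro Max_ge) auto
      then show "bd v < Max (insert 0 (bd ` A)) + 1" by simp
    qed
      then show ?thesis using \<open>B = {}\<close> by (auto intro: less_imp_le)
    qed
  next
    case False
    define lo hi where "lo = Max (bd ` A)" and "hi = Min (bd ` B)"
    have lo: "\<And>u. u \<in> A \<Longrightarrow> bd u \<le> lo" and hi: "\<And>u. u \<in> B \<Longrightarrow> hi \<le> bd u"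
      unfolding lo_def hi_def using fin by auto
    have "lo \<in> bd ` A" "hi \<in> bd ` B" unfolding lo_def hi_def using fin False by (intro Max_in Min_in; simp)+
    then obtain u0 v0 where uv: "u0 \<in> A" "lo = bd u0" "v0 \<in> B" "hi = bd v0" by auto
    have le: "lo \<le> hi" using AB[of u0 v0] uv by simp
    show ?thesis
    proof (cases "lo < hi")
      case True
      then have "lo < (lo + hi) / 2" "(lo + hi) / 2 < hi" by simp_all
      then show ?thesis
        using le_less_trans[OF lo, of _ "(lo + hi) / 2"] less_le_trans[OF _ hi, of "(lo + hi) / 2"]
        by (intro exI[of _ "(lo + hi) / 2"]) (auto intro: less_imp_le)
    next
      case eq: False
      then have "lo = hi" using le by simp
      \<comment> \<open>Here the only possible value is \<open>lo = hi\<close>. A strict bound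
        cannot be attained there, because \<open>AB\<close> separates it strictly from the extreme
        bound on the other side.\<close>
      have "bd u \<le> lo \<and> (u \<in> S \<longrightarrow> bd u < lo)" if "u \<in> A" for u
        using lo[OF that] AB[OF that uv(3)] uv(4) \<open>lo = hi\<close> by auto
      moreover have "lo \<le> bd v \<and> (v \<in> S \<longrightarrow> lo < bd v)" if "v \<in> B" for v
        using hi[OF that] AB[OF uv(1) that] uv(2) \<open>lo = hi\<close> by auto
      ultimately show ?thesis by blast
    qed
  qed
  then obtain t where t: "\<And>u. u \<in> A \<Longrightarrow> bd u \<le> t \<and> (u \<in> S \<longrightarrow> bd u < t)"
    "\<And>v. v \<in> B \<Longrightarrow> t \<le> bd v \<and> (v \<in> S \<longrightarrow> t < bd v)" by blast
  define w' where "w' = w(m := t)"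
  have w': "(\<Sum>i<Suc m. w' i * of_int (v i)) = f v + t * of_int (v m)" for v
  proof -
    have "(\<Sum>i<m. w' i * of_int (v i)) = f v" unfolding f_def w'_def by (rule sum.cong) auto
    then show ?thesis by (simp add: w'_def)
  qed
  have "f v + t * of_int (v m) \<ge> 0 \<and> (v \<in> S \<longrightarrow> f v + t * of_int (v m) > 0)" if v: "v \<in> S \<union> W" for v
  proof -
    consider "v m = 0" | "v m > 0" | "v m < 0" by linarith
    then show ?thesis
    proof cases
      case 1
      then have "v \<in> S \<longrightarrow> v \<in> S'" "v \<in> W \<longrightarrow> v \<in> W'" unfolding S'_def W'_def nul_def by auto
      then show ?thesis using 1 v w unfolding f_def by (auto intro: less_imp_le)
    next
      case 2
      then have "v \<in> A" using v unfolding A_def pos_def by auto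
      have "(0 :: rat) < of_int (v m)" using 2 by simp
      then show ?thesis using t(1)[OF \<open>v \<in> A\<close>] unfolding bd_def by (auto simp: field_simps)
    next
      case 3
      then have "v \<in> B" using v unfolding B_def neg_def by auto
      have "(of_int (v m) :: rat) < 0" using 3 by simp
      then show ?thesis using t(2)[OF \<open>v \<in> B\<close>] unfolding bd_def by (auto simp: field_simps)
    qed
  qed
  then show ?case unfolding w'[symmetric] by blast
qed

lemma common_denominator_rat:
  fixes w :: "nat \<Rightarrow> rat"
  shows "\<exists>c > 0. \<exists>w' :: nat \<Rightarrow> int. \<forall>i<n. of_int (w' i) = of_int c * w i"
proof (induction n)
  case (Suc n)
  then obtain c w' where c: "c > 0" "\<forall>i<n. of_int (w' i) = (of_int c * w i :: rat)" by auto
  obtain p q where pq: "w n = of_int p / of_int q" "q > 0"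
    by (metis quotient_of_denom_pos' quotient_of_div surjective_pairing)
  have "of_int (c * p) = (of_int (c * q) * w n :: rat)" using pq by simp
  moreover have "of_int (w' i * q) = (of_int (c * q) * w i :: rat)" if "i < n" for i
    using c(2) that by simp
  ultimately have "\<forall>i<Suc n. of_int (((\<lambda>i. w' i * q)(n := c * p)) i) = (of_int (c * q) * w i :: rat)"
    by (auto simp: less_Suc_eq)
  moreover have "c * q > 0" using c pq by simp
  ultimately show ?case by blast
qed (auto intro: exI[of _ 1])

section \<open>Preorders on exponent vectors and their leading parts\<close>

lemma monomial_preorderD:
  assumes "monomial_preorder n lt"
  shows "a \<in> exponents n \<Longrightarrow> \<not> lt a a"
    "a \<in> exponents n \<Longrightarrow> b \<in> exponents n \<Longrightarrow> c \<in> exponents n \<Longrightarrow> lt a b \<Longrightarrow> lt b c \<Longrightarrow> lt a c"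
    "a \<in> exponents n \<Longrightarrow> b \<in> exponents n \<Longrightarrow> c \<in> exponents n \<Longrightarrow> lt a b \<longleftrightarrow> lt (a + c) (b + c)"
    "a \<in> exponents n \<Longrightarrow> b \<in> exponents n \<Longrightarrow> c \<in> exponents n \<Longrightarrow> \<not> lt b a \<Longrightarrow> \<not> lt c b \<Longrightarrow> \<not> lt c a"
proof -
  have w: "irreflp_on (exponents n) lt" "transp_on (exponents n) lt"
    "trans {(x, y). x \<in> exponents n \<and> y \<in> exponents n \<and> \<not> lt x y \<and> \<not> lt y x}"
    using assms unfolding monomial_preorder_def weak_order_on_def by (auto elim: equivE)
  show irr: "\<not> lt a a" if "a \<in> exponents n" for a using w(1) that by (auto simp: irreflp_on_def)
  show tr: "lt a c" if "a \<in> exponents n" "b \<in> exponents n" "c \<in> exponents n" "lt a b" "lt b c" for a b c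
    using w(2) that by (auto dest: transp_onD)
  show "a \<in> exponents n \<Longrightarrow> b \<in> exponents n \<Longrightarrow> c \<in> exponents n \<Longrightarrow> lt a b \<longleftrightarrow> lt (a + c) (b + c)"
    using assms unfolding monomial_preorder_def by blast
  show "\<not> lt c a" if m: "a \<in> exponents n" "b \<in> exponents n" "c \<in> exponents n" and ab: "\<not> lt b a" and bc: "\<not> lt c b" for a b c
  proof
    \<comment> \<open>If \<open>c\<close> were below \<open>a\<close>, then \<open>b\<close> would
      be incomparable to both, and incomparability is transitive.\<close>
    assume ca: "lt c a"
    have "\<not> lt a b" using tr[OF m(3,1,2) ca] bc by blast
    moreover have "\<not> lt b c" using tr[OF m(2,3,1) _ ca] ab by blast
    ultimately have "(a, b) \<in> {(x, y). x \<in> exponents n \<and> y \<in> exponents n \<and> \<not> lt x y \<and> \<not> lt y x}"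
      "(b, c) \<in> {(x, y). x \<in> exponents n \<and> y \<in> exponents n \<and> \<not> lt x y \<and> \<not> lt y x}"
      using m ab bc by auto
    with w(3) have "(a, c) \<in> {(x, y). x \<in> exponents n \<and> y \<in> exponents n \<and> \<not> lt x y \<and> \<not> lt y x}"
      by (rule transD)
    then show False using ca by auto
  qed
qed

text \<open>Both sums are compared with the intermediate monomial \<open>b + c\<close>. This closure
  under addition makes the differences of compared exponents a cone.\<close>

lemma monomial_preorder_add:
  assumes "monomial_preorder n lt" and m: "a \<in> exponents n" "b \<in> exponents n" "c \<in> exponents n" "d \<in> exponents n"
    and ex: "\<And>a b. a \<in> exponents n \<Longrightarrow> b \<in> exponents n \<Longrightarrow> a + b \<in> exponents n"
  shows "lt a b \<Longrightarrow> \<not> lt d c \<Longrightarrow> lt (a + c) (b + d)" "\<not> lt b a \<Longrightarrow> \<not> lt d c \<Longrightarrow> \<not> lt (b + d) (a + c)"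
proof -
  note M = monomial_preorderD[OF assms(1)]
  have 1: "lt a b \<longleftrightarrow> lt (a + c) (b + c)" "lt b a \<longleftrightarrow> lt (b + c) (a + c)" using M(3)[OF m(1,2,3)] M(3)[OF m(2,1,3)] by auto
  have 2: "lt d c \<longleftrightarrow> lt (b + d) (b + c)" using M(3)[of d c b] m by (simp add: add.commute)
  show "\<not> lt b a \<Longrightarrow> \<not> lt d c \<Longrightarrow> \<not> lt (b + d) (a + c)"
    using M(4)[of "a + c" "b + c" "b + d"] m ex 1 2 by auto
  show "lt (a + c) (b + d)" if "lt a b" "\<not> lt d c"
  proof (rule ccontr)
    assume "\<not> lt (a + c) (b + d)"
    then have "\<not> lt (a + c) (b + c)"
      using M(4)[of "b + c" "b + d" "a + c"] m ex 2 that by auto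
    then show False using 1 that by simp
  qed
qed

lemma lookup_leading_part:
  "lookup (leading_part lt f) a = (if \<forall>b\<in>keys f. \<not> lt a b then lookup f a else 0)"
  unfolding leading_part_def by (simp add: lookup_sum_single in_keys_iff)

lemma keys_leading_part: "keys (leading_part lt f) = {a \<in> keys f. \<forall>b\<in>keys f. \<not> lt a b}"
  by (auto simp: in_keys_iff lookup_leading_part split: if_splits)

lemma leading_part_polys: "f \<in> polys n \<Longrightarrow> leading_part lt f \<in> polys n"
  by (auto simp: polys_def keys_leading_part)

lemma leading_part_cong:
  assumes "\<And>a b. a \<in> keys f \<Longrightarrow> b \<in> keys f \<Longrightarrow> lt a b \<longleftrightarrow> lt' a b"
  shows "leading_part lt f = leading_part lt' f"
proof (rule poly_mapping_eqI)
  fix a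
  show "lookup (leading_part lt f) a = lookup (leading_part lt' f) a"
    using assms by (cases "a \<in> keys f") (auto simp: lookup_leading_part in_keys_iff)
qed

lemma leading_part_single_mult:
  assumes lt: "monomial_preorder n lt" and f: "f \<in> polys n" and a: "a \<in> exponents n" and c: "c \<noteq> 0"
  shows "leading_part lt (single a c * f) = single a c * leading_part lt f"
proof (rule poly_mapping_eqI)
  fix x
  show "lookup (leading_part lt (single a c * f)) x = lookup (single a c * leading_part lt f) x"
  proof (cases "x \<in> (+) a ` keys f")
    case True
    then obtain b where b: "b \<in> keys f" "x = a + b" by auto
    have "lt (a + b) (a + b') \<longleftrightarrow> lt b b'" if "b' \<in> keys f" for b'
      using monomial_preorderD(3)[OF lt, of b b' a] b f a that by (auto simp: polys_def add.commute)
    then show ?thesis unfolding b(2)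
      by (simp add: lookup_leading_part lookup_single_mult_add keys_single_mult[OF c])
  next
    case False
    then have "x \<notin> keys (single a c * f)" "x \<notin> keys (single a c * leading_part lt f)"
      unfolding keys_single_mult[OF c] by (auto simp: keys_leading_part)
    then show ?thesis by (simp add: lookup_leading_part in_keys_iff)
  qed
qed

text \<open>Write \<open>u = 1 + v\<close>, where all monomials of \<open>v\<close> lie below 1.
  Then every monomial of \<open>v * f\<close> lies below one of \<open>f\<close>, so that adding
  \<open>v * f\<close> affects no maximal term of \<open>f\<close>.\<close>

lemma leading_part_unit_mult:
  assumes lt: "monomial_preorder n lt" and u: "u \<in> polys n" "leading_part lt u = 1" and f: "f \<in> polys n"
  shows "leading_part lt (u * f) = leading_part lt f"
proof -
  note M = monomial_preorderD[OF lt]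
  define v where "v = u - 1"
  have uf: "u * f = f + v * f" unfolding v_def by (simp add: algebra_simps)
  have k1: "lookup u 0 = 1" "\<forall>b\<in>keys u. \<not> lt 0 b"
    using u(2) lookup_leading_part[of lt u 0] by (auto split: if_splits)
  have ue: "keys u \<subseteq> exponents n" and fe: "keys f \<subseteq> exponents n" using u f by (auto simp: polys_def)
  have v: "a \<in> exponents n \<and> lt a 0" if "a \<in> keys v" for a
  proof -
    have "a \<noteq> 0" using that k1 by (auto simp: in_keys_iff v_def lookup_minus)
    then have au: "a \<in> keys u" using that by (auto simp: in_keys_iff v_def lookup_minus lookup_one)
    have "lookup (leading_part lt u) a = 0" using \<open>a \<noteq> 0\<close> u(2) by (simp add: lookup_one)
    then obtain b where b: "b \<in> keys u" "lt a b" using au by (auto simp: lookup_leading_part in_keys_iff split: if_splits)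
    then have "lt a 0" using M(4)[of b 0 a] k1 ue au exponents_zero by blast
    then show ?thesis using au ue by auto
  qed
  have vf: "z \<in> exponents n \<and> (\<exists>b\<in>keys f. lt z b)" if "z \<in> keys (v * f)" for z
  proof -
    obtain a b where "a \<in> keys v" "b \<in> keys f" "z = a + b" using \<open>z \<in> keys (v * f)\<close> keys_mult by blast
    then show ?thesis using M(3)[of a 0 b] v[of a] fe exponents_zero exponents_add by fastforce
  qed
  show ?thesis
  proof (rule poly_mapping_eqI)
    fix x
    show "lookup (leading_part lt (u * f)) x = lookup (leading_part lt f) x"
    proof (cases "x \<in> exponents n")
      case False
      then have "x \<notin> keys f" "x \<notin> keys (u * f)"
        using fe subring_onD(5)[OF subring_polys u(1) f] by (auto simp: polys_def)
      then show ?thesis by (simp add: lookup_leading_part in_keys_iff)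
    next
      case xe: True
      show ?thesis
      proof (cases "\<exists>b\<in>keys f. lt x b")
        case False
        then have "x \<notin> keys (v * f)" using vf by blast
        then have "lookup (u * f) x = lookup f x" unfolding uf by (simp add: lookup_add in_keys_iff)
        moreover have "\<not> lt x z" if "z \<in> keys (u * f)" for z
        proof
          assume "lt x z"
          have "z \<in> keys f \<or> z \<in> keys (v * f)" using that keys_add[of f "v * f"] unfolding uf by blast
          then show False using False vf[of z] M(2)[OF xe _ _ \<open>lt x z\<close>] \<open>lt x z\<close> fe by blast
        qed
        ultimately show ?thesis using False by (auto simp: lookup_leading_part)
      next
        case True
        \<comment> \<open>A monomial of \<open>f\<close> above \<open>x\<close> might be cancelled
          in \<open>u * f\<close>; a maximal one cannot, and it keeps \<open>x\<close> out of the
          leading part.\<close>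
        define Y where "Y = {b \<in> keys f. lt x b}"
        have Y: "finite Y" "Y \<noteq> {}" "Y \<subseteq> exponents n" using True fe unfolding Y_def by auto
        have "asymp_on Y lt" "transp_on Y lt"
        proof -
          show "transp_on Y lt"
          proof (rule transp_onI)
            fix a b c assume "a \<in> Y" "b \<in> Y" "c \<in> Y" "lt a b" "lt b c"
            then show "lt a c" using M(2)[of a b c] Y(3) by blast
          qed
          show "asymp_on Y lt"
          proof (rule asymp_onI)
            fix a b assume "a \<in> Y" "b \<in> Y" "lt a b"
            then show "\<not> lt b a" using M(1)[of a] M(2)[of a b a] Y(3) by blast
          qed
        qed
        then obtain b where b: "b \<in> Y" "\<And>c. c \<in> Y \<Longrightarrow> c \<noteq> b \<Longrightarrow> \<not> lt b c"
          using Finite_Set.bex_max_element[OF Y(1)] Y(2) by blast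
        have bY: "b \<in> keys f" "lt x b" "b \<in> exponents n" using b Y by (auto simp: Y_def)
        have "\<not> lt b c" if c: "c \<in> keys f" for c
        proof
          assume "lt b c"
          then have "lt x c" using M(2)[OF xe bY(3) _ bY(2)] c fe by blast
          then show False using b(2)[of c] \<open>lt b c\<close> c M(1)[OF bY(3)] unfolding Y_def by blast
        qed
        then have "b \<notin> keys (v * f)" using vf by blast
        then have "b \<in> keys (u * f)" using bY unfolding uf by (simp add: lookup_add in_keys_iff)
        then show ?thesis using True bY by (auto simp: lookup_leading_part)
      qed
    qed
  qed
qed

text \<open>Sums of leading parts, for an arbitrary set \<open>V\<close>: for an ideal this is the
  leading ideal, and for the polynomials of an ideal up to a given degree it is a subspace.
  Multiples come from the closure properties of \<open>V\<close>.\<close>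

inductive_set lead_span :: "((nat \<Rightarrow>\<^sub>0 nat) \<Rightarrow> (nat \<Rightarrow>\<^sub>0 nat) \<Rightarrow> bool) \<Rightarrow> ((nat \<Rightarrow>\<^sub>0 nat) \<Rightarrow>\<^sub>0 'k::field) set
    \<Rightarrow> ((nat \<Rightarrow>\<^sub>0 nat) \<Rightarrow>\<^sub>0 'k) set" for lt V where
  zero: "0 \<in> lead_span lt V"
| step: "x \<in> lead_span lt V \<Longrightarrow> g \<in> V \<Longrightarrow> x + leading_part lt g \<in> lead_span lt V"

lemma lead_span_base: "g \<in> V \<Longrightarrow> leading_part lt g \<in> lead_span lt V"
  using lead_span.step[OF lead_span.zero] by force

lemma lead_span_add:
  assumes "x \<in> lead_span lt V" "y \<in> lead_span lt V"
  shows "x + y \<in> lead_span lt V"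
  using assms(2) by induction (use assms(1) lead_span.step in \<open>auto simp: add.assoc[symmetric]\<close>)

lemma lead_span_sum: "(\<And>i. i \<in> A \<Longrightarrow> f i \<in> lead_span lt V) \<Longrightarrow> sum f A \<in> lead_span lt V"
  by (induction A rule: infinite_finite_induct) (auto intro: lead_span.zero lead_span_add)

lemma lead_span_mono:
  assumes "V \<subseteq> W"
  shows "lead_span lt V \<subseteq> lead_span lt W"
proof
  fix x assume "x \<in> lead_span lt V"
  then show "x \<in> lead_span lt W" by induction (use assms in \<open>auto intro: lead_span.intros\<close>)
qed

lemma lead_span_least:
  assumes "x \<in> lead_span lt V" "0 \<in> U" "\<And>g. g \<in> V \<Longrightarrow> leading_part lt g \<in> U" "\<And>x y. x \<in> U \<Longrightarrow> y \<in> U \<Longrightarrow> x + y \<in> U"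
  shows "x \<in> U"
  using assms(1) by induction (use assms in auto)

lemma lead_span_keys:
  assumes "x \<in> lead_span lt V" "\<And>g. g \<in> V \<Longrightarrow> keys g \<subseteq> A"
  shows "keys x \<subseteq> A"
  using assms(1)
proof induction
  case (step x g)
  have "keys (leading_part lt g) \<subseteq> A" using assms(2)[OF step(2)] by (auto simp: keys_leading_part)
  then show ?case using step.IH keys_add[of x "leading_part lt g"] by blast
qed simp

lemma lead_span_finite:
  assumes "x \<in> lead_span lt V"
  shows "\<exists>G. finite G \<and> G \<subseteq> V \<and> x \<in> lead_span lt G"
  using assms
proof induction
  case zero
  then show ?case using lead_span.zero by blast
next
  case (step x g)
  then obtain G where G: "finite G" "G \<subseteq> V" "x \<in> lead_span lt G" by auto
  then have "x + leading_part lt g \<in> lead_span lt (insert g G)"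
    using lead_span_mono[of G "insert g G" lt] by (intro lead_span.step) auto
  then show ?case using G step by (intro exI[of _ "insert g G"]) auto
qed

text \<open>A leading part depends only on comparisons between monomials of one polynomial. Together
  with \<open>lead_span_finite\<close>, a single membership in the span is secured by finitely many
  comparisons.\<close>

lemma lead_span_agree:
  assumes "x \<in> lead_span lt V" "\<And>g a b. g \<in> V \<Longrightarrow> a \<in> keys g \<Longrightarrow> b \<in> keys g \<Longrightarrow> lt' a b \<longleftrightarrow> lt a b"
  shows "x \<in> lead_span lt' V"
  using assms(1)
proof induction
  case (step x g)
  have "leading_part lt g = leading_part lt' g" using assms(2)[OF step(2)] by (intro leading_part_cong) auto
  then show ?case using step lead_span.step by metis
qed (rule lead_span.zero)

lemma lead_span_single_mult:
  assumes lt: "monomial_preorder n lt" and V: "V \<subseteq> polys n" and a: "a \<in> exponents n"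
    and VW: "\<And>g. g \<in> V \<Longrightarrow> single a c * g \<in> W" and x: "x \<in> lead_span lt V"
  shows "single a c * x \<in> lead_span lt W"
proof (cases "c = 0")
  case True
  then show ?thesis using lead_span.zero by simp
next
  case False
  from x show ?thesis
  proof induction
    case (step x g)
    have "leading_part lt (single a c * g) = single a c * leading_part lt g"
      using leading_part_single_mult[OF lt _ a False] V step by blast
    then show ?case using lead_span.step[OF step.IH VW[OF step(2)]] by (simp add: distrib_left)
  qed (simp add: lead_span.zero)
qed

lemma lead_span_mult:
  fixes r x :: "(nat \<Rightarrow>\<^sub>0 nat) \<Rightarrow>\<^sub>0 'k::field"
  assumes lt: "monomial_preorder n lt" and V: "V \<subseteq> polys n" and A: "A \<subseteq> exponents n"
    and VW: "\<And>g a c. g \<in> V \<Longrightarrow> a \<in> A \<Longrightarrow> single a c * g \<in> W" and x: "x \<in> lead_span lt V" and r: "keys r \<subseteq> A"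
  shows "r * x \<in> lead_span lt W"
  by (rule poly_mapping_induct_single[OF r, of "\<lambda>r. r * x \<in> lead_span lt W"])
    (use lead_span_single_mult[OF lt V _ VW x] A in \<open>auto simp: lead_span.zero distrib_right intro: lead_span_add\<close>)

text \<open>A term times the leading part of \<open>g\<close> is the leading part of the product,
  because the order is compatible with multiplication; so sums of leading parts already form an
  ideal.\<close>

lemma ideal_lead_span:
  fixes J :: "((nat \<Rightarrow>\<^sub>0 nat) \<Rightarrow>\<^sub>0 'k::field) set"
  assumes lt: "monomial_preorder n lt" and J: "ideal_on (polys n) J"
  shows "ideal_on (polys n) (lead_span lt J)"
  unfolding ideal_on_def
proof (intro conjI ballI)
  show "lead_span lt J \<subseteq> polys n"
    using lead_span_keys[of _ lt J "exponents n"] ideal_onD(1)[OF J] by (auto simp: polys_def)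
  fix r x :: "(nat \<Rightarrow>\<^sub>0 nat) \<Rightarrow>\<^sub>0 'k" assume "r \<in> polys n" "x \<in> lead_span lt J"
  then show "r * x \<in> lead_span lt J"
    using lead_span_mult[OF lt ideal_onD(1)[OF J] order.refl] ideal_onD(4)[OF J single_polys] by (auto simp: polys_def)
qed (auto intro: lead_span.zero lead_span_add)

lemma genideal_leading_parts:
  assumes lt: "monomial_preorder n lt" and J: "ideal_on (polys n) J"
  shows "Idl\<^bsub>polynomial_ring n\<^esub> (leading_part lt ` J) = lead_span lt J"
proof -
  interpret cring "ring_on (polys n :: ((nat \<Rightarrow>\<^sub>0 nat) \<Rightarrow>\<^sub>0 'a) set)" by (rule cring_ring_on[OF subring_polys])
  have sub: "leading_part lt ` J \<subseteq> carrier (ring_on (polys n))"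
    using ideal_onD(1)[OF J] leading_part_polys by auto
  have I: "ideal_on (polys n) (Idl\<^bsub>ring_on (polys n)\<^esub> (leading_part lt ` J))"
    using genideal_ideal[OF sub] ideal_ring_on_iff[OF subring_polys] by blast
  show ?thesis
    unfolding polynomial_ring_eq
  proof
    show "Idl\<^bsub>ring_on (polys n)\<^esub> (leading_part lt ` J) \<subseteq> lead_span lt J"
      by (rule genideal_minimal) (use ideal_lead_span[OF lt J] ideal_ring_on_iff[OF subring_polys] lead_span_base in auto)
    show "lead_span lt J \<subseteq> Idl\<^bsub>ring_on (polys n)\<^esub> (leading_part lt ` J)"
      using lead_span_least[of _ lt J "Idl\<^bsub>ring_on (polys n)\<^esub> (leading_part lt ` J)"] ideal_onD(2,3)[OF I] genideal_self[OF sub]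
      by blast
  qed
qed

text \<open>In every class of equivalent monomials, an element of the span coincides with a single element of \<open>V\<close>
  that has no larger monomials.\<close>

lemma lead_span_class:
  assumes lt: "monomial_preorder n lt" and V: "V \<subseteq> polys n" "0 \<in> V" "\<And>f g. f \<in> V \<Longrightarrow> g \<in> V \<Longrightarrow> f + g \<in> V"
    and e: "e \<in> exponents n" and x: "x \<in> lead_span lt V"
  shows "\<exists>g\<in>V. (\<forall>b\<in>keys g. \<not> lt e b) \<and> (\<forall>b\<in>exponents n. \<not> lt e b \<longrightarrow> \<not> lt b e \<longrightarrow> lookup x b = lookup g b)"
  using x
proof induction
  case zero
  then show ?case using V(2) by (intro bexI[of _ 0]) auto
next
  case (step x h)
  note M = monomial_preorderD[OF lt]
  have he: "keys h \<subseteq> exponents n" using step V(1) by (auto simp: polys_def)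
  obtain g where g: "g \<in> V" "\<forall>b\<in>keys g. \<not> lt e b"
    "\<And>b. b \<in> exponents n \<Longrightarrow> \<not> lt e b \<Longrightarrow> \<not> lt b e \<Longrightarrow> lookup x b = lookup g b" using step.IH by blast
  \<comment> \<open>If the leading part of \<open>h\<close> meets the class of \<open>e\<close>,
    then \<open>h\<close> has nothing above \<open>e\<close> and coincides with its leading part
    within the class, so \<open>h\<close> is added to \<open>g\<close>. Otherwise the leading part
    contributes nothing to the class, and \<open>g\<close> is kept.\<close>
  show ?case
  proof (cases "\<exists>b\<in>keys (leading_part lt h). \<not> lt e b \<and> \<not> lt b e")
    case True
    then obtain b where b: "b \<in> keys h" "\<forall>c\<in>keys h. \<not> lt b c" "\<not> lt e b" "\<not> lt b e" by (auto simp: keys_leading_part)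
    have be: "b \<in> exponents n" using b he by auto
    have h_le: "\<not> lt e c" if "c \<in> keys h" for c using M(4)[of c b e] b that he e be by blast
    have "lookup (leading_part lt h) b' = lookup h b'" if b': "b' \<in> exponents n" "\<not> lt e b'" "\<not> lt b' e" for b'
    proof -
      have "\<not> lt b' b" using M(4)[of b e b'] b b' e be by blast
      then have "\<not> lt b' c" if "c \<in> keys h" for c using M(4)[of c b b'] b(2) that b'(1) be he by blast
      then show ?thesis by (simp add: lookup_leading_part)
    qed
    then show ?thesis
      using g h_le V(3)[OF g(1) step(2)] keys_add[of g h] by (intro bexI[of _ "g + h"]) (auto simp: lookup_add)
  next
    case False
    have "lookup (leading_part lt h) b' = 0" if b': "b' \<in> exponents n" "\<not> lt e b'" "\<not> lt b' e" for b'
      using False b' by (auto simp: in_keys_iff)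
    then show ?thesis using g by (intro bexI[of _ g]) (auto simp: lookup_add)
  qed
qed

text \<open>An element of \<open>J\<close> that agrees with 1 in the class of the monomial 1, and
  has nothing above that class, has leading part 1. So the leading ideal of \<open>p\<close> is
  proper if \<open>p\<close> contains no polynomial with leading part 1.\<close>

lemma one_in_lead_span:
  assumes lt: "monomial_preorder n lt" and J: "ideal_on (polys n) J" and one: "1 \<in> lead_span lt J"
  shows "\<exists>g\<in>J. leading_part lt g = 1"
proof -
  obtain g where g: "g \<in> J" "\<forall>b\<in>keys g. \<not> lt 0 b"
    "\<And>b. b \<in> exponents n \<Longrightarrow> \<not> lt 0 b \<Longrightarrow> \<not> lt b 0 \<Longrightarrow> lookup 1 b = lookup g b"
    using lead_span_class[OF lt ideal_onD(1,2)[OF J] _ exponents_zero one] ideal_onD(3)[OF J] by blast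
  have ge: "keys g \<subseteq> exponents n" using g(1) ideal_onD(1)[OF J] by (auto simp: polys_def)
  have g0: "lookup g 0 = 1"
    using g(3)[OF exponents_zero] monomial_preorderD(1)[OF lt exponents_zero] by simp
  have "leading_part lt g = 1"
  proof (rule poly_mapping_eqI)
    fix x
    show "lookup (leading_part lt g) x = lookup 1 x"
    proof (cases "x = 0")
      case True
      then show ?thesis using g(2) g0 by (simp add: lookup_leading_part)
    next
      case x0: False
      show ?thesis
      proof (cases "x \<in> keys g \<and> \<not> lt x 0")
        case True
        then have "lookup g x = lookup 1 x" using g(2) g(3)[of x] ge by auto
        then show ?thesis using True x0 by (simp add: in_keys_iff lookup_one)
      next
        case False
        then have "lookup (leading_part lt g) x = 0" using g0 by (auto simp: lookup_leading_part in_keys_iff)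
        then show ?thesis using x0 by (simp add: lookup_one)
      qed
    qed
  qed
  then show ?thesis using g(1) by blast
qed

section \<open>Dimension of a span of leading parts\<close>

lemma ex_linear_extension:
  assumes "finite M" "\<And>a. a \<in> M \<Longrightarrow> \<not> lt a a"
    "\<And>a b c. a \<in> M \<Longrightarrow> b \<in> M \<Longrightarrow> c \<in> M \<Longrightarrow> lt a b \<Longrightarrow> lt b c \<Longrightarrow> lt a c"
  shows "\<exists>h :: 'a \<Rightarrow> nat. inj_on h M \<and> (\<forall>a\<in>M. \<forall>b\<in>M. lt a b \<longrightarrow> h a < h b)"
  using assms
proof (induction "card M" arbitrary: M)
  case 0
  then show ?case by simp
next
  case (Suc k)
  have "M \<noteq> {}" using Suc.hyps(2) by auto
  have "transp_on M lt"
    by (rule transp_onI) (use Suc.prems(3) in blast)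
  moreover have "asymp_on M lt"
  proof (rule asymp_onI)
    fix a b assume "a \<in> M" "b \<in> M" "lt a b"
    then show "\<not> lt b a" using Suc.prems(2)[of a] Suc.prems(3)[of a b a] by blast
  qed
  ultimately obtain m where m: "m \<in> M" "\<And>x. x \<in> M \<Longrightarrow> x \<noteq> m \<Longrightarrow> \<not> lt m x"
    using Finite_Set.bex_max_element[OF Suc.prems(1)] \<open>M \<noteq> {}\<close> by blast
  have "k = card (M - {m})" using Suc.hyps(2) m(1) Suc.prems(1) by simp
  then have "\<exists>h :: 'a \<Rightarrow> nat. inj_on h (M - {m}) \<and> (\<forall>a\<in>M - {m}. \<forall>b\<in>M - {m}. lt a b \<longrightarrow> h a < h b)"
    using Suc.prems by (intro Suc.hyps(1)) auto
  then obtain h :: "'a \<Rightarrow> nat" where h: "inj_on h (M - {m})" "\<And>a b. a \<in> M - {m} \<Longrightarrow> b \<in> M - {m} \<Longrightarrow> lt a b \<Longrightarrow> h a < h b"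
    by blast
  \<comment> \<open>A value above all the others, for the maximal element that was removed.\<close>
  define t where "t = Suc (\<Sum>a\<in>M - {m}. h a)"
  have t: "h a < t" if "a \<in> M - {m}" for a
    using that Suc.prems(1) member_le_sum[of a "M - {m}" h] unfolding t_def by auto
  have "inj_on (h(m := t)) M"
    using h(1) t by (auto simp: inj_on_def)
  moreover have "(h(m := t)) a < (h(m := t)) b" if "a \<in> M" "b \<in> M" "lt a b" for a b
    using that h(2)[of a b] t[of a] m Suc.prems(2)[of m] by (cases "a = m"; cases "b = m") auto
  ultimately show ?case by blast
qed

interpretation kv: vector_space "\<lambda>c (p :: (nat \<Rightarrow>\<^sub>0 nat) \<Rightarrow>\<^sub>0 'k::field). single 0 c * p"
  by unfold_locales (simp_all add: algebra_simps single_add mult_single flip: mult.assoc)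

lemma lookup_scale: "lookup (single 0 c * p) a = c * lookup (p :: (nat \<Rightarrow>\<^sub>0 nat) \<Rightarrow>\<^sub>0 'k::field) a"
  using lookup_single_mult_add[of 0 c p a] by simp

text \<open>For an injective \<open>h\<close> this is the position of the top monomial in a linear
  order. For \<open>p = 0\<close> the maximum over the empty set is unspecified, hence the recurring
  \<open>V - {0}\<close>.\<close>

definition height :: "('a \<Rightarrow> nat) \<Rightarrow> ('a \<Rightarrow>\<^sub>0 'b::zero) \<Rightarrow> nat" where
  "height h p = Max (h ` keys p)"

lemma height_props:
  assumes "p \<noteq> 0"
  shows "b \<in> keys p \<Longrightarrow> h b \<le> height h p" "\<exists>a\<in>keys p. h a = height h p"
proof -
  have ne: "h ` keys p \<noteq> {}" using assms by (metis image_is_empty poly_mapping_eqI in_keys_iff lookup_zero empty_iff)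
  show "b \<in> keys p \<Longrightarrow> h b \<le> height h p" unfolding height_def by auto
  have "height h p \<in> h ` keys p" unfolding height_def using ne by (intro Max_in) auto
  then show "\<exists>a\<in>keys p. h a = height h p" by auto
qed

lemma height_eqI:
  assumes "a \<in> keys p" "\<And>b. b \<in> keys p \<Longrightarrow> h b \<le> h a"
  shows "height h p = h a"
  unfolding height_def using assms by (intro Max_eqI) auto

text \<open>Echelon form: one vector for each height that occurs gives a basis, so the dimension of
  \<open>V\<close> is the number of its heights.\<close>

lemma height_basis:
  fixes V :: "((nat \<Rightarrow>\<^sub>0 nat) \<Rightarrow>\<^sub>0 'k::field) set"
  assumes V: "kv.subspace V" and M: "finite M" "\<And>v. v \<in> V \<Longrightarrow> keys v \<subseteq> M" and h: "inj_on h M"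
  shows "\<exists>B. finite B \<and> B \<subseteq> V \<and> kv.independent B \<and> V \<subseteq> kv.span B \<and> card B = card (height h ` (V - {0}))"
proof -
  define N where "N = height h ` (V - {0})"
  have "N \<subseteq> h ` M"
  proof
    fix k assume "k \<in> N"
    then obtain v where v: "v \<in> V" "v \<noteq> 0" "k = height h v" unfolding N_def by auto
    then show "k \<in> h ` M" using height_props(2)[of v h] M(2)[of v] by (metis image_eqI subsetD)
  qed
  then have N: "finite N" using M(1) finite_surj by blast
  have "\<forall>k\<in>N. \<exists>v. v \<in> V \<and> v \<noteq> 0 \<and> height h v = k" unfolding N_def by auto
  then obtain p where p: "\<And>k. k \<in> N \<Longrightarrow> p k \<in> V \<and> p k \<noteq> 0 \<and> height h (p k) = k" by metis
  define B where "B = p ` N"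
  have inj: "inj_on p N" using p by (intro inj_onI) metis
  have B: "finite B" "B \<subseteq> V" "card B = card N" unfolding B_def using N p card_image[OF inj] by auto
  have key: "a = b" if "v \<in> V" "v' \<in> V" "a \<in> keys v" "b \<in> keys v'" "h a = h b" for v v' a b
    using that M(2) h by (meson inj_onD subsetD)
  have "kv.independent B"
  proof (rule kv.independent_if_scalars_zero[OF B(1)])
    fix f x assume sum0: "(\<Sum>x\<in>B. single 0 (f x) * x) = 0" and x: "x \<in> B"
    show "f x = 0"
    proof (rule ccontr)
      assume fx: "f x \<noteq> 0"
      define N' where "N' = {k \<in> N. f (p k) \<noteq> 0}"
      have N': "finite N'" "N' \<noteq> {}" using N x fx unfolding N'_def B_def by auto
      \<comment> \<open>The highest vector in the dependency: no other vector with nonzero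
        coefficient reaches its top monomial.\<close>
      define k where "k = Max N'"
      have k: "k \<in> N" "f (p k) \<noteq> 0" "\<And>j. j \<in> N \<Longrightarrow> f (p j) \<noteq> 0 \<Longrightarrow> j \<le> k"
        using Max_in[OF N'] Max_ge[OF N'(1)] unfolding k_def N'_def by auto
      obtain a where a: "a \<in> keys (p k)" "h a = k" using height_props(2)[of "p k" h] p[OF k(1)] by auto
      have "f (p j) * lookup (p j) a = 0" if j: "j \<in> N - {k}" for j
      proof (cases "f (p j) = 0")
        case False
        then have "j < k" using k(3)[of j] j by auto
        then have "a \<notin> keys (p j)" using height_props(1)[of "p j" a h] p[of j] j a(2) by auto
        then show ?thesis by (simp add: in_keys_iff)
      qed simp
      then have "(\<Sum>j\<in>N - {k}. f (p j) * lookup (p j) a) = 0" by (intro sum.neutral) auto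
      moreover have "(\<Sum>j\<in>N. f (p j) * lookup (p j) a) = 0"
      proof -
        have "(\<Sum>j\<in>N. single 0 (f (p j)) * p j) = 0" using sum0 unfolding B_def by (simp add: sum.reindex[OF inj])
        then have "lookup (\<Sum>j\<in>N. single 0 (f (p j)) * p j) a = 0" by simp
        then show ?thesis by (simp add: lookup_sum lookup_scale)
      qed
      ultimately have "f (p k) * lookup (p k) a = 0" using sum.remove[OF N k(1), of "\<lambda>j. f (p j) * lookup (p j) a"] by simp
      then show False using k(2) a(1) by (simp add: in_keys_iff)
    qed
  qed
  moreover have "v \<in> kv.span B" if "v \<in> V" for v
    using that
  proof (induction "height h v" arbitrary: v rule: less_induct)
    case less
    show ?case
    proof (cases "v = 0")
      case False
      define k where "k = height h v"
      have kN: "k \<in> N" unfolding N_def k_def using less.prems False by auto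
      obtain a where a: "a \<in> keys v" "h a = k" using height_props(2)[OF False, of h] unfolding k_def by auto
      obtain b where b: "b \<in> keys (p k)" "h b = k" using height_props(2)[of "p k" h] p[OF kN] by auto
      have ab: "b = a" using key[of "p k" v b a] p[OF kN] less.prems a b by auto
      \<comment> \<open>This multiple of \<open>p k\<close> cancels the top monomial of
        \<open>v\<close>, which is the same for both because \<open>h\<close> is injective.\<close>
      define c where "c = lookup v a / lookup (p k) a"
      define v' where "v' = v - single 0 c * p k"
      have v'V: "v' \<in> V" unfolding v'_def using V less.prems p[OF kN] by (intro kv.subspace_diff kv.subspace_scale) auto
      have "lookup v' a = 0" using b(1) unfolding v'_def c_def ab by (simp add: lookup_minus lookup_scale in_keys_iff)
      have "v' \<in> kv.span B"
      proof (cases "v' = 0")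
        case True
        then show ?thesis by (simp add: kv.span_zero)
      next
        case nz: False
        obtain e where e: "e \<in> keys v'" "h e = height h v'" using height_props(2)[OF nz, of h] by auto
        have "e \<noteq> a" using e(1) \<open>lookup v' a = 0\<close> by (auto simp: in_keys_iff)
        have "e \<in> keys v \<or> e \<in> keys (p k)"
          using e(1) unfolding v'_def by (auto simp: in_keys_iff lookup_minus lookup_scale)
        then have "h e \<le> k"
          using height_props(1)[OF False, of e h] height_props(1)[of "p k" e h] p[OF kN] unfolding k_def by auto
        moreover have "h e \<noteq> k" using key[OF v'V less.prems e(1) a(1)] a(2) \<open>e \<noteq> a\<close> by auto
        ultimately have "height h v' < height h v" using e(2) unfolding k_def by simp
        then show ?thesis using less.hyps v'V by blast
      qed
      moreover have "single 0 c * p k \<in> kv.span B"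
        using kN unfolding B_def by (intro kv.span_scale kv.span_base) auto
      ultimately have "v' + single 0 c * p k \<in> kv.span B" by (rule kv.span_add)
      then show ?thesis unfolding v'_def by simp
    qed (simp add: kv.span_zero)
  qed
  ultimately show ?thesis using B unfolding N_def by blast
qed

text \<open>The span of the leading parts has the dimension of \<open>V\<close>, whatever the order: with respect to a linear
  extension of the order, both subspaces have the same heights.\<close>

lemma lead_span_basis:
  fixes V :: "((nat \<Rightarrow>\<^sub>0 nat) \<Rightarrow>\<^sub>0 'k::field) set"
  assumes lt: "monomial_preorder n lt" and V: "kv.subspace V" and M: "finite M" "M \<subseteq> exponents n" "\<And>v. v \<in> V \<Longrightarrow> keys v \<subseteq> M"
  shows "kv.subspace (lead_span lt V)"
    "\<exists>B C. finite B \<and> B \<subseteq> V \<and> kv.independent B \<and> V \<subseteq> kv.span B \<and>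
      finite C \<and> C \<subseteq> lead_span lt V \<and> kv.independent C \<and> lead_span lt V \<subseteq> kv.span C \<and> card C = card B"
proof -
  note P = monomial_preorderD[OF lt]
  have Vp: "V \<subseteq> polys n" using M by (auto simp: polys_def)
  show U: "kv.subspace (lead_span lt V)"
    unfolding kv.subspace_def
    using lead_span.zero lead_span_add lead_span_single_mult[OF lt Vp exponents_zero] kv.subspace_scale[OF V] by blast
  have keysU: "keys x \<subseteq> M" if "x \<in> lead_span lt V" for x using lead_span_keys[OF that M(3)] .
  have "\<exists>h :: (nat \<Rightarrow>\<^sub>0 nat) \<Rightarrow> nat. inj_on h M \<and> (\<forall>a\<in>M. \<forall>b\<in>M. lt a b \<longrightarrow> h a < h b)"
  proof (rule ex_linear_extension[OF M(1)])
    show "\<not> lt a a" if "a \<in> M" for a using P(1) M(2) that by blast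
    show "lt a c" if "a \<in> M" "b \<in> M" "c \<in> M" "lt a b" "lt b c" for a b c
      using P(2)[of a b c] M(2) that by blast
  qed
  then obtain h :: "(nat \<Rightarrow>\<^sub>0 nat) \<Rightarrow> nat" where h: "inj_on h M" "\<And>a b. a \<in> M \<Longrightarrow> b \<in> M \<Longrightarrow> lt a b \<Longrightarrow> h a < h b"
    by blast
  have "height h ` (V - {0}) = height h ` (lead_span lt V - {0})"
  proof
    show "height h ` (V - {0}) \<subseteq> height h ` (lead_span lt V - {0})"
    proof
      fix k assume "k \<in> height h ` (V - {0})"
      then obtain v where v: "v \<in> V" "v \<noteq> 0" "k = height h v" by auto
      obtain a where a: "a \<in> keys v" "h a = k" using height_props(2)[OF v(2), of h] v(3) by auto
      \<comment> \<open>The top monomial for the linear extension is maximal for the order itself,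
        hence it survives in the leading part.\<close>
      have "\<not> lt a b" if "b \<in> keys v" for b
        using h(2)[of a b] height_props(1)[OF v(2) that, of h] a v(3) M(3)[OF v(1)] that by fastforce
      then have al: "a \<in> keys (leading_part lt v)" using a by (simp add: keys_leading_part)
      have "height h (leading_part lt v) = h a"
        by (rule height_eqI[OF al]) (use height_props(1)[OF v(2), of _ h] a v(3) in \<open>auto simp: keys_leading_part\<close>)
      moreover have "leading_part lt v \<noteq> 0" using al by auto
      ultimately show "k \<in> height h ` (lead_span lt V - {0})"
        using lead_span_base[OF v(1)] a(2) by (metis DiffI image_eqI singletonD)
    qed
    show "height h ` (lead_span lt V - {0}) \<subseteq> height h ` (V - {0})"
    proof
      fix k assume "k \<in> height h ` (lead_span lt V - {0})"
      then obtain x where x: "x \<in> lead_span lt V" "x \<noteq> 0" "k = height h x" by auto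
      obtain a where a: "a \<in> keys x" "h a = k" using height_props(2)[OF x(2), of h] x(3) by auto
      have am: "a \<in> M" "a \<in> exponents n" using a keysU[OF x(1)] M(2) by auto
      \<comment> \<open>Conversely, \<open>g\<close> agrees with \<open>x\<close> in the class of
        the top monomial \<open>a\<close> and has nothing above it, so \<open>a\<close> is also the
        top monomial of \<open>g\<close>.\<close>
      obtain g where g: "g \<in> V" "\<forall>b\<in>keys g. \<not> lt a b"
        "\<And>b. b \<in> exponents n \<Longrightarrow> \<not> lt a b \<Longrightarrow> \<not> lt b a \<Longrightarrow> lookup x b = lookup g b"
        using lead_span_class[OF lt Vp kv.subspace_0[OF V] kv.subspace_add[OF V] am(2) x(1)] by blast
      have ag: "a \<in> keys g" using g(3)[OF am(2)] P(1)[OF am(2)] a(1) by (simp add: in_keys_iff)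
      have "h b \<le> h a" if b: "b \<in> keys g" for b
      proof (cases "lt b a")
        case True
        then show ?thesis using h(2)[of b a] am M(3)[OF g(1)] b by fastforce
      next
        case False
        have "b \<in> exponents n" using b M(2) M(3)[OF g(1)] by blast
        then have "b \<in> keys x" using False g(2) g(3)[of b] b by (auto simp: in_keys_iff)
        then show ?thesis using height_props(1)[OF x(2)] a(2) x(3) by auto
      qed
      then have "height h g = k" using height_eqI[OF ag] a(2) by blast
      moreover have "g \<noteq> 0" using ag by auto
      ultimately show "k \<in> height h ` (V - {0})" using g(1) by blast
    qed
  qed
  then show "\<exists>B C. finite B \<and> B \<subseteq> V \<and> kv.independent B \<and> V \<subseteq> kv.span B \<and>
      finite C \<and> C \<subseteq> lead_span lt V \<and> kv.independent C \<and> lead_span lt V \<subseteq> kv.span C \<and> card C = card B"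
    using height_basis[OF V M(1,3) h(1)] height_basis[OF U M(1) keysU h(1)] by metis
qed

text \<open>Both spans have the dimension of \<open>V\<close>, so that an inclusion between them is
  an equality.\<close>

lemma lead_span_maximal:
  fixes V :: "((nat \<Rightarrow>\<^sub>0 nat) \<Rightarrow>\<^sub>0 'k::field) set"
  assumes lt: "monomial_preorder n lt" and lt': "monomial_preorder n lt'" and V: "kv.subspace V"
    and M: "finite M" "M \<subseteq> exponents n" "\<And>v. v \<in> V \<Longrightarrow> keys v \<subseteq> M"
    and sub: "lead_span lt V \<subseteq> lead_span lt' V"
  shows "lead_span lt' V = lead_span lt V"
proof -
  obtain B C where B: "finite B" "B \<subseteq> V" "kv.independent B" "V \<subseteq> kv.span B"
    and C: "finite C" "C \<subseteq> lead_span lt V" "kv.independent C" "card C = card B"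
    using lead_span_basis(2)[OF lt V M] by blast
  obtain B' C' where B': "finite B'" "B' \<subseteq> V" "kv.independent B'" "V \<subseteq> kv.span B'"
    and C': "finite C'" "lead_span lt' V \<subseteq> kv.span C'" "card C' = card B'"
    using lead_span_basis(2)[OF lt' V M] by blast
  have "card B' \<le> card B" using kv.independent_span_bound[OF B(1) B'(3)] B'(2) B(4) by blast
  then have le: "card C' \<le> card C" using C(4) C'(3) by simp
  have "x \<in> lead_span lt V" if x: "x \<in> lead_span lt' V" for x
  proof (rule ccontr)
    assume "x \<notin> lead_span lt V"
    then have "x \<notin> kv.span C" using kv.span_minimal[OF C(2) lead_span_basis(1)[OF lt V M]] by blast
    then have "kv.independent (insert x C)" "x \<notin> C" using C(3) kv.independent_insertI kv.span_base by blast+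
    moreover have "insert x C \<subseteq> kv.span C'" using x C(2) sub C'(2) by blast
    ultimately have "Suc (card C) \<le> card C'"
      using kv.independent_span_bound[OF C'(1), of "insert x C"] C(1) by auto
    then show False using le by simp
  qed
  then show ?thesis using sub by blast
qed

lemma finite_bounded_exponents: "finite {a \<in> exponents n. wdeg n (\<lambda>_. 1) a \<le> d}"
proof -
  have "a \<in> (\<lambda>f. \<Sum>i<n. single i (f i)) ` ({..<n} \<rightarrow>\<^sub>E {..nat d})" if a: "a \<in> exponents n" "wdeg n (\<lambda>_. 1) a \<le> d" for a
  proof
    have "lookup a i \<le> nat d" if "i < n" for i
    proof -
      have "int (lookup a i) \<le> wdeg n (\<lambda>_. 1) a"
        unfolding wdeg_def using that member_le_sum[of i "{..<n}" "\<lambda>i. int (lookup a i)"] by simp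
      then show ?thesis using a(2) by linarith
    qed
    then show "restrict (lookup a) {..<n} \<in> {..<n} \<rightarrow>\<^sub>E {..nat d}" by auto
    have "(\<Sum>i<n. single i (restrict (lookup a) {..<n} i)) = (\<Sum>i<n. single i (lookup a i))" by (rule sum.cong) auto
    then show "a = (\<Sum>i<n. single i (restrict (lookup a) {..<n} i))" using exponents_expand[OF a(1)] by simp
  qed
  then have "{a \<in> exponents n. wdeg n (\<lambda>_. 1) a \<le> d} \<subseteq> (\<lambda>f. \<Sum>i<n. single i (f i)) ` ({..<n} \<rightarrow>\<^sub>E {..nat d})"
    by blast
  then show ?thesis by (rule finite_subset) (auto intro!: finite_imageI finite_PiE)
qed

text \<open>The Rees algebra of the total degree is noetherian, so that finitely many elements of \<open>J\<close> determine the
  leading parts of \<open>J\<close> up to a given total degree, for all degrees at once. An order that agrees on these finitely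
  many elements has at least the same leading parts, and then exactly the same by a count of dimensions.\<close>

lemma ex_support_of_lead_span:
  fixes J :: "((nat \<Rightarrow>\<^sub>0 nat) \<Rightarrow>\<^sub>0 'k::field) set"
  assumes lt: "monomial_preorder n lt" and J: "ideal_on (polys n) J"
  shows "\<exists>K. finite K \<and> K \<subseteq> exponents n \<and> (\<forall>lt'. monomial_preorder n lt' \<longrightarrow>
    (\<forall>a\<in>K. \<forall>b\<in>K. lt' a b \<longleftrightarrow> lt a b) \<longrightarrow> lead_span lt' J = lead_span lt J)"
proof -
  \<comment> \<open>The filtration by total degree: as \<open>M d\<close> is finite, the piece
    \<open>V d\<close> of \<open>J\<close> is finite-dimensional, and dimensions can be
    compared.\<close>
  define M where "M d = {a \<in> exponents n. wdeg n (\<lambda>_. 1) a \<le> d}" for d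
  define V where "V d = {f \<in> J. keys f \<subseteq> M d}" for d
  let ?D = "rees n (\<lambda>_. 1) :: 'k graded set"
  have MD: "F \<in> ?D \<longleftrightarrow> (\<forall>d. keys (lookup F d) \<subseteq> M d)" for F unfolding rees_def M_def by blast
  have Vp: "V d \<subseteq> polys n" for d unfolding V_def using ideal_onD(1)[OF J] by auto
  have V_mult: "single a c * g \<in> V (e + d)" if "g \<in> V d" "a \<in> M e" for g a c e d
  proof -
    have "single a c * g \<in> J" using that ideal_onD(4)[OF J single_polys] unfolding V_def M_def by blast
    moreover have "keys (single a c * g) \<subseteq> M (e + d)"
    proof
      fix x assume "x \<in> keys (single a c * g)"
      then obtain b where "x = a + b" "b \<in> keys g" using keys_mult[of "single a c" g] by (auto split: if_splits)
      then show "x \<in> M (e + d)" using that unfolding V_def M_def by (auto simp: wdeg_add intro: exponents_add add_mono)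
    qed
    ultimately show ?thesis unfolding V_def by simp
  qed
  \<comment> \<open>Generators of the leading ideal of \<open>J\<close> alone would not control the
    degree of the elements of \<open>J\<close> that are used. Collecting the spans of all
    \<open>V d\<close> in one ideal of the Rees algebra lets finitely many generators work for every
    \<open>d\<close>.\<close>
  define U where "U l = {F \<in> ?D. \<forall>d. lookup F d \<in> lead_span l (V d)}" for l
  have U_ideal: "ideal_on ?D (U l)" if l: "monomial_preorder n l" for l
    unfolding ideal_on_def
  proof (intro conjI ballI)
    show "U l \<subseteq> ?D" unfolding U_def by auto
    show "0 \<in> U l" unfolding U_def using subring_onD(1)[OF subring_rees] lead_span.zero by auto
    fix F G :: "'k graded" assume "F \<in> U l" "G \<in> U l"
    then show "F + G \<in> U l" unfolding U_def
      by (auto simp: lookup_add intro!: lead_span_add subring_onD(4)[OF subring_rees])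
  next
    fix F G :: "'k graded" assume F: "F \<in> ?D" and G: "G \<in> U l"
    have "lookup (F * G) d \<in> lead_span l (V d)" for d
      unfolding lookup_mult_group
    proof (rule lead_span_sum)
      fix e
      have "lookup F e * lookup G (d - e) \<in> lead_span l (V (e + (d - e)))"
      proof (rule lead_span_mult[OF l Vp _ V_mult])
        show "M e \<subseteq> exponents n" unfolding M_def by auto
        show "lookup G (d - e) \<in> lead_span l (V (d - e))" using G unfolding U_def by blast
        show "keys (lookup F e) \<subseteq> M e" using F unfolding MD by blast
      qed
      then show "lookup F e * lookup G (d - e) \<in> lead_span l (V d)" by simp
    qed
    then show "F * G \<in> U l" unfolding U_def using subring_onD(5)[OF subring_rees F] G unfolding U_def by auto
  qed
  obtain E where E: "finite E" "E \<subseteq> U lt" "U lt \<subseteq> lincomb ?D E"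
    using noetherian_rees[of n "\<lambda>_. 1"] U_ideal[OF lt] unfolding noetherian_on_def by blast
  have "\<forall>F\<in>E. \<forall>d. \<exists>G. finite G \<and> G \<subseteq> V d \<and> lookup F d \<in> lead_span lt G"
    using E(2) lead_span_finite unfolding U_def by blast
  then obtain G where G: "\<And>F d. F \<in> E \<Longrightarrow> finite (G F d) \<and> G F d \<subseteq> V d \<and> lookup F d \<in> lead_span lt (G F d)"
    by metis
  \<comment> \<open>The monomials of those elements of \<open>J\<close> whose leading parts build
    the generators; an order that agrees on \<open>K\<close> gives these elements the same leading
    parts.\<close>
  define K where "K = (\<Union>F\<in>E. \<Union>d\<in>keys F. \<Union>g\<in>G F d. keys g)"
  have K: "finite K" "K \<subseteq> exponents n"
    unfolding K_def using E(1) G Vp by (auto simp: polys_def) (metis (no_types, lifting) mem_Collect_eq polys_def subsetD)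
  have "lead_span lt' J = lead_span lt J"
    if lt': "monomial_preorder n lt'" and agree: "\<forall>a\<in>K. \<forall>b\<in>K. lt' a b \<longleftrightarrow> lt a b" for lt'
  proof -
    have "E \<subseteq> U lt'"
    proof
      fix F assume F: "F \<in> E"
      have "lookup F d \<in> lead_span lt' (V d)" for d
      proof (cases "d \<in> keys F")
        case True
        then have "keys g \<subseteq> K" if "g \<in> G F d" for g using that F unfolding K_def by blast
        then have "lookup F d \<in> lead_span lt' (G F d)"
          using lead_span_agree[of "lookup F d" lt "G F d" lt'] G[OF F] agree by blast
        then show ?thesis using lead_span_mono[of "G F d" "V d"] G[OF F] by blast
      next
        case False
        then show ?thesis by (simp add: in_keys_iff lead_span.zero)
      qed
      then show "F \<in> U lt'" using F E(2) unfolding U_def by auto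
    qed
    then have UU: "U lt \<subseteq> U lt'" using E(3) lincomb_least[OF U_ideal[OF lt']] by blast
    \<comment> \<open>The component of \<open>U lt\<close> in degree \<open>d\<close> is the span
      for \<open>V d\<close>; there the inclusion becomes an equality by dimension.\<close>
    have eq: "lead_span lt' (V d) = lead_span lt (V d)" for d
    proof (rule lead_span_maximal[OF lt lt'])
      show "kv.subspace (V d)"
        unfolding kv.subspace_def
      proof (intro conjI ballI allI)
        show "0 \<in> V d" unfolding V_def using ideal_onD(2)[OF J] by simp
        fix f g :: "(nat \<Rightarrow>\<^sub>0 nat) \<Rightarrow>\<^sub>0 'k" and c assume f: "f \<in> V d"
        show "single 0 c * f \<in> V d" using V_mult[OF f, of 0 0 c] by (simp add: M_def exponents_zero)
        assume "g \<in> V d"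
        then show "f + g \<in> V d" using f ideal_onD(3)[OF J] keys_add[of f g] unfolding V_def by auto
      qed
      show "finite (M d)" "M d \<subseteq> exponents n" unfolding M_def using finite_bounded_exponents by auto
      show "keys v \<subseteq> M d" if "v \<in> V d" for v using that by (simp add: V_def)
      show "lead_span lt (V d) \<subseteq> lead_span lt' (V d)"
      proof
        fix x assume x: "x \<in> lead_span lt (V d)"
        have "keys x \<subseteq> M d" by (rule lead_span_keys[OF x]) (simp add: V_def)
        then have "single d x \<in> U lt"
          unfolding U_def MD using x by (auto simp: lookup_single when_def lead_span.zero)
        then have "single d x \<in> U lt'" using UU by blast
        then have "lookup (single d x) d \<in> lead_span lt' (V d)" unfolding U_def by blast
        then show "x \<in> lead_span lt' (V d)" by simp
      qed
    qed
    have bound: "\<exists>d. g \<in> V d" if g: "g \<in> J" for g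
    proof -
      define d where "d = Max (insert 0 (wdeg n (\<lambda>_. 1) ` keys g))"
      have "wdeg n (\<lambda>_. 1) a \<le> d" if "a \<in> keys g" for a unfolding d_def using that by (intro Max_ge) auto
      then have "g \<in> V d" unfolding V_def M_def using g ideal_onD(1)[OF J] by (auto simp: polys_def)
      then show ?thesis ..
    qed
    have VJ: "lead_span l (V d) \<subseteq> lead_span l J" for l d by (rule lead_span_mono) (auto simp: V_def)
    have inc: "lead_span l J \<subseteq> lead_span l' J" if "\<And>d. lead_span l (V d) \<subseteq> lead_span l' (V d)" for l l'
    proof
      fix x assume x: "x \<in> lead_span l J"
      show "x \<in> lead_span l' J"
      proof (rule lead_span_least[OF x lead_span.zero _ lead_span_add])
        fix g assume "g \<in> J"
        then obtain d where "g \<in> V d" using bound by blast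
        then have "leading_part l g \<in> lead_span l' (V d)" using lead_span_base that by blast
        then show "leading_part l g \<in> lead_span l' J" using VJ by blast
      qed
    qed
    show ?thesis using inc[of lt' lt] inc[of lt lt'] eq by blast
  qed
  then show ?thesis using K by blast
qed

section \<open>Weights that represent a preorder on finitely many monomials\<close>

definition wlt :: "nat \<Rightarrow> (nat \<Rightarrow> int) \<Rightarrow> (nat \<Rightarrow>\<^sub>0 nat) \<Rightarrow> (nat \<Rightarrow>\<^sub>0 nat) \<Rightarrow> bool" where
  "wlt n w a b \<longleftrightarrow> wdeg n w a < wdeg n w b"

lemma monomial_preorder_wlt: "monomial_preorder n (wlt n w)"
  unfolding monomial_preorder_def weak_order_on_def
proof (intro conjI ballI)
  show "equiv (exponents n) {(x, y). x \<in> exponents n \<and> y \<in> exponents n \<and> \<not> wlt n w x y \<and> \<not> wlt n w y x}"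
    by (intro equivI refl_onI symI transI) (auto simp: wlt_def)
qed (auto simp: wlt_def wdeg_add irreflp_on_def transp_on_def)

text \<open>The differences \<open>b - a\<close> with \<open>lt a b\<close> form the strict cone of
  the elimination, those with \<open>\<not> lt b a\<close> the weak one; irreflexivity keeps 0 out
  of the strict cone. This gives a rational weight for finitely many comparisons, and clearing
  denominators by a positive factor preserves the signs.\<close>

lemma ex_weight:
  assumes lt: "monomial_preorder n lt" and K: "finite K" "K \<subseteq> exponents n"
  shows "\<exists>w. \<forall>a\<in>K. \<forall>b\<in>K. wlt n w a b \<longleftrightarrow> lt a b"
proof -
  note M = monomial_preorderD[OF lt] and A = monomial_preorder_add[OF lt _ _ _ _ exponents_add]
  define df where "df a b = (\<lambda>i. int (lookup b i) - int (lookup a i))" for a b :: "nat \<Rightarrow>\<^sub>0 nat"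
  define Ps where "Ps v \<longleftrightarrow> (\<exists>a\<in>exponents n. \<exists>b\<in>exponents n. lt a b \<and> v = df a b)" for v
  define Pw where "Pw v \<longleftrightarrow> (\<exists>a\<in>exponents n. \<exists>b\<in>exponents n. \<not> lt b a \<and> v = df a b)" for v
  have df_add: "(\<lambda>i. df a b i + df c d i) = df (a + c) (b + d)" for a b c d
    by (auto simp: df_def lookup_add)
  have imp: "\<not> lt b a" if "lt a b" "a \<in> exponents n" "b \<in> exponents n" for a b
    using M(1)[of a] M(2)[of a b a] that by blast
  define S where "S = {df a b |a b. a \<in> K \<and> b \<in> K \<and> lt a b}"
  define W where "W = {df a b |a b. a \<in> K \<and> b \<in> K \<and> \<not> lt b a}"
  have "S \<subseteq> case_prod df ` (K \<times> K)" "W \<subseteq> case_prod df ` (K \<times> K)" unfolding S_def W_def by auto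
  then have fin: "finite S" "finite W" using K(1) by (meson finite_SigmaI finite_imageI finite_subset)+
  have "\<exists>w :: nat \<Rightarrow> rat. (\<forall>v\<in>S. (\<Sum>i<n. w i * of_int (v i)) > 0) \<and> (\<forall>v\<in>W. (\<Sum>i<n. w i * of_int (v i)) \<ge> 0)"
  proof (rule fourier_motzkin[of Ps Pw])
    fix u v
    show "Ps (\<lambda>i. u i + v i)" if uv: "Ps u" "Pw v"
    proof -
      obtain a b c d where m: "a \<in> exponents n" "b \<in> exponents n" "c \<in> exponents n" "d \<in> exponents n"
        and r: "lt a b" "\<not> lt d c" and e: "u = df a b" "v = df c d" using uv unfolding Ps_def Pw_def by blast
      then have "lt (a + c) (b + d)" using A(1)[OF m] by blast
      then show ?thesis using exponents_add[OF m(1,3)] exponents_add[OF m(2,4)] unfolding Ps_def e df_add by blast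
    qed
    show "Pw (\<lambda>i. u i + v i)" if uv: "Pw u" "Pw v"
    proof -
      obtain a b c d where m: "a \<in> exponents n" "b \<in> exponents n" "c \<in> exponents n" "d \<in> exponents n"
        and r: "\<not> lt b a" "\<not> lt d c" and e: "u = df a b" "v = df c d" using uv unfolding Pw_def by blast
      then have "\<not> lt (b + d) (a + c)" using A(2)[OF m] by blast
      then show ?thesis using exponents_add[OF m(1,3)] exponents_add[OF m(2,4)] unfolding Pw_def e df_add by blast
    qed
    show "Ps (\<lambda>i. u i + v i)" if uv: "Ps u" "Ps v"
    proof -
      obtain a b c d where m: "a \<in> exponents n" "b \<in> exponents n" "c \<in> exponents n" "d \<in> exponents n"
        and r: "lt a b" "lt c d" and e: "u = df a b" "v = df c d" using uv unfolding Ps_def by blast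
      then have "lt (a + c) (b + d)" using A(1)[OF m] imp[OF r(2) m(3,4)] by blast
      then show ?thesis using exponents_add[OF m(1,3)] exponents_add[OF m(2,4)] unfolding Ps_def e df_add by blast
    qed
  next
    show "\<not> Ps (\<lambda>_. 0)"
    proof
      assume "Ps (\<lambda>_. 0)"
      then obtain a b where ab: "a \<in> exponents n" "lt a b" "(\<lambda>_. 0) = df a b" unfolding Ps_def by blast
      have "lookup a i = lookup b i" for i using fun_cong[OF ab(3), of i] by (simp add: df_def)
      then have "a = b" by (rule poly_mapping_eqI)
      then show False using ab M(1) by blast
    qed
    show "Ps v" if "v \<in> S" for v using that K(2) unfolding S_def Ps_def by blast
    show "Pw v" if "v \<in> W" for v using that K(2) unfolding W_def Pw_def by blast
    show "v i = 0" if v: "v \<in> S \<union> W" and i: "n \<le> i" for v i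
    proof -
      have "lookup a i = 0" if "a \<in> K" for a
      proof -
        have "keys a \<subseteq> {..<n}" using that K(2) by (auto simp: exponents_def)
        then show ?thesis using i by (metis in_keys_iff leD lessThan_iff subsetD)
      qed
      then show ?thesis using v unfolding S_def W_def df_def by auto
    qed
  qed (use fin in auto)
  then obtain w :: "nat \<Rightarrow> rat" where w: "\<And>v. v \<in> S \<Longrightarrow> (\<Sum>i<n. w i * of_int (v i)) > 0"
    "\<And>v. v \<in> W \<Longrightarrow> (\<Sum>i<n. w i * of_int (v i)) \<ge> 0" by blast
  obtain c w' where c: "c > 0" "\<forall>i<n. of_int (w' i) = (of_int c * w i :: rat)"
    using common_denominator_rat[of n w] by blast
  have scaled: "of_int (\<Sum>i<n. w' i * v i) = (of_int c * (\<Sum>i<n. w i * of_int (v i)) :: rat)" for v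
    using c(2) by (simp add: sum_distrib_left mult.assoc)
  have diff: "wdeg n w' b - wdeg n w' a = (\<Sum>i<n. w' i * df a b i)" for a b
    by (simp add: wdeg_def df_def algebra_simps sum_subtractf)
  have pos: "wdeg n w' a < wdeg n w' b" if "a \<in> K" "b \<in> K" "lt a b" for a b
  proof -
    have "(0 :: rat) < of_int (\<Sum>i<n. w' i * df a b i)"
      unfolding scaled using w(1) c(1) that unfolding S_def by (intro mult_pos_pos) auto
    then have "0 < (\<Sum>i<n. w' i * df a b i)" by (simp only: of_int_0_less_iff)
    then show ?thesis using diff[of b a] by linarith
  qed
  have nonneg: "wdeg n w' a \<le> wdeg n w' b" if "a \<in> K" "b \<in> K" "\<not> lt b a" for a b
  proof -
    have "(0 :: rat) \<le> of_int (\<Sum>i<n. w' i * df a b i)"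
      unfolding scaled using w(2) c(1) that unfolding W_def by (intro mult_nonneg_nonneg) auto
    then have "0 \<le> (\<Sum>i<n. w' i * df a b i)" by (simp only: of_int_0_le_iff)
    then show ?thesis using diff[of b a] by linarith
  qed
  \<comment> \<open>The strict condition covers \<open>lt a b\<close>; otherwise the weak condition
    for the exchanged pair excludes \<open>wlt n w' a b\<close>.\<close>
  have "wlt n w' a b \<longleftrightarrow> lt a b" if "a \<in> K" "b \<in> K" for a b
    using pos[OF that] nonneg[OF that(2,1)] unfolding wlt_def by (cases "lt a b") auto
  then show ?thesis by blast
qed

section \<open>The degeneration\<close>

text \<open>A finitely supported map is encoded by its finite graph on the support, and an infinite
  set has as many finite subsets as elements.\<close>

lemma poly_mapping_lepoll:
  assumes u: "infinite (UNIV :: 'u set)"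
    and a: "(UNIV :: 'a set) \<lesssim> (UNIV :: 'u set)" and b: "(UNIV :: 'b::zero set) \<lesssim> (UNIV :: 'u set)"
  shows "(UNIV :: ('a \<Rightarrow>\<^sub>0 'b) set) \<lesssim> (UNIV :: 'u set)"
proof -
  obtain i :: "'a \<Rightarrow> 'u" and j :: "'b \<Rightarrow> 'u" where ij: "inj i" "inj j"
    using a b unfolding lepoll_def by auto
  define g where "g p = (\<lambda>x. (i x, j (lookup p x))) ` keys p" for p :: "'a \<Rightarrow>\<^sub>0 'b"
  have g: "(i x, y) \<in> g p \<longleftrightarrow> x \<in> keys p \<and> y = j (lookup p x)" for x y p
    unfolding g_def using ij(1) by (auto dest: injD)
  have "inj g"
  proof (rule injI, rule poly_mapping_eqI)
    fix p q x assume eq: "g p = g q"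
    show "lookup p x = lookup q x"
    proof (cases "x \<in> keys p \<or> x \<in> keys q")
      case True
      then obtain y where "(i x, y) \<in> g p" using g eq by metis
      then have "y = j (lookup p x)" "y = j (lookup q x)" using g eq by metis+
      then show ?thesis using ij(2) by (metis injD)
    qed (simp add: in_keys_iff)
  qed
  moreover have "range g \<subseteq> Fpow (UNIV :: ('u \<times> 'u) set)" unfolding g_def Fpow_def by auto
  ultimately have "(UNIV :: ('a \<Rightarrow>\<^sub>0 'b) set) \<lesssim> Fpow (UNIV :: ('u \<times> 'u) set)" unfolding lepoll_def by blast
  moreover have "Fpow (UNIV :: ('u \<times> 'u) set) \<approx> (UNIV :: ('u \<times> 'u) set)"
  proof -
    have "infinite (UNIV :: ('u \<times> 'u) set)" using u by (simp add: finite_prod)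
    then show ?thesis unfolding eqpoll_iff_card_of_ordIso by (rule card_of_Fpow_infinite)
  qed
  moreover have "(UNIV :: ('u \<times> 'u) set) \<approx> (UNIV :: 'u set)"
    using card_of_Times_same_infinite[OF u] by (simp add: eqpoll_iff_card_of_ordIso)
  ultimately show ?thesis by (meson eqpoll_imp_lepoll lepoll_trans)
qed

lemma graded_lepoll:
  assumes u: "infinite (UNIV :: 'u set)" "(UNIV :: 'k::field set) \<lesssim> (UNIV :: 'u set)"
  shows "(UNIV :: ((nat \<Rightarrow>\<^sub>0 nat) \<Rightarrow>\<^sub>0 'k) set) \<lesssim> (UNIV :: 'u set)" "(UNIV :: 'k graded set) \<lesssim> (UNIV :: 'u set)"
proof -
  have nat: "(UNIV :: nat set) \<lesssim> (UNIV :: 'u set)" using u(1) infinite_le_lepoll by blast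
  have "(UNIV :: int set) \<lesssim> (UNIV :: nat set)" unfolding lepoll_def by (metis inj_to_nat top_greatest)
  then have int: "(UNIV :: int set) \<lesssim> (UNIV :: 'u set)" using nat lepoll_trans by blast
  show p: "(UNIV :: ((nat \<Rightarrow>\<^sub>0 nat) \<Rightarrow>\<^sub>0 'k) set) \<lesssim> (UNIV :: 'u set)"
    by (intro poly_mapping_lepoll[OF u(1)] nat u(2))
  show "(UNIV :: 'k graded set) \<lesssim> (UNIV :: 'u set)" by (intro poly_mapping_lepoll[OF u(1)] int p)
qed

lemma lepoll_UNIV_subset: "(UNIV :: 'a set) \<lesssim> B \<Longrightarrow> A \<lesssim> B" for A :: "'a set"
  by (meson lepoll_trans subset_UNIV subset_imp_lepoll)

text \<open>In a noetherian ring the union of a nonempty chain of ideals belongs to the chain, so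
  Zorn's lemma applies to the proper ideals above \<open>I\<close>.\<close>

lemma (in noetherian_ring) ex_prime_ideal_above:
  assumes "cring R" "ideal I R" "\<one> \<notin> I"
  shows "\<exists>Q. primeideal Q R \<and> I \<subseteq> Q"
proof -
  define A where "A = {I'. ideal I' R \<and> I \<subseteq> I' \<and> \<one> \<notin> I'}"
  have "\<exists>M\<in>A. \<forall>X\<in>A. M \<subseteq> X \<longrightarrow> X = M"
  proof (rule subset_Zorn_nonempty)
    show "A \<noteq> {}" unfolding A_def using assms by blast
    fix C assume C: "C \<noteq> {}" "subset.chain A C"
    then have "subset.chain {I. ideal I R} C" unfolding A_def pred_on.chain_def by auto
    then have "\<Union>C \<in> C" using ideal_chain_is_trivial C(1) by blast
    then show "\<Union>C \<in> A" using C(2) unfolding pred_on.chain_def by blast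
  qed
  then obtain M where M: "M \<in> A" "\<And>X. X \<in> A \<Longrightarrow> M \<subseteq> X \<Longrightarrow> X = M" by blast
  have "maximalideal M R"
  proof (rule maximalidealI)
    show "ideal M R" using M(1) unfolding A_def by blast
    show "carrier R \<noteq> M" using M(1) unfolding A_def by auto
    fix X assume X: "ideal X R" "M \<subseteq> X" "X \<subseteq> carrier R"
    show "X = M \<or> X = carrier R"
    proof (cases "\<one> \<in> X")
      case True
      then show ?thesis using ideal.one_imp_carrier[OF X(1)] by blast
    next
      case False
      then have "X \<in> A" using X M(1) unfolding A_def by blast
      then show ?thesis using M(2) X(2) by blast
    qed
  qed
  then have "primeideal M R" by (rule cring.maximalideal_prime[OF assms(1)])
  then show ?thesis using M(1) unfolding A_def by blast
qed

text \<open>The variant of \<open>local_ring_at_surj\<close> that starts from a prime of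
  \<open>A\<close> and takes its image in \<open>B\<close>.\<close>

lemma local_ring_at_surj_image:
  assumes A: "cring A" and B: "cring B" and h: "h \<in> ring_hom A B" "h ` carrier A = carrier B"
    and P: "primeideal P A" and ker: "\<forall>a\<in>carrier A. h a = \<zero>\<^bsub>B\<^esub> \<longleftrightarrow> a \<in> J" and J: "J \<subseteq> P"
  shows "primeideal (h ` P) B"
    "local_ring_at A J P ((\<lambda>a. frac B (carrier B - h ` P) a \<one>\<^bsub>B\<^esub>) \<circ> h) (localization_at B (h ` P))"
proof -
  have ker': "a \<in> P" if "a \<in> carrier A" "h a = \<zero>\<^bsub>B\<^esub>" for a using that ker J by blast
  show P': "primeideal (h ` P) B" by (rule primeideal_image_surj(1)[OF A B h P ker'])
  have vim: "{a \<in> carrier A. h a \<in> h ` P} = P" by (rule primeideal_image_surj(2)[OF A B h P ker'])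
  have "J \<subseteq> carrier A" using J ideal.Icarr[OF primeideal.axioms(1)[OF P]] by blast
  then have "{a \<in> carrier A. h a = \<zero>\<^bsub>B\<^esub>} = J" using ker by blast
  then show "local_ring_at A J P ((\<lambda>a. frac B (carrier B - h ` P) a \<one>\<^bsub>B\<^esub>) \<circ> h) (localization_at B (h ` P))"
    using local_ring_at_surj[OF A B h P'] vim by simp
qed

lemma quotient_map:
  assumes "cring A" "ideal J A"
  shows "cring (A Quot J)" "(+>\<^bsub>A\<^esub>) J \<in> ring_hom A (A Quot J)" "(+>\<^bsub>A\<^esub>) J ` carrier A = carrier (A Quot J)"
    "\<forall>a\<in>carrier A. J +>\<^bsub>A\<^esub> a = \<zero>\<^bsub>A Quot J\<^esub> \<longleftrightarrow> a \<in> J"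
proof -
  interpret J: ideal J A by fact
  show "cring (A Quot J)" by (rule J.quotient_is_cring[OF assms(1)])
  show "(+>\<^bsub>A\<^esub>) J \<in> ring_hom A (A Quot J)" by (rule J.rcos_ring_hom)
  show "(+>\<^bsub>A\<^esub>) J ` carrier A = carrier (A Quot J)" unfolding FactRing_def A_RCOSETS_def' by auto
  show "\<forall>a\<in>carrier A. J +>\<^bsub>A\<^esub> a = \<zero>\<^bsub>A Quot J\<^esub> \<longleftrightarrow> a \<in> J"
    using J.a_rcos_const J.rcos_const_imp_mem by (auto simp: FactRing_def)
qed

section \<open>Polynomials in one variable over \<open>k[X]\<close> inside the Laurent ring\<close>

lemma finsum_ring_on:
  assumes "subring_on C" "f ` A \<subseteq> C" "finite A"
  shows "finsum (ring_on C) f A = sum f A"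
proof -
  interpret cring "ring_on C" by (rule cring_ring_on[OF assms(1)])
  show ?thesis
    using assms(3,2)
  proof (induction A rule: finite_induct)
    case (insert x F)
    then have "f \<in> F \<rightarrow> carrier (ring_on C)" "f x \<in> carrier (ring_on C)" by auto
    from finsum_insert[OF insert.hyps this] insert show ?case by simp
  qed simp
qed

text \<open>\<open>UP\<close>, in which (F1) is stated, represents \<open>k[X][T]\<close> by
  functions on the natural numbers, the Laurent ring by finitely supported maps on the integers;
  negative exponents get the coefficient 0.\<close>

definition poly_to_laurent :: "(nat \<Rightarrow> ((nat \<Rightarrow>\<^sub>0 nat) \<Rightarrow>\<^sub>0 'k::field)) \<Rightarrow> 'k graded" where
  "poly_to_laurent f = Abs_poly_mapping (\<lambda>d. if d \<ge> 0 then f (nat d) else 0)"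

lemma UP_ring_on_iff:
  "f \<in> carrier (UP (ring_on C)) \<longleftrightarrow> (\<forall>i. f i \<in> C) \<and> (\<exists>N. \<forall>i>N. f i = 0)"
  by (auto simp: UP_def up_def bound_def)

lemma coeff_UP_ring_on: "f \<in> carrier (UP A) \<Longrightarrow> coeff (UP A) f i = f i"
  by (simp add: UP_def)

lemma lookup_poly_to_laurent:
  assumes "f \<in> carrier (UP (ring_on C))"
  shows "lookup (poly_to_laurent f) d = (if d \<ge> 0 then f (nat d) else 0)"
proof -
  obtain N where N: "\<forall>i>N. f i = 0" using assms by (auto simp: UP_ring_on_iff)
  have "d \<in> {0..int N}" if "(if d \<ge> 0 then f (nat d) else 0) \<noteq> 0" for d
    using that N by (auto split: if_splits) (metis nat_le_iff not_le)
  then have "{d. (if d \<ge> 0 then f (nat d) else 0) \<noteq> 0} \<subseteq> {0..int N}" by blast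
  then have "finite {d. (if d \<ge> 0 then f (nat d) else 0) \<noteq> 0}" by (rule finite_subset) simp
  then show ?thesis unfolding poly_to_laurent_def by simp
qed

lemma poly_to_laurent_hom:
  "poly_to_laurent \<in> ring_hom (UP (ring_on (polys n))) (ring_on (laurent n :: 'k::field graded set))"
proof -
  let ?R = "ring_on (polys n :: ((nat \<Rightarrow>\<^sub>0 nat) \<Rightarrow>\<^sub>0 'k) set)"
  note S = subring_onD[OF subring_polys[where 'k = 'k, of n]]
  have cr: "cring ?R" by (rule cring_ring_on[OF subring_polys])
  interpret U: UP_cring ?R "UP ?R" using UP_cringI[OF cr] .
  show ?thesis
  proof (rule ring_hom_memI)
    fix f assume f: "f \<in> carrier (UP ?R)"
    then have fc: "f i \<in> polys n" for i by (simp add: UP_ring_on_iff)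
    show "poly_to_laurent f \<in> carrier (ring_on (laurent n))"
      using fc S(1) by (simp add: laurent_def lookup_poly_to_laurent[OF f])
    fix g assume g: "g \<in> carrier (UP ?R)"
    then have gc: "g i \<in> polys n" for i by (simp add: UP_ring_on_iff)
    have fg: "f \<otimes>\<^bsub>UP ?R\<^esub> g \<in> carrier (UP ?R)" "f \<oplus>\<^bsub>UP ?R\<^esub> g \<in> carrier (UP ?R)" using f g by auto
    have add: "(f \<oplus>\<^bsub>UP ?R\<^esub> g) i = f i + g i" for i
      using U.coeff_add[OF f g, of i] by (simp add: coeff_UP_ring_on f g fg)
    have mult: "(f \<otimes>\<^bsub>UP ?R\<^esub> g) i = (\<Sum>j\<le>i. f j * g (i - j))" for i
      using U.coeff_mult[OF f g, of i] finsum_ring_on[OF subring_polys, of "\<lambda>j. f j * g (i - j)" "{..i}" n] S(5) fc gc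
      by (simp add: coeff_UP_ring_on f g fg image_subset_iff)
    have "poly_to_laurent (f \<oplus>\<^bsub>UP ?R\<^esub> g) = poly_to_laurent f + poly_to_laurent g"
      by (rule poly_mapping_eqI) (simp add: lookup_add lookup_poly_to_laurent[OF f] lookup_poly_to_laurent[OF g] lookup_poly_to_laurent[OF fg(2)] add)
    then show "poly_to_laurent (f \<oplus>\<^bsub>UP ?R\<^esub> g) = poly_to_laurent f \<oplus>\<^bsub>ring_on (laurent n)\<^esub> poly_to_laurent g" by simp
    have "poly_to_laurent (f \<otimes>\<^bsub>UP ?R\<^esub> g) = poly_to_laurent f * poly_to_laurent g"
    proof (rule poly_mapping_eqI)
      fix d
      let ?h = "\<lambda>e. lookup (poly_to_laurent f) e * lookup (poly_to_laurent g) (d - e)"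
      have "lookup (poly_to_laurent f * poly_to_laurent g) d = (\<Sum>e\<in>keys (poly_to_laurent f). ?h e)"
        by (rule lookup_mult_group)
      \<comment> \<open>Outside the interval one of the exponents \<open>e\<close> and
        \<open>d - e\<close> is negative, so the product vanishes; for negative \<open>d\<close> the
        interval is empty.\<close>
      also have "\<dots> = (\<Sum>e\<in>{0..d}. ?h e)"
        by (rule sum.mono_neutral_cong)
          (auto simp: in_keys_iff lookup_poly_to_laurent[OF f] lookup_poly_to_laurent[OF g] split: if_splits)
      also have "\<dots> = lookup (poly_to_laurent (f \<otimes>\<^bsub>UP ?R\<^esub> g)) d"
      proof (cases "d \<ge> 0")
        case True
        have "{0..d} = int ` {..nat d}" using True by (auto simp: image_iff) (metis atMost_iff nat_0_le nat_mono)
        then have "(\<Sum>e\<in>{0..d}. ?h e) = (\<Sum>j\<le>nat d. ?h (int j))" by (simp add: sum.reindex)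
        also have "\<dots> = (\<Sum>j\<le>nat d. f j * g (nat d - j))"
          by (rule sum.cong) (use True in \<open>auto simp: lookup_poly_to_laurent[OF f] lookup_poly_to_laurent[OF g] nat_diff_distrib\<close>)
        finally show ?thesis using True by (simp add: lookup_poly_to_laurent[OF fg(1)] mult)
      qed (simp add: lookup_poly_to_laurent[OF fg(1)])
      finally show "lookup (poly_to_laurent (f \<otimes>\<^bsub>UP ?R\<^esub> g)) d = lookup (poly_to_laurent f * poly_to_laurent g) d" by simp
    qed
    then show "poly_to_laurent (f \<otimes>\<^bsub>UP ?R\<^esub> g) = poly_to_laurent f \<otimes>\<^bsub>ring_on (laurent n)\<^esub> poly_to_laurent g" by simp
  next
    have "\<one>\<^bsub>UP ?R\<^esub> i = (if i = 0 then 1 else 0)" for i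
      using U.coeff_one[of i] unfolding coeff_UP_ring_on[OF U.UP_one_closed] by (simp only: ring_on_simps)
    then show "poly_to_laurent \<one>\<^bsub>UP ?R\<^esub> = \<one>\<^bsub>ring_on (laurent n)\<^esub>"
      by (auto intro!: poly_mapping_eqI simp: lookup_poly_to_laurent[OF U.UP_one_closed] lookup_one when_def)
  qed
qed

lemma laurent_eq_poly_to_laurent:
  assumes F: "F \<in> laurent n" "\<forall>d\<in>keys F. d \<ge> 0"
  shows "\<exists>f\<in>carrier (UP (ring_on (polys n))). poly_to_laurent f = (F :: 'k::field graded)"
proof
  let ?f = "\<lambda>i. lookup F (int i)"
  have "lookup F (int i) = 0" if "i > nat (Max (insert 0 (keys F)))" for i
  proof (rule ccontr)
    assume "lookup F (int i) \<noteq> 0"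
    then have "int i \<le> Max (insert 0 (keys F))" by (intro Max_ge) (auto simp: in_keys_iff)
    then show False using that by linarith
  qed
  then show f: "?f \<in> carrier (UP (ring_on (polys n)))"
    unfolding UP_ring_on_iff using F(1) by (auto simp: laurent_def)
  show "poly_to_laurent ?f = F"
    by (rule poly_mapping_eqI) (use F(2) in \<open>auto simp: lookup_poly_to_laurent[OF f] in_keys_iff\<close>)
qed

text \<open>\<open>T\<close> is a unit of the Laurent ring, hence outside the extended prime, and a
  power of \<open>T\<close> turns a Laurent element into a polynomial. So \<open>k[X][T]\<close> and
  the Laurent ring have the same local ring at the extension of \<open>P\<close>.\<close>

lemma local_ring_at_laurent_UP:
  fixes J P :: "((nat \<Rightarrow>\<^sub>0 nat) \<Rightarrow>\<^sub>0 'k::field) set"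
  assumes J: "ideal_on (polys n) J"
    and L: "local_ring_at (ring_on (laurent n)) (coeffs_in (laurent n) J) (coeffs_in (laurent n) P) \<psi> L"
  shows "local_ring_at (UP (ring_on (polys n))) (poly_ideal (ring_on (polys n)) J) (poly_ideal (ring_on (polys n)) P)
    (\<psi> \<circ> poly_to_laurent) (L :: ('c, 'd) ring_scheme)"
proof -
  let ?R = "ring_on (polys n :: ((nat \<Rightarrow>\<^sub>0 nat) \<Rightarrow>\<^sub>0 'k) set)"
  have cr: "cring ?R" by (rule cring_ring_on[OF subring_polys])
  interpret U: UP_cring ?R "UP ?R" using UP_cringI[OF cr] .
  have prime: "primeideal (coeffs_in (laurent n) P) (ring_on (laurent n))" using L by (simp add: local_ring_at_def)
  have sets: "{f \<in> carrier (UP ?R). poly_to_laurent f \<in> coeffs_in (laurent n) K} = poly_ideal ?R K" if "0 \<in> K" for K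
  proof -
    have "poly_to_laurent f \<in> coeffs_in (laurent n) K \<longleftrightarrow> (\<forall>i. coeff (UP ?R) f i \<in> K)" if f: "f \<in> carrier (UP ?R)" for f
    proof -
      have "poly_to_laurent f \<in> laurent n" using ring_hom_closed[OF poly_to_laurent_hom f] by simp
      then show ?thesis
        using \<open>0 \<in> K\<close> unfolding coeffs_in_def coeff_UP_ring_on[OF f]
        by (auto simp: lookup_poly_to_laurent[OF f]) (metis nat_int of_nat_0_le_iff)
    qed
    then show ?thesis unfolding poly_ideal_def by blast
  qed
  have zeroP: "0 \<in> P"
    using prime unfolding primeideal_ring_on_iff[OF subring_laurent] ideal_on_def coeffs_in_def by (auto dest: spec[of _ 0])
  have "\<exists>e\<in>carrier (UP ?R). \<exists>b\<in>carrier (UP ?R). poly_to_laurent e \<notin> coeffs_in (laurent n) P \<and>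
      poly_to_laurent e \<otimes>\<^bsub>ring_on (laurent n)\<^esub> a = poly_to_laurent b" if a: "a \<in> carrier (ring_on (laurent n))" for a
  proof -
    obtain m where m: "\<forall>d\<in>keys (single (int m) 1 * a). d \<ge> 0" using laurent_shift_nonneg[of a] by blast
    have T: "single (int m) 1 \<in> laurent n" using subring_onD(1,2)[OF subring_polys] by (auto simp: laurent_def lookup_single when_def)
    have "\<forall>d\<in>keys (single (int m) 1). d \<ge> 0" by auto
    then obtain e where e: "e \<in> carrier (UP ?R)" "poly_to_laurent e = single (int m) 1"
      using laurent_eq_poly_to_laurent[OF T] by blast
    have "single (int m) 1 * a \<in> laurent n" using subring_onD(5)[OF subring_laurent T] a by simp
    then obtain b where b: "b \<in> carrier (UP ?R)" "poly_to_laurent b = single (int m) 1 * a"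
      using laurent_eq_poly_to_laurent m by blast
    have "single (int m) 1 \<notin> coeffs_in (laurent n) P"
    proof
      assume c: "single (int m) 1 \<in> coeffs_in (laurent n) P"
      have T': "single (- int m) 1 \<in> laurent n" using subring_onD(1,2)[OF subring_polys] by (auto simp: laurent_def lookup_single when_def)
      have "single (- int m) 1 * single (int m) 1 \<in> coeffs_in (laurent n) P"
        using prime T' c unfolding primeideal_ring_on_iff[OF subring_laurent] ideal_on_def by blast
      then show False using prime unfolding primeideal_ring_on_iff[OF subring_laurent] by (simp add: mult_single)
    qed
    then have "poly_to_laurent e \<notin> coeffs_in (laurent n) P \<and> poly_to_laurent e \<otimes>\<^bsub>ring_on (laurent n)\<^esub> a = poly_to_laurent b"
      using e(2) b(2) by simp
    then show ?thesis using e(1) b(1) by blast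
  qed
  moreover have "ideal (coeffs_in (laurent n) J) (ring_on (laurent n))"
    using ideal_ring_on_iff[OF subring_laurent] ideal_coeffs_in_laurent[OF J] by blast
  ultimately show ?thesis
    using local_ring_at_restrict[OF L _ U.UP_cring poly_to_laurent_hom] sets[OF ideal_onD(2)[OF J]] sets[OF zeroP]
    by simp
qed

text \<open>The same comparison for the Rees algebra. With \<open>local_ring_at_laurent_UP\<close>
  it identifies the local ring at the homogenization of \<open>P\<close>, which openness reaches,
  with the one at \<open>P[T]\<close>, to which (F1) applies.\<close>

lemma local_ring_at_laurent_rees:
  assumes J: "ideal_on (polys n) J"
    and L: "local_ring_at (ring_on (laurent n)) (coeffs_in (laurent n) J) (coeffs_in (laurent n) P) \<psi> L"
  shows "local_ring_at (ring_on (rees n w)) (coeffs_in (rees n w) J) (coeffs_in (rees n w) P) \<psi> (L :: ('c, 'd) ring_scheme)"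
proof -
  have prime: "primeideal (coeffs_in (laurent n) P) (ring_on (laurent n))" using L by (simp add: local_ring_at_def)
  have sets: "{F \<in> carrier (ring_on (rees n w)). id F \<in> coeffs_in (laurent n) K} = coeffs_in (rees n w) K" for K
    using rees_laurent by (auto simp: coeffs_in_def)
  have hom: "id \<in> ring_hom (ring_on (rees n w)) (ring_on (laurent n))"
    using rees_laurent by (intro ring_hom_memI) auto
  have "\<exists>e\<in>carrier (ring_on (rees n w)). \<exists>b\<in>carrier (ring_on (rees n w)). id e \<notin> coeffs_in (laurent n) P \<and>
      id e \<otimes>\<^bsub>ring_on (laurent n)\<^esub> a = id b" if a: "a \<in> carrier (ring_on (laurent n))" for a
  proof -
    obtain m where m: "single (int m) 1 * a \<in> rees n w" using laurent_shift_rees[of a n w] a by auto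
    have T: "single (int m) 1 \<in> rees n w" unfolding single_rees_iff by (auto simp: exponents_zero)
    have "single (int m) 1 \<notin> coeffs_in (laurent n) P"
    proof
      assume c: "single (int m) 1 \<in> coeffs_in (laurent n) P"
      have T': "single (- int m) 1 \<in> laurent n" using subring_onD(1,2)[OF subring_polys] by (auto simp: laurent_def lookup_single when_def)
      have "single (- int m) 1 * single (int m) 1 \<in> coeffs_in (laurent n) P"
        using prime T' c unfolding primeideal_ring_on_iff[OF subring_laurent] ideal_on_def by blast
      then show False using prime unfolding primeideal_ring_on_iff[OF subring_laurent] by (simp add: mult_single)
    qed
    then show ?thesis using m T by (intro bexI[of _ "single (int m) 1"] bexI[of _ "single (int m) 1 * a"]) auto
  qed
  moreover have "ideal (coeffs_in (laurent n) J) (ring_on (laurent n))"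
    using ideal_ring_on_iff[OF subring_laurent] ideal_coeffs_in_laurent[OF J] by blast
  ultimately show ?thesis
    using local_ring_at_restrict[OF L _ cring_ring_on[OF subring_rees] hom] unfolding sets by (simp add: comp_def)
qed

text \<open>The coefficient of \<open>T ^ d\<close> has weighted degree at most \<open>d\<close>;
  its part of degree exactly \<open>d\<close> is its leading part, or 0 if the bound is not
  attained.\<close>

lemma rho_coeffs_in:
  assumes F: "F \<in> coeffs_in (rees n w) J"
  shows "rho n w F \<in> lead_span (wlt n w) J"
  unfolding rho_def
proof (rule lead_span_sum)
  fix d
  have k: "wdeg n w a \<le> d" if "a \<in> keys (lookup F d)" for a
    using F that by (auto simp: coeffs_in_def rees_def)
  have fJ: "lookup F d \<in> J" using F by (simp add: coeffs_in_def)
  show "restr {a. wdeg n w a = d} (lookup F d) \<in> lead_span (wlt n w) J"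
  proof (cases "\<exists>a\<in>keys (lookup F d). wdeg n w a = d")
    case True
    then obtain a where a: "a \<in> keys (lookup F d)" "wdeg n w a = d" by auto
    have "restr {a. wdeg n w a = d} (lookup F d) = leading_part (wlt n w) (lookup F d)"
    proof (rule poly_mapping_eqI)
      fix x
      show "lookup (restr {a. wdeg n w a = d} (lookup F d)) x = lookup (leading_part (wlt n w) (lookup F d)) x"
      proof (cases "x \<in> keys (lookup F d)")
        case True
        then have "(\<forall>b\<in>keys (lookup F d). \<not> wlt n w x b) \<longleftrightarrow> wdeg n w x = d"
          using k[OF True] k a by (force simp: wlt_def)
        then show ?thesis by (auto simp: lookup_restr lookup_leading_part)
      qed (simp add: lookup_restr lookup_leading_part in_keys_iff)
    qed
    then show ?thesis using lead_span_base[OF fJ] by simp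
  next
    case False
    then have "restr {a. wdeg n w a = d} (lookup F d) = 0"
      by (intro poly_mapping_eqI) (auto simp: lookup_restr in_keys_iff)
    then show ?thesis by (simp add: lead_span.zero)
  qed
qed

text \<open>A leading part is the reduction of the homogenization at the exact weighted degree. So
  the homogenized ideal reduces to the full leading ideal.\<close>

lemma lead_span_rho:
  assumes J: "ideal_on (polys n) J" and x: "x \<in> lead_span (wlt n w) J"
  shows "\<exists>F\<in>coeffs_in (rees n w) J. rho n w F = x"
proof -
  have "x \<in> rho n w ` coeffs_in (rees n w) J"
  proof (rule lead_span_least[OF x])
    have zero: "0 \<in> coeffs_in (rees n w) J"
      using subring_onD(1)[OF subring_rees] ideal_onD(2)[OF J] by (simp add: coeffs_in_def)
    then show "0 \<in> rho n w ` coeffs_in (rees n w) J" by (metis imageI rho_zero)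
    fix g assume g: "g \<in> J"
    show "leading_part (wlt n w) g \<in> rho n w ` coeffs_in (rees n w) J"
    proof (cases "g = 0")
      case True
      then have "leading_part (wlt n w) g = rho n w 0" by (intro poly_mapping_eqI) (simp add: lookup_leading_part)
      then show ?thesis using zero by blast
    next
      case False
      then have ne: "wdeg n w ` keys g \<noteq> {}" by (metis image_is_empty poly_mapping_eqI in_keys_iff lookup_zero empty_iff)
      define d where "d = Max (wdeg n w ` keys g)"
      have d: "\<And>a. a \<in> keys g \<Longrightarrow> wdeg n w a \<le> d" "d \<in> wdeg n w ` keys g"
        unfolding d_def using ne by (auto intro: Max_in)
      have "single d g \<in> coeffs_in (rees n w) J"
        using d(1) g ideal_onD(1,2)[OF J] unfolding coeffs_in_def
        by (auto simp: single_rees_iff polys_def lookup_single when_def)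
      moreover have "rho n w (single d g) = leading_part (wlt n w) g"
      proof (rule poly_mapping_eqI)
        fix y
        show "lookup (rho n w (single d g)) y = lookup (leading_part (wlt n w) g) y"
        proof (cases "y \<in> keys g")
          case True
          have "(\<forall>b\<in>keys g. \<not> wlt n w y b) \<longleftrightarrow> wdeg n w y = d"
            using d(1)[OF True] d by (force simp: wlt_def)
          then show ?thesis by (simp add: rho_single lookup_restr lookup_leading_part)
        qed (simp add: rho_single lookup_restr lookup_leading_part in_keys_iff)
      qed
      ultimately show ?thesis by (metis imageI)
    qed
  next
    fix y z assume "y \<in> rho n w ` coeffs_in (rees n w) J" "z \<in> rho n w ` coeffs_in (rees n w) J"
    then obtain F G where FG: "F \<in> coeffs_in (rees n w) J" "G \<in> coeffs_in (rees n w) J" "y = rho n w F" "z = rho n w G" by auto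
    have "F + G \<in> rees n w" by (rule subring_onD(4)[OF subring_rees]) (use FG in \<open>simp_all add: coeffs_in_def\<close>)
    then have "F + G \<in> coeffs_in (rees n w) J"
      using FG ideal_onD(3)[OF J] by (simp add: coeffs_in_def lookup_add)
    then show "y + z \<in> rho n w ` coeffs_in (rees n w) J" using FG by (metis imageI rho_add)
  qed
  then show ?thesis by blast
qed

section \<open>The localized polynomial ring and its leading ideals\<close>

lemma localize_unit_lead:
  assumes lt: "monomial_preorder n lt"
  shows "localize (ring_on (polys n)) (unit_lead n lt :: ((nat \<Rightarrow>\<^sub>0 nat) \<Rightarrow>\<^sub>0 'k::field) set)"
proof -
  interpret cring "ring_on (polys n :: ((nat \<Rightarrow>\<^sub>0 nat) \<Rightarrow>\<^sub>0 'k) set)" by (rule cring_ring_on[OF subring_polys])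
  have S: "u \<in> unit_lead n lt \<longleftrightarrow> u \<in> polys n \<and> leading_part lt u = 1" for u :: "(nat \<Rightarrow>\<^sub>0 nat) \<Rightarrow>\<^sub>0 'k"
    by (simp add: unit_lead_def polynomial_ring_eq)
  have "leading_part lt (1 :: (nat \<Rightarrow>\<^sub>0 nat) \<Rightarrow>\<^sub>0 'k) = 1"
    by (rule poly_mapping_eqI) (use monomial_preorderD(1)[OF lt exponents_zero] in \<open>auto simp: lookup_leading_part lookup_one when_def\<close>)
  moreover have "leading_part lt (s * t) = 1" if "s \<in> unit_lead n lt" "t \<in> unit_lead n lt" for s t :: "(nat \<Rightarrow>\<^sub>0 nat) \<Rightarrow>\<^sub>0 'k"
    using leading_part_unit_mult[OF lt, of s t] S that by simp
  ultimately show ?thesis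
    by unfold_locales (use S subring_onD(2,5)[OF subring_polys[where 'k = 'k, of n]] in auto)
qed

text \<open>Clearing denominators by elements of \<open>unit_lead\<close> changes no leading part,
  so the choice in \<open>localized_leading_part\<close> does not matter and \<open>I\<close> may be
  replaced by its contraction \<open>J\<close> to \<open>k[X]\<close>.\<close>

lemma leading_ideal_eq:
  fixes I :: "'k::field fractions set"
  assumes lt: "monomial_preorder n lt" and I: "ideal I (localized_polynomial_ring n lt)"
    and J: "J = {f \<in> polys n. poly_to_localized n lt f \<in> I}"
  shows "leading_ideal n lt I = lead_span lt J" "ideal_on (polys n) J"
proof -
  let ?R = "ring_on (polys n :: ((nat \<Rightarrow>\<^sub>0 nat) \<Rightarrow>\<^sub>0 'k) set)" and ?S = "unit_lead n lt :: ((nat \<Rightarrow>\<^sub>0 nat) \<Rightarrow>\<^sub>0 'k) set"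
  let ?T = "localized_polynomial_ring n lt :: 'k fractions ring"
  let ?l = "poly_to_localized n lt :: ((nat \<Rightarrow>\<^sub>0 nat) \<Rightarrow>\<^sub>0 'k) \<Rightarrow> 'k fractions"
  interpret l: localize ?R ?S by (rule localize_unit_lead[OF lt])
  interpret I: ideal I ?T by (rule I)
  have T: "?T = localization ?R ?S" by (simp add: localized_polynomial_ring_def polynomial_ring_eq)
  have l: "?l f = frac ?R ?S f 1" for f by (simp add: poly_to_localized_def polynomial_ring_eq)
  have S: "u \<in> polys n" "leading_part lt u = 1" if "u \<in> ?S" for u
    using that by (simp_all add: unit_lead_def polynomial_ring_eq)
  have hom: "?l \<in> ring_hom ?R ?T" using l.frac_hom unfolding T l[abs_def] by simp
  have "ideal J ?R"
    using ideal_vimage_hom[OF l.is_cring _ hom I] l.cring_localization unfolding T J by simp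
  then show Jid: "ideal_on (polys n) J" using ideal_ring_on_iff[OF subring_polys] by blast
  define Q where "Q f p \<longleftrightarrow> p \<in> polys n \<and> (\<exists>u\<in>?S. ?l u \<otimes>\<^bsub>?T\<^esub> f = ?l p)" for f p
  have Q: "localized_leading_part n lt f = leading_part lt (SOME p. Q f p)" for f
    unfolding localized_leading_part_def Q_def by (simp add: polynomial_ring_eq)
  have ex: "\<exists>p. Q f p" if f: "f \<in> carrier ?T" for f
  proof -
    obtain a s where a: "a \<in> polys n" "s \<in> ?S" "f = frac ?R ?S a s"
      using f l.localization_cases unfolding T by auto
    have "?l s \<otimes>\<^bsub>?T\<^esub> f = frac ?R ?S (s * a) (s * 1)"
      unfolding T l a(3) using a l.one_S S by (simp add: l.frac_mult)
    also have "\<dots> = ?l a"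
      using l.frac_cancel[of a 1 s] a l.one_S unfolding l by simp
    finally show ?thesis unfolding Q_def using a by blast
  qed
  have "localized_leading_part n lt ` I = leading_part lt ` J"
  proof
    show "localized_leading_part n lt ` I \<subseteq> leading_part lt ` J"
    proof
      fix y assume "y \<in> localized_leading_part n lt ` I"
      then obtain f where f: "f \<in> I" "y = leading_part lt (SOME p. Q f p)" using Q by auto
      then have "Q f (SOME p. Q f p)" using someI_ex[OF ex[OF I.Icarr]] by blast
      then obtain u where u: "(SOME p. Q f p) \<in> polys n" "u \<in> ?S" "?l u \<otimes>\<^bsub>?T\<^esub> f = ?l (SOME p. Q f p)"
        unfolding Q_def by blast
      have "?l u \<in> carrier ?T" using ring_hom_closed[OF hom, of u] S(1)[OF u(2)] by simp
      then have "?l (SOME p. Q f p) \<in> I" using I.I_l_closed[OF f(1)] u(3) by metis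
      then show "y \<in> leading_part lt ` J" using u(1) f(2) unfolding J by blast
    qed
    show "leading_part lt ` J \<subseteq> localized_leading_part n lt ` I"
    proof
      fix y assume "y \<in> leading_part lt ` J"
      then obtain g where g: "g \<in> polys n" "?l g \<in> I" "y = leading_part lt g" unfolding J by auto
      define p where "p = (SOME p. Q (?l g) p)"
      have "Q (?l g) p" unfolding p_def using someI_ex[OF ex[OF I.Icarr[OF g(2)]]] .
      then obtain u where u: "p \<in> polys n" "u \<in> ?S" "?l u \<otimes>\<^bsub>?T\<^esub> ?l g = ?l p" unfolding Q_def by blast
      have ug: "u * g \<in> polys n" using subring_onD(5)[OF subring_polys S(1)[OF u(2)] g(1)] .
      have "?l (u * g) = ?l p" using ring_hom_mult[OF hom, of u g] S(1)[OF u(2)] g(1) u(3) by simp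
      \<comment> \<open>Equality of fractions holds only up to a further factor \<open>v\<close>,
        but this too has leading part 1.\<close>
      then obtain v where v: "v \<in> ?S" "v * (u * g) = v * p"
        using l.frac_eq_iff[of "u * g" p 1 1] ug u(1) l.one_S unfolding l by auto
      have "leading_part lt (v * (u * g)) = leading_part lt g"
        using leading_part_unit_mult[OF lt S[OF v(1)] ug] leading_part_unit_mult[OF lt S[OF u(2)] g(1)] by simp
      moreover have "leading_part lt (v * p) = leading_part lt p"
        using leading_part_unit_mult[OF lt S[OF v(1)] u(1)] .
      ultimately have "y = localized_leading_part n lt (?l g)" unfolding Q p_def[symmetric] g(3) v(2) by simp
      then show "y \<in> localized_leading_part n lt ` I" using g(2) by blast
    qed
  qed
  then show "leading_ideal n lt I = lead_span lt J"
    unfolding leading_ideal_def using genideal_leading_parts[OF lt Jid] by simp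
qed

text \<open>\<open>p\<close> is the contraction of the prime to \<open>k[X]\<close>. Elements with
  leading part 1 become units in the localized ring, so \<open>p\<close> avoids them.\<close>

lemma localized_quotient_prime:
  fixes I :: "'k::field fractions set"
  assumes lt: "monomial_preorder n lt" and I: "ideal I (localized_polynomial_ring n lt)"
    and J: "J = {f \<in> polys n. poly_to_localized n lt f \<in> I}"
    and P: "primeideal P (localized_polynomial_ring n lt Quot I)"
  shows "\<exists>p \<psi>. local_ring_at (ring_on (polys n)) J p \<psi> (localization_at (localized_polynomial_ring n lt Quot I) P) \<and>
    J \<subseteq> p \<and> p \<inter> unit_lead n lt = {}"
proof -
  let ?R = "ring_on (polys n :: ((nat \<Rightarrow>\<^sub>0 nat) \<Rightarrow>\<^sub>0 'k) set)" and ?S = "unit_lead n lt :: ((nat \<Rightarrow>\<^sub>0 nat) \<Rightarrow>\<^sub>0 'k) set"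
  let ?T = "localized_polynomial_ring n lt :: 'k fractions ring"
  let ?l = "poly_to_localized n lt :: ((nat \<Rightarrow>\<^sub>0 nat) \<Rightarrow>\<^sub>0 'k) \<Rightarrow> 'k fractions"
  interpret l: localize ?R ?S by (rule localize_unit_lead[OF lt])
  have T: "?T = localization ?R ?S" by (simp add: localized_polynomial_ring_def polynomial_ring_eq)
  have l: "?l f = frac ?R ?S f 1" for f by (simp add: poly_to_localized_def polynomial_ring_eq)
  have fr: "is_fraction_map ?R ?l ?T" using l.is_fraction_map_localization unfolding T l[abs_def] by simp
  then have cT: "cring ?T" and hom: "?l \<in> ring_hom ?R ?T" by (auto simp: is_fraction_map_def)
  note q = quotient_map[OF cT I]
  define P' where "P' = {a \<in> carrier ?T. I +>\<^bsub>?T\<^esub> a \<in> P}"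
  have P': "primeideal P' ?T" unfolding P'_def by (rule primeideal_vimage_hom[OF cT q(2) P])
  interpret P': primeideal P' ?T by (rule P')
  have I_car: "I \<subseteq> carrier ?T" using ideal.Icarr[OF I] by blast
  have "{a \<in> carrier ?T. I +>\<^bsub>?T\<^esub> a = \<zero>\<^bsub>?T Quot I\<^esub>} = I" using q(4) I_car by blast
  then have L: "local_ring_at ?T I P' ((\<lambda>a. frac (?T Quot I) (carrier (?T Quot I) - P) a \<one>\<^bsub>?T Quot I\<^esub>) \<circ> (+>\<^bsub>?T\<^esub>) I)
      (localization_at (?T Quot I) P)"
    using local_ring_at_surj[OF cT q(1,2,3) P] unfolding P'_def by simp
  have no_unit: "x \<notin> P'" if "x \<in> Units ?T" for x
  proof
    assume "x \<in> P'"
    then have "inv\<^bsub>?T\<^esub> x \<otimes>\<^bsub>?T\<^esub> x \<in> P'" using that by (intro P'.I_l_closed) auto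
    then show False using that P'.one_imp_carrier P'.I_notcarr by (simp add: P'.Units_l_inv)
  qed
  have mult: "\<exists>e\<in>carrier ?R. \<exists>b\<in>carrier ?R. ?l e \<notin> P' \<and> ?l e \<otimes>\<^bsub>?T\<^esub> a = ?l b" if a: "a \<in> carrier ?T" for a
  proof -
    obtain b s where b: "b \<in> carrier ?R" "s \<in> carrier ?R" "?l s \<in> Units ?T" "a \<otimes>\<^bsub>?T\<^esub> ?l s = ?l b"
      using fr a unfolding is_fraction_map_def by blast
    then have "?l s \<otimes>\<^bsub>?T\<^esub> a = ?l b" using P'.m_comm[OF a P'.Units_closed] by metis
    then show ?thesis using b no_unit by blast
  qed
  define p where "p = {f \<in> carrier ?R. ?l f \<in> P'}"
  have "J = {f \<in> carrier ?R. ?l f \<in> I}" unfolding J by simp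
  then have "local_ring_at ?R J p
      ((\<lambda>a. frac (?T Quot I) (carrier (?T Quot I) - P) a \<one>\<^bsub>?T Quot I\<^esub>) \<circ> (+>\<^bsub>?T\<^esub>) I \<circ> ?l) (localization_at (?T Quot I) P)"
    using local_ring_at_restrict[OF L I l.is_cring hom mult] unfolding p_def by simp
  moreover have "J \<subseteq> p"
  proof -
    have "I \<subseteq> P'"
    proof
      fix x assume x: "x \<in> I"
      have "\<zero>\<^bsub>?T Quot I\<^esub> \<in> P"
        using additive_subgroup.zero_closed[OF ideal.axioms(1)[OF primeideal.axioms(1)[OF P]]] .
      then show "x \<in> P'" unfolding P'_def using bspec[OF q(4), of x] x I_car by auto
    qed
    then show ?thesis unfolding J p_def by auto
  qed
  moreover have "p \<inter> ?S = {}"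
  proof -
    have "?l u \<in> Units ?T" if "u \<in> ?S" for u
      using l.frac_unit[OF that l.one_S] unfolding T l by simp
    then show ?thesis unfolding p_def using no_unit by blast
  qed
  ultimately show ?thesis by blast
qed

lemma field_ring_on_UNIV: "field (ring_on (UNIV :: 'k::field set))"
proof -
  have "subring_on (UNIV :: 'k set)" by (simp add: subring_on_def)
  then interpret cring "ring_on (UNIV :: 'k set)" by (rule cring_ring_on)
  show ?thesis
  proof (rule cring_fieldI)
    show "Units (ring_on (UNIV :: 'k set)) = carrier (ring_on UNIV) - {\<zero>\<^bsub>ring_on (UNIV :: 'k set)\<^esub>}"
      unfolding Units_def by auto (metis left_inverse right_inverse)
  qed
qed

text \<open>\<open>open_property\<close> asks for a base field in the universe type as well, so
  \<open>k\<close> is replaced by a copy \<open>F\<close> and the embedding of the constants is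
  transported.\<close>

lemma fin_gen_algebra_rees:
  fixes B :: "'u ring" and h :: "'k::field graded \<Rightarrow> 'u"
  assumes u: "(UNIV :: 'k set) \<lesssim> (UNIV :: 'u set)"
    and B: "cring B" and h: "h \<in> ring_hom (ring_on (rees n w)) B" "h ` rees n w = carrier B"
  shows "\<exists>(F :: 'u ring) \<phi>. field F \<and> fin_gen_algebra F \<phi> B"
proof -
  let ?D = "ring_on (rees n w) :: 'k graded ring"
  let ?k = "ring_on (UNIV :: 'k set)"
  note D = subring_onD[OF subring_rees[where 'k = 'k, of n w]]
  interpret D: cring ?D by (rule cring_ring_on[OF subring_rees])
  interpret B: cring B by (rule B)
  interpret h: ring_hom_cring ?D B h using h B D.is_cring by (intro UnivPoly.ring_hom_cringI) auto
  interpret k: field ?k by (rule field_ring_on_UNIV)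
  obtain f :: "'k \<Rightarrow> 'u" where f: "inj f" using u unfolding lepoll_def by auto
  define F where "F = image_ring f ?k"
  have F: "field F" unfolding F_def using f by (intro k.inj_imp_image_ring_is_field) simp
  have iso: "f \<in> ring_iso ?k F" unfolding F_def using f by (intro inj_imp_image_ring_iso) simp
  define c :: "'k \<Rightarrow> 'k graded" where "c x = single 0 (single 0 x)" for x
  have cD: "c x \<in> rees n w" for x by (auto simp: c_def single_rees_iff exponents_zero split: if_splits)
  have c_hom: "c \<in> ring_hom ?k ?D"
    by (rule ring_hom_memI) (use cD in \<open>auto simp: c_def mult_single single_add\<close>)
  define \<phi> where "\<phi> = h \<circ> c \<circ> inv_into (carrier ?k) f"
  have inv: "inv_into (carrier ?k) f \<in> ring_hom F ?k"
    using ring_iso_set_sym[OF k.ring_axioms iso] by (simp add: ring_iso_def)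
  have phi: "\<phi> \<in> ring_hom F B"
    unfolding \<phi>_def by (intro ring_hom_trans[OF inv] ring_hom_trans[OF c_hom h(1)])
  have img: "\<phi> ` carrier F = h ` rees_consts"
  proof -
    have "carrier F = f ` UNIV" unfolding F_def by (simp add: image_ring_carrier)
    then have "\<phi> ` carrier F = (\<lambda>x. h (c x)) ` UNIV"
      unfolding \<phi>_def image_image using inv_into_f_f[OF f] by (simp add: image_image)
    then show ?thesis by (simp add: rees_consts_def c_def image_image)
  qed
  define E where "E = h ` set (rees_gens n w)"
  have gens: "set (rees_gens n w) \<subseteq> rees n w" "rees_consts \<subseteq> (rees n w :: 'k graded set)"
    unfolding rees_generated using adjoin_list_props(2,3)[OF subring_rees_consts] by auto
  let ?G = "generate_ring B (\<phi> ` carrier F \<union> E)"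
  have sub: "\<phi> ` carrier F \<union> E \<subseteq> carrier B"
    unfolding img E_def using gens h(2) by blast
  \<comment> \<open>The preimage of the subring generated in \<open>B\<close>: a subring that
    contains the constants and generators of the Rees algebra, hence all of it.\<close>
  define X where "X = {x \<in> rees n w. h x \<in> ?G}"
  have "subring_on X"
    unfolding subring_on_def
  proof (intro conjI ballI)
    show "0 \<in> X" unfolding X_def using h.hom_zero B.zero_in_generate D(1) by simp
    show "1 \<in> X" unfolding X_def using h.hom_one generate_ring.one D(2) by (metis (mono_tags, lifting) mem_Collect_eq ring_on_simps(3))
    fix x assume x: "x \<in> X"
    have "\<ominus>\<^bsub>?D\<^esub> x = - x" by (rule D.minus_equality) (use x D(3) in \<open>auto simp: X_def\<close>)
    then have "h (- x) = \<ominus>\<^bsub>B\<^esub> h x" using h.hom_a_inv[of x] x by (simp add: X_def)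
    moreover have hx: "x \<in> rees n w" "h x \<in> ?G" using x unfolding X_def by simp_all
    ultimately show "- x \<in> X" using D(3)[OF hx(1)] generate_ring.a_inv[OF hx(2)] unfolding X_def by simp
    fix y assume y: "y \<in> X"
    then have hy: "y \<in> rees n w" "h y \<in> ?G" unfolding X_def by simp_all
    have "h (x + y) = h x \<oplus>\<^bsub>B\<^esub> h y" "h (x * y) = h x \<otimes>\<^bsub>B\<^esub> h y"
      using h.hom_add[of x y] h.hom_mult[of x y] x y by (simp_all add: X_def)
    then show "x + y \<in> X" "x * y \<in> X"
      using D(4,5)[OF hx(1) hy(1)] generate_ring.eng_add[OF hx(2) hy(2)] generate_ring.eng_mult[OF hx(2) hy(2)]
      unfolding X_def by simp_all
  qed
  moreover have "rees_consts \<subseteq> X" "set (rees_gens n w) \<subseteq> X"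
  proof -
    have "h x \<in> ?G" if "x \<in> rees_consts \<union> set (rees_gens n w)" for x
      by (rule generate_ring.incl) (use that in \<open>auto simp: img E_def\<close>)
    then show "rees_consts \<subseteq> X" "set (rees_gens n w) \<subseteq> X" unfolding X_def using gens by auto
  qed
  ultimately have "rees n w \<subseteq> X" unfolding rees_generated by (intro adjoin_list_least)
  then have "carrier B \<subseteq> ?G" unfolding h(2)[symmetric] X_def by blast
  then have "?G = carrier B" using B.generate_ring_incl[OF sub] by blast
  then have "fin_gen_algebra F \<phi> B"
    unfolding fin_gen_algebra_def using B phi sub by (intro conjI exI[of _ E]) (auto simp: E_def)
  then show ?thesis using F by blast
qed

text \<open>The ring \<open>B \<cong> rees n w / JJ\<close> degenerates \<open>k[X]/J\<close> to \<open>k[X]/lead_span J\<close>: the latter is the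
  quotient by the non-zerodivisor \<open>T = ?t\<close>, and inverting \<open>T\<close> gives \<open>(k[X]/J)[T, 1/T]\<close>.\<close>

lemma property_at_prime:
  fixes PP :: "'u ring \<Rightarrow> bool" and J p :: "((nat \<Rightarrow>\<^sub>0 nat) \<Rightarrow>\<^sub>0 'k::field) set"
  assumes u: "infinite (UNIV :: 'u set)" "(UNIV :: 'k set) \<lesssim> (UNIV :: 'u set)"
    and op: "open_property PP" and fa: "faithful_property PP"
    and J: "ideal_on (polys n) J" and Jp: "J \<subseteq> p" and L: "local_ring_at (ring_on (polys n)) J p \<psi> L"
    and proper: "1 \<notin> lead_span (wlt n w) p"
    and hyp: "\<And>P. P \<in> spec (ring_on (polys n) Quot lead_span (wlt n w) J) \<Longrightarrow>
      holds_at PP (ring_on (polys n) Quot lead_span (wlt n w) J) P"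
  shows "has_property PP L"
proof -
  let ?R = "ring_on (polys n) :: ((nat \<Rightarrow>\<^sub>0 nat) \<Rightarrow>\<^sub>0 'k) ring"
  let ?D = "ring_on (rees n w) :: 'k graded ring"
  let ?lt = "wlt n w"
  let ?t = "single 1 1 :: 'k graded"
  note lt = monomial_preorder_wlt[of n w]
  note D = subring_onD[OF subring_rees[where 'k = 'k, of n w]]
  have cR: "cring ?R" by (rule cring_ring_on[OF subring_polys])
  have cD: "cring ?D" by (rule cring_ring_on[OF subring_rees])
  have nR: "noetherian_ring ?R" and nD: "noetherian_ring ?D"
    using noetherian_ring_on noetherian_polys noetherian_rees by blast+
  have p: "primeideal p ?R" using L by (simp add: local_ring_at_def)
  have p_on: "ideal_on (polys n) p" using p primeideal_ring_on_iff[OF subring_polys] by blast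
  define Ld where "Ld = lead_span ?lt J"
  have Ld: "ideal Ld ?R" "ideal (lead_span ?lt p) ?R"
    unfolding Ld_def using ideal_lead_span[OF lt] J p_on ideal_ring_on_iff[OF subring_polys] by blast+
  \<comment> \<open>A point where the special fibre meets the homogenization of \<open>p\<close>; it
    exists because the leading ideal of \<open>p\<close> is proper.\<close>
  obtain q where q: "primeideal q ?R" "lead_span ?lt p \<subseteq> q"
    using noetherian_ring.ex_prime_ideal_above[OF nR cR Ld(2)] proper by auto
  have Ld_q: "Ld \<subseteq> q" unfolding Ld_def using lead_span_mono[OF Jp] q(2) by blast
  define JJ where "JJ = coeffs_in (rees n w) J"
  define pp where "pp = coeffs_in (rees n w) p"
  define rh where "rh = (rho n w :: 'k graded \<Rightarrow> _)"
  have rh: "rh \<in> ring_hom ?D ?R" "rh ` carrier ?D = carrier ?R"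
    unfolding rh_def using rho_surj[of n w] by (auto intro!: ring_hom_memI simp: rho_polys rho_add rho_mult)
  define QQ where "QQ = {F \<in> carrier ?D. rh F \<in> q}"
  define KK where "KK = {F \<in> carrier ?D. rh F \<in> Ld}"
  have QQ: "primeideal QQ ?D" unfolding QQ_def by (rule primeideal_vimage_hom[OF cD rh(1) q(1)])
  have KK: "ideal KK ?D" unfolding KK_def by (rule ideal_vimage_hom[OF cD cR rh(1) Ld(1)])
  interpret QQ: primeideal QQ ?D by (rule QQ)
  have JJ_KK: "JJ \<subseteq> KK" and pp_QQ: "pp \<subseteq> QQ" and KK_QQ: "KK \<subseteq> QQ" and t_KK: "?t \<in> KK"
  proof -
    show "JJ \<subseteq> KK"
    proof
      fix F assume "F \<in> JJ"
      then show "F \<in> KK" using rho_coeffs_in[of F n w J] unfolding JJ_def KK_def rh_def Ld_def coeffs_in_def by simp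
    qed
    show "pp \<subseteq> QQ"
    proof
      fix F assume "F \<in> pp"
      then show "F \<in> QQ" using rho_coeffs_in[of F n w p] q(2) unfolding pp_def QQ_def rh_def coeffs_in_def by auto
    qed
    show "KK \<subseteq> QQ" unfolding KK_def QQ_def using Ld_q by blast
    have "0 \<in> Ld" unfolding Ld_def by (rule lead_span.zero)
    moreover have "?t \<in> rees n w" "rho n w ?t = 0" by (rule T_rees, rule rho_T)
    ultimately show "?t \<in> KK" unfolding KK_def rh_def by simp
  qed
  have JJ_pp: "JJ \<subseteq> pp" unfolding JJ_def pp_def coeffs_in_def using Jp by auto
  have t_QQ: "?t \<in> QQ" using t_KK KK_QQ by blast

  have JJ_on: "ideal_on (rees n w) JJ"
  proof -
    note I = ideal_onD[OF ideal_coeffs_in_laurent[OF J]]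
    have "JJ = rees n w \<inter> coeffs_in (laurent n) J"
      unfolding JJ_def coeffs_in_def using rees_laurent[of n w] by blast
    moreover have "f * x \<in> coeffs_in (laurent n) J" if "f \<in> rees n w" "x \<in> coeffs_in (laurent n) J" for f x
      using I(4)[OF subsetD[OF rees_laurent that(1)] that(2)] .
    ultimately show ?thesis
      unfolding ideal_on_def using I(2,3) D(1,4,5) by simp
  qed
  have JJ: "ideal JJ ?D" using JJ_on ideal_ring_on_iff[OF subring_rees] by blast
  \<comment> \<open>Multiplication by \<open>T\<close> only shifts the coefficients, and membership
    in \<open>JJ\<close> is tested on coefficients.\<close>
  have t_regular: "F \<in> JJ" if "F \<in> rees n w" "?t * F \<in> JJ" for F
  proof -
    have "lookup F d \<in> J" for d
    proof -
      have "lookup (?t * F) (d + 1) \<in> J" using that(2) unfolding JJ_def coeffs_in_def by blast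
      then show ?thesis by (simp add: lookup_single_mult_group)
    qed
    then show ?thesis using that(1) unfolding JJ_def coeffs_in_def by blast
  qed
  \<comment> \<open>\<open>KK\<close> is \<open>JJ\<close> plus the multiples of \<open>T\<close>:
    an element whose reduction lies in the leading ideal has the same reduction as some element of
    \<open>JJ\<close>, and the difference is divisible by \<open>T\<close>.\<close>
  have KK_mod: "\<exists>d\<in>carrier ?D. a \<ominus>\<^bsub>?D\<^esub> ?t \<otimes>\<^bsub>?D\<^esub> d \<in> JJ" if a: "a \<in> KK" for a
  proof -
    have aD: "a \<in> rees n w" "rho n w a \<in> lead_span ?lt J" using a unfolding KK_def rh_def Ld_def by auto
    obtain F where F: "F \<in> JJ" "rho n w F = rho n w a" using lead_span_rho[OF J aD(2)] unfolding JJ_def by blast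
    have FD: "F \<in> rees n w" using F unfolding JJ_def coeffs_in_def by blast
    have "rho n w (a - F) = 0"
      using rho_add[of n w "a - F" F] F(2) by simp
    then obtain G where G: "G \<in> rees n w" "a - F = ?t * G" using rho_kernel[OF D(6)[OF aD(1) FD]] by blast
    have "a \<ominus>\<^bsub>?D\<^esub> ?t \<otimes>\<^bsub>?D\<^esub> G = a - ?t * G"
      using ring_on_minus[OF subring_rees aD(1) D(5)[OF T_rees G(1)]] by simp
    then have "a \<ominus>\<^bsub>?D\<^esub> ?t \<otimes>\<^bsub>?D\<^esub> G = F" using G(2) by (simp add: algebra_simps)
    then show ?thesis using F G by auto
  qed

  \<comment> \<open>Read over the Rees algebra, the hypothesis at the image of \<open>q\<close>
    concerns the local ring at \<open>QQ\<close> modulo \<open>KK\<close>.\<close>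
  have "\<exists>\<chi> L0. local_ring_at ?D KK QQ \<chi> (L0 :: (((nat \<Rightarrow>\<^sub>0 nat) \<Rightarrow>\<^sub>0 'k) set \<times> ((nat \<Rightarrow>\<^sub>0 nat) \<Rightarrow>\<^sub>0 'k) set) set ring) \<and>
      has_property PP L0"
  proof -
    note qm = quotient_map[OF cR Ld(1)]
    note s = local_ring_at_surj_image[OF cR qm(1,2,3) q(1) qm(4) Ld_q]
    have "has_property PP (localization_at (?R Quot Ld) ((+>\<^bsub>?R\<^esub>) Ld ` q))"
      using hyp s(1) unfolding spec_def holds_at_def Ld_def by simp
    then show ?thesis
      using local_ring_at_pullback[OF cD cR rh s(2)] unfolding KK_def QQ_def by blast
  qed
  then obtain \<chi> and L0 :: "(((nat \<Rightarrow>\<^sub>0 nat) \<Rightarrow>\<^sub>0 'k) set \<times> ((nat \<Rightarrow>\<^sub>0 nat) \<Rightarrow>\<^sub>0 'k) set) set ring"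
    where L0: "local_ring_at ?D KK QQ \<chi> L0" "has_property PP L0" by blast

  note qD = quotient_map[OF cD JJ]
  have lepollD: "carrier ?D \<lesssim> (UNIV :: 'u set)" "carrier ?R \<lesssim> (UNIV :: 'u set)"
    using graded_lepoll[OF u] lepoll_UNIV_subset by blast+
  have "carrier (?D Quot JJ) \<lesssim> (UNIV :: 'u set)"
    by (rule is_fraction_map_lepoll[OF is_fraction_map_surj[OF cD qD(1,2,3)] lepollD(1) u(1)])
  \<comment> \<open>The total space of the degeneration, copied into the universe because openness
    is stated for algebras there.\<close>
  then obtain B :: "'u ring" and g where B: "cring B" "g \<in> ring_iso (?D Quot JJ) B"
    using ex_iso_copy[OF qD(1)] by blast
  define h where "h = g \<circ> (+>\<^bsub>?D\<^esub>) JJ"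
  have g: "g \<in> ring_hom (?D Quot JJ) B" "g ` carrier (?D Quot JJ) = carrier B" "inj_on g (carrier (?D Quot JJ))"
    using B(2) unfolding ring_iso_def bij_betw_def by auto
  interpret g: ring_hom_cring "?D Quot JJ" B g using g B qD(1) by (intro UnivPoly.ring_hom_cringI) auto
  have h: "h \<in> ring_hom ?D B" "h ` carrier ?D = carrier B"
    unfolding h_def image_comp[symmetric] qD(3) g(2) by (rule ring_hom_trans[OF qD(2) g(1)], rule refl)
  have h0: "\<forall>a\<in>carrier ?D. h a = \<zero>\<^bsub>B\<^esub> \<longleftrightarrow> a \<in> JJ"
  proof
    fix a assume a: "a \<in> carrier ?D"
    have ac: "JJ +>\<^bsub>?D\<^esub> a \<in> carrier (?D Quot JJ)" using qD(3) a by blast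
    have "g (JJ +>\<^bsub>?D\<^esub> a) = g \<zero>\<^bsub>?D Quot JJ\<^esub> \<longleftrightarrow> JJ +>\<^bsub>?D\<^esub> a = \<zero>\<^bsub>?D Quot JJ\<^esub>"
      using inj_on_eq_iff[OF g(3) ac g.R.zero_closed] .
    then show "h a = \<zero>\<^bsub>B\<^esub> \<longleftrightarrow> a \<in> JJ" unfolding h_def comp_def g.hom_zero bspec[OF qD(4) a] .
  qed
  note sQ = local_ring_at_surj_image[OF cD B(1) h QQ h0 order.trans[OF JJ_KK KK_QQ]]

  have "has_property PP (localization_at B (h ` QQ))"
  proof -
    have "carrier (localization_at B (h ` QQ)) \<lesssim> (UNIV :: 'u set)"
      using is_fraction_map_lepoll[OF _ lepollD(1) u(1)] sQ(2) unfolding local_ring_at_def by blast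
    then obtain L' :: "'u ring" and f where L': "cring L'" "f \<in> ring_iso (localization_at B (h ` QQ)) L'"
      using ex_iso_copy local_ring_at_local(1)[OF sQ(2)] by blast
    define \<chi>' where "\<chi>' = f \<circ> ((\<lambda>a. frac B (carrier B - h ` QQ) a \<one>\<^bsub>B\<^esub>) \<circ> h)"
    have L'_at: "local_ring_at ?D JJ QQ \<chi>' L'" unfolding \<chi>'_def by (rule local_ring_at_iso[OF sQ(2) L'])
    have fr: "is_fraction_map ?D \<chi>' L'" and hom: "\<chi>' \<in> ring_hom ?D L'"
      and ker: "\<And>a. a \<in> carrier ?D \<Longrightarrow> \<chi>' a = \<zero>\<^bsub>L'\<^esub> \<longleftrightarrow> (\<exists>s\<in>carrier ?D - QQ. s \<otimes>\<^bsub>?D\<^esub> a \<in> JJ)"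
      and U: "\<And>a. a \<in> carrier ?D \<Longrightarrow> \<chi>' a \<in> Units L' \<longleftrightarrow> a \<notin> QQ"
      using L'_at by (auto simp: local_ring_at_def is_fraction_map_def)
    interpret L': cring L' by (rule L'(1))
    interpret c: ring_hom_cring ?D L' \<chi>' using hom L'(1) cD by (intro UnivPoly.ring_hom_cringI) auto
    have tD: "?t \<in> carrier ?D" using T_rees by simp
    \<comment> \<open>Regularity of \<open>T\<close> modulo \<open>JJ\<close> passes to fractions: a
      relation in \<open>L'\<close> holds modulo \<open>JJ\<close> after multiplication by an
      element outside \<open>QQ\<close>.\<close>
    have "non_zerodivisor L' (\<chi>' ?t)"
      unfolding non_zerodivisor_def
    proof (intro conjI ballI impI)
      show "\<chi>' ?t \<in> carrier L'" using tD by (rule c.hom_closed)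
      fix x assume x: "x \<in> carrier L'" "\<chi>' ?t \<otimes>\<^bsub>L'\<^esub> x = \<zero>\<^bsub>L'\<^esub>"
      obtain a s where a: "a \<in> carrier ?D" "s \<in> carrier ?D" "\<chi>' s \<in> Units L'" "x \<otimes>\<^bsub>L'\<^esub> \<chi>' s = \<chi>' a"
        using fr x(1) unfolding is_fraction_map_def by blast
      have "\<chi>' (?t \<otimes>\<^bsub>?D\<^esub> a) = \<chi>' ?t \<otimes>\<^bsub>L'\<^esub> (x \<otimes>\<^bsub>L'\<^esub> \<chi>' s)"
        unfolding a(4) by (rule c.hom_mult[OF tD a(1)])
      also have "\<dots> = (\<chi>' ?t \<otimes>\<^bsub>L'\<^esub> x) \<otimes>\<^bsub>L'\<^esub> \<chi>' s"
        using L'.m_assoc[OF c.hom_closed[OF tD] x(1) c.hom_closed[OF a(2)]] by simp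
      also have "\<dots> = \<zero>\<^bsub>L'\<^esub>" unfolding x(2) by (rule L'.l_null[OF c.hom_closed[OF a(2)]])
      finally have z: "\<chi>' (?t \<otimes>\<^bsub>?D\<^esub> a) = \<zero>\<^bsub>L'\<^esub>" .
      have ta: "?t \<otimes>\<^bsub>?D\<^esub> a \<in> carrier ?D" using D(5)[OF T_rees] a(1) by simp
      obtain s' where s': "s' \<in> rees n w" "s' \<notin> QQ" "s' * (?t * a) \<in> JJ"
        using ker[OF ta] z by auto
      have "?t * (s' * a) \<in> JJ" using s'(3) by (simp add: mult.left_commute)
      then have "s' * a \<in> JJ" using t_regular D(5)[OF s'(1)] a(1) by simp
      then have "\<chi>' a = \<zero>\<^bsub>L'\<^esub>" using ker[OF a(1)] s' by auto
      then have "x \<otimes>\<^bsub>L'\<^esub> \<chi>' s = \<zero>\<^bsub>L'\<^esub> \<otimes>\<^bsub>L'\<^esub> \<chi>' s" using a(4) L'.l_null[OF c.hom_closed[OF a(2)]] by simp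
      then show "x = \<zero>\<^bsub>L'\<^esub>"
        using L'.Units_l_cancel[OF a(3) x(1) L'.zero_closed] L'.m_comm c.hom_closed[OF a(2)] x(1) L'.zero_closed by metis
    qed
    \<comment> \<open>Modulo \<open>T\<close>, the ring \<open>L'\<close> and the local ring
      \<open>L0\<close> of the special fibre have the same presentation by \<open>KK\<close> and
      \<open>QQ\<close>.\<close>
    moreover have "has_property PP (L' Quot (PIdl\<^bsub>L'\<^esub> (\<chi>' ?t)))"
      using local_ring_at_has_property[OF L0(1) local_ring_at_quotient[OF L'_at t_QQ KK KK_QQ JJ_KK t_KK KK_mod] L0(2)] .
    moreover have "\<chi>' ?t \<in> carrier L' - Units L'" using U[OF tD] t_QQ c.hom_closed[OF tD] by simp
    ultimately have "has_property PP L'"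
      using fa is_fraction_map_noetherian[OF fr nD] local_ring_at_local(2,3)[OF L'_at]
      unfolding faithful_property_def by blast
    then show ?thesis by (rule local_ring_at_has_property[OF L'_at sQ(2)])
  qed
  then have QQ_in: "h ` QQ \<in> spec_property PP B"
    using sQ(1) unfolding spec_property_def spec_def holds_at_def by simp

  have "\<exists>(F :: 'u ring) \<phi>. field F \<and> fin_gen_algebra F \<phi> B"
    by (rule fin_gen_algebra_rees[OF u(2) B(1)]) (use h in simp_all)
  then have "zariski_open B (spec_property PP B)" using op unfolding open_property_def by blast
  then obtain Z where Z: "spec_property PP B = spec B - {P \<in> spec B. Z \<subseteq> P}" unfolding zariski_open_def by blast
  define PL where "PL = coeffs_in (laurent n) p"
  define JL where "JL = coeffs_in (laurent n) J"
  have PL: "primeideal PL (ring_on (laurent n))" unfolding PL_def by (rule prime_coeffs_in_laurent[OF p])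
  have JL: "ideal JL (ring_on (laurent n))"
    unfolding JL_def using ideal_coeffs_in_laurent[OF J] ideal_ring_on_iff[OF subring_laurent] by blast
  have JL_PL: "JL \<subseteq> PL" unfolding JL_def PL_def coeffs_in_def using Jp by auto
  note qL = quotient_map[OF cring_ring_on[OF subring_laurent] JL]
  note LL = local_ring_at_surj_image(2)[OF cring_ring_on[OF subring_laurent] qL(1,2,3) PL qL(4) JL_PL]
  note LD = local_ring_at_laurent_rees[OF J LL[unfolded JL_def PL_def], of w, folded JJ_def pp_def]
  have pp: "primeideal pp ?D" using LD by (simp add: local_ring_at_def)
  note sp = local_ring_at_surj_image[OF cD B(1) h pp h0 JJ_pp]
  \<comment> \<open>Generization: if the smaller prime contained \<open>Z\<close>, so would the
    larger one.\<close>
  have "h ` pp \<in> spec_property PP B"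
    using QQ_in sp(1) pp_QQ unfolding Z spec_def by blast
  then have "has_property PP (localization_at B (h ` pp))" unfolding spec_property_def holds_at_def by blast
  note prop_LL = local_ring_at_has_property[OF sp(2) LD this]

  have "carrier L \<lesssim> (UNIV :: 'u set)"
    using is_fraction_map_lepoll[OF _ lepollD(2) u(1)] L unfolding local_ring_at_def by blast
  then obtain C :: "'u ring" and f where C: "cring C" "f \<in> ring_iso L C"
    using ex_iso_copy local_ring_at_local(1)[OF L] by blast
  note C_at = local_ring_at_iso[OF L C]
  have J': "ideal J ?R" using J ideal_ring_on_iff[OF subring_polys] by blast
  \<comment> \<open>\<open>W\<close> and \<open>W'\<close> present the same local ring over
    \<open>k[X][T]\<close>: as \<open>C[T]\<close> localized at the extended maximal ideal, and as
    the local ring of the degeneration where \<open>T\<close> is invertible.\<close>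
  note W = local_ring_at_UP[OF C_at J' refl]
  note W' = local_ring_at_laurent_UP[OF J LL[unfolded JL_def PL_def]]
  have "has_property PP (localization_at (UP C) (extended_ideal C (carrier C - Units C)))"
    by (rule local_ring_at_has_property[OF W' W]) (use prop_LL in \<open>simp add: JL_def PL_def\<close>)
  moreover have "noetherian_ring C"
    using C_at is_fraction_map_noetherian[OF _ nR] unfolding local_ring_at_def by blast
  ultimately have "has_property PP C"
    using fa local_ring_at_local(2,3)[OF C_at] unfolding faithful_property_def by blast
  then show ?thesis by (rule local_ring_at_has_property[OF C_at L])
qed

theorem corollary4p6:
  fixes n :: nat
    and lt :: "(nat \<Rightarrow>\<^sub>0 nat) \<Rightarrow> (nat \<Rightarrow>\<^sub>0 nat) \<Rightarrow> bool"
    and PP :: "'u ring \<Rightarrow> bool"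
    and I :: "'k::field fractions set"
  assumes universe: "infinite (UNIV :: 'u set)" "(UNIV :: 'k set) \<lesssim> (UNIV :: 'u set)"
    and "monomial_preorder n lt"
    and "local_ring_property PP"
    and "open_property PP"
    and "faithful_property PP"
    and "ideal I (localized_polynomial_ring n lt)"
    and "\<forall>P \<in> spec (polynomial_ring n Quot leading_ideal n lt I).
           holds_at PP (polynomial_ring n Quot leading_ideal n lt I) P"
  shows "\<forall>P \<in> spec (localized_polynomial_ring n lt Quot I).
           holds_at PP (localized_polynomial_ring n lt Quot I) P"
proof
  fix P assume "P \<in> spec (localized_polynomial_ring n lt Quot I)"
  then have P: "primeideal P (localized_polynomial_ring n lt Quot I)" by (simp add: spec_def)
  note lt = assms(3)
  define J where "J = {f \<in> polys n. poly_to_localized n lt f \<in> I}"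
  note lead = leading_ideal_eq[OF lt assms(7) J_def]
  obtain p \<psi> where L: "local_ring_at (ring_on (polys n)) J p \<psi> (localization_at (localized_polynomial_ring n lt Quot I) P)"
    and p: "J \<subseteq> p" "p \<inter> unit_lead n lt = {}"
    using localized_quotient_prime[OF lt assms(7) J_def P] by blast
  have p_on: "ideal_on (polys n) p"
    using L primeideal_ring_on_iff[OF subring_polys] unfolding local_ring_at_def by blast
  \<comment> \<open>The finite sets \<open>K1\<close> and \<open>K2\<close> determine the leading
    ideals of \<open>J\<close> and of \<open>p\<close>. One weight must serve both: \<open>J\<close>
    for the use of the hypothesis, \<open>p\<close> for a prime of the special fibre above
    it.\<close>
  obtain K1 where K1: "finite K1" "K1 \<subseteq> exponents n" "\<And>lt'. monomial_preorder n lt' \<Longrightarrow>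
      \<forall>a\<in>K1. \<forall>b\<in>K1. lt' a b \<longleftrightarrow> lt a b \<Longrightarrow> lead_span lt' J = lead_span lt J"
    using ex_support_of_lead_span[OF lt lead(2)] by blast
  obtain K2 where K2: "finite K2" "K2 \<subseteq> exponents n" "\<And>lt'. monomial_preorder n lt' \<Longrightarrow>
      \<forall>a\<in>K2. \<forall>b\<in>K2. lt' a b \<longleftrightarrow> lt a b \<Longrightarrow> lead_span lt' p = lead_span lt p"
    using ex_support_of_lead_span[OF lt p_on] by blast
  obtain w where w: "\<forall>a\<in>K1 \<union> K2. \<forall>b\<in>K1 \<union> K2. wlt n w a b \<longleftrightarrow> lt a b"
    using ex_weight[OF lt finite_UnI[OF K1(1) K2(1)] Un_least[OF K1(2) K2(2)]] by blast
  have eq: "lead_span (wlt n w) J = lead_span lt J" "lead_span (wlt n w) p = lead_span lt p"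
    using K1(3)[OF monomial_preorder_wlt] K2(3)[OF monomial_preorder_wlt] w by blast+
  \<comment> \<open>An element of \<open>p\<close> with leading part 1 would be an invertible
    denominator of the localized ring.\<close>
  have "1 \<notin> lead_span (wlt n w) p"
  proof
    assume "1 \<in> lead_span (wlt n w) p"
    then obtain g where "g \<in> p" "leading_part lt g = 1" using one_in_lead_span[OF lt p_on] eq by auto
    moreover from this have "g \<in> polys n" using ideal_onD(1)[OF p_on] by blast
    ultimately show False using p(2) by (auto simp: unit_lead_def polynomial_ring_eq)
  qed
  then show "holds_at PP (localized_polynomial_ring n lt Quot I) P"
    unfolding holds_at_def
  proof (rule property_at_prime[OF universe assms(5,6) lead(2) p(1) L])
    fix P' assume P': "P' \<in> spec (ring_on (polys n) Quot lead_span (wlt n w) J)"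
    show "holds_at PP (ring_on (polys n) Quot lead_span (wlt n w) J) P'"
      using bspec[OF assms(8)[unfolded lead(1) polynomial_ring_eq] P'[unfolded eq]] unfolding eq .
  qed
qed

end
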